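(* Let $M$ be a $7$-dimensional Riemannian spin manifold, $P_i,P_j$ principal $E_8$-bundles over $M$ (with connections), and $g:M\to SO(N)$ smooth, $N$ even and large enough, having a lift $g^\Delta:M\to\mathrm{Spin}(N)$. Suppose $c_3(E,g,d)=0$. With $\kappa=8$ and $\mathbf c,m_0,m_1,m_2,b_1,b_2,\eta_0,\eta_1,\eta_2$ as defined in the context, one has $$\Big\{e^{\frac1{720}\mathbf c}\widehat A(TM,\nabla^{TM})\big[m_2\eta_0+m_1\eta_1+m_0\eta_2+b_1(m_1\eta_0+m_0\eta_1)+b_2m_0\eta_0\big]\Big\}^{(7)}$$ $$=196560\Big\{e^{\frac1{720}\mathbf c}\widehat A(TM,\nabla^{TM})\,m_0\eta_0\Big\}^{(7)}-24\Big\{e^{\frac1{720}\mathbf c}\widehat A(TM,\nabla^{TM})\big[m_1\eta_0+m_0\eta_1+b_1m_0\eta_0\big]\Big\}^{(7)}.$$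
   Context: $\{\cdot\}^{(n)}$ is the degree-$n$ component of a differential form. $\widehat A(TM,\nabla^{TM})=\det^{1/2}\Big(\frac{\frac{\sqrt{-1}}{4\pi}R^{TM}}{\sinh(\frac{\sqrt{-1}}{4\pi}R^{TM})}\Big)$, $R^{TM}$ the Levi-Civita curvature; $\mathrm{ch}(F)=\mathrm{tr}\exp(\frac{\sqrt{-1}}{2\pi}R^F)$, extended additively to virtual bundles, with induced connections. For a bundle $F$, $\widetilde F=F-\dim F$; exterior and symmetric powers of virtual bundles are defined by $\wedge_t(F-G)=\wedge_t(F)/\wedge_t(G)$, $S_t(F)=1/\wedge_{-t}(F)$, where $\wedge_t(F)=\sum t^k\wedge^kF$, $S_t(F)=\sum t^kS^kF$. Tangent data: $\triangle(M)$ is the complex spinor bundle of $M$, $\widetilde T=\widetilde{T_{\mathbf C}M}$, $T_{\mathbf C}M=TM\otimes\mathbf C$. For a constant $\kappa$: $m_0=\mathrm{ch}(\triangle(M))+\kappa$; $m_1=\mathrm{ch}(\triangle(M)\otimes2\widetilde T)+\kappa\,\mathrm{ch}(\widetilde T+\wedge^2\widetilde T)$; $m_2=\mathrm{ch}(\triangle(M)\otimes(2\widetilde T+\wedge^2\widetilde T+\widetilde T\otimes\widetilde T+S^2\widetilde T))+\kappa\,\mathrm{ch}(\wedge^4\widetilde T+\wedge^2\widetilde T\otimes\widetilde T+\widetilde T\otimes\widetilde T+S^2\widetilde T+\widetilde T)$. $E_8\times E_8$ data: $V_k$ is the $E_8$-representation on the degree-$k$ graded piece of the basic representation of affine $E_8$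 ($V_1$ the adjoint representation, $\dim248$; $V_2=\mathbf1\oplus\mathbf{248}\oplus\mathbf{3875}$); $W_i=P_i\times_{E_8}V_1$, $\overline{W_i}=P_i\times_{E_8}V_2$, and similarly $W_j,\overline{W_j}$ from $P_j$; $c_2$ denotes the second Chern form; $\mathbf c=c_2(W_i)+c_2(W_j)$; $W_iW_j=W_i\otimes W_j$. Put $b_1=\mathrm{ch}(W_i+W_j-16)-\frac1{30}\mathbf c$, $b_2=\mathrm{ch}(-16W_i-16W_j+W_iW_j+\overline{W_i}+\overline{W_j}+104)-\frac1{30}\mathbf c\,\mathrm{ch}(W_i+W_j-16)+\frac12\big(-6+\frac1{30}\mathbf c\big)\cdot\frac1{30}\mathbf c$. Odd Chern character data: $E$ is the trivial real rank-$N$ bundle over $M$ with trivial metric and connection $d$, $E_{\mathbf C}$ its complexification, $\Delta(E)$ its (trivial) spinor bundle of rank $2^{N/2}$; $c_3(E,g,d)=(\frac1{2\pi\sqrt{-1}})^2\mathrm{Tr}[(g^{-1}dg)^3]$ (a differential form). For a bundle $F$ built from $\Delta(E)$ and $E_{\mathbf C}$ by tensor operations, let $g_F$ be the automorphism of the trivial bundle $F$ induced by $g$ and $g^\Delta$, and $\mathrm{ch}(F,g,d)=\sum_{n\ge1}\frac{n!}{(2n+1)!}\big(\frac1{2\pi\sqrt{-1}}\big)^{n+1}\mathrm{Tr}[(g_F^{-1}dg_F)^{2n+1}]$, extended additively to virtual bundles. Put, with $\widetilde E=\widetilde{E_{\mathbf C}}$, $\eta_0=\mathrm{ch}(\Delta(E),g^{\Delta(E)},d)$,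 $\eta_1=\mathrm{ch}(\Delta(E)\otimes(2\wedge^2\widetilde E-\widetilde E\otimes\widetilde E+\widetilde E),g,d)$, $\eta_2=\mathrm{ch}(\Delta(E)\otimes(\wedge^2\widetilde E\otimes\wedge^2\widetilde E+2\wedge^4\widetilde E-2\widetilde E\otimes\wedge^3\widetilde E+2\widetilde E\otimes\wedge^2\widetilde E-\widetilde E\otimes\widetilde E\otimes\widetilde E+\widetilde E+\wedge^2\widetilde E),g,d)$. *)

theory Defs
  imports "HOL-Analysis.Analysis" "Jordan_Normal_Form.Determinant"
begin

hide_const (open) Finite_Cartesian_Product.mat Finite_Cartesian_Product.vec Determinants.det
hide_type (open) Finite_Cartesian_Product.vec
unbundle no vec_syntax

type_synonym 'n coords = "(real, 'n) Finite_Cartesian_Product.vec"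

section \<open>The exterior algebra\<close>

text \<open>
  An element of the complexified exterior algebra of the dual of real coordinate space with
  coordinates indexed by \<open>'n\<close> is given by its coefficients in the basis of the monomials
  \<open>dx\<^sub>I\<close>, factors in increasing order. The index \<open>{}\<close> belongs to the unit.
\<close>

datatype 'n form = Form (coeff: "'n set \<Rightarrow> complex")

definition shuffle_sign :: "'n::linorder set \<Rightarrow> 'n set \<Rightarrow> complex" where
  "shuffle_sign I J = (-1) ^ card {(i, j). i \<in> I \<and> j \<in> J \<and> j < i}"

instantiation form :: ("{finite, linorder}") ring_1
begin

definition "0 = Form (\<lambda>I. 0)"
definition "1 = Form (\<lambda>I. if I = {} then 1 else 0)"
definition "a + b = Form (\<lambda>I. coeff a I + coeff b I)"
definition "- a = Form (\<lambda>I. - coeff a I)"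
definition "a - b = Form (\<lambda>I. coeff a I - coeff b I)"
definition "a * b = Form (\<lambda>K. \<Sum>I\<in>Pow K. shuffle_sign I (K - I) * coeff a I * coeff b (K - I))"

instance
proof
  fix a b c :: "'a form"
  have fin: "finite A" for A :: "'a set" by simp
  have fin2: "finite A" for A :: "('a \<times> 'a) set" by simp
  have split1: "shuffle_sign (I \<union> J) K = shuffle_sign I K * shuffle_sign J K"
    if "I \<inter> J = {}" for I J K :: "'a set"
  proof -
    have "{(i, j). i \<in> I \<union> J \<and> j \<in> K \<and> j < i} =
      {(i, j). i \<in> I \<and> j \<in> K \<and> j < i} \<union> {(i, j). i \<in> J \<and> j \<in> K \<and> j < i}" by auto
    moreover have "{(i, j). i \<in> I \<and> j \<in> K \<and> j < i} \<inter> {(i, j). i \<in> J \<and> j \<in> K \<and> j < i} = {}"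
      using that by auto
    ultimately show ?thesis
      unfolding shuffle_sign_def by (simp only: card_Un_disjoint[OF fin2 fin2] power_add)
  qed
  have split2: "shuffle_sign K (I \<union> J) = shuffle_sign K I * shuffle_sign K J"
    if "I \<inter> J = {}" for I J K :: "'a set"
  proof -
    have "{(i, j). i \<in> K \<and> j \<in> I \<union> J \<and> j < i} =
      {(i, j). i \<in> K \<and> j \<in> I \<and> j < i} \<union> {(i, j). i \<in> K \<and> j \<in> J \<and> j < i}" by auto
    moreover have "{(i, j). i \<in> K \<and> j \<in> I \<and> j < i} \<inter> {(i, j). i \<in> K \<and> j \<in> J \<and> j < i} = {}"
      using that by auto
    ultimately show ?thesis
      unfolding shuffle_sign_def by (simp only: card_Un_disjoint[OF fin2 fin2] power_add)
  qed
  have s1: "shuffle_sign {} J = 1" "shuffle_sign J {} = 1" for J :: "'a set"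
    unfolding shuffle_sign_def by simp_all
  show "a * b * c = a * (b * c)"
  proof -
    have "(\<Sum>L\<in>Pow K. shuffle_sign L (K - L) *
            (\<Sum>I\<in>Pow L. shuffle_sign I (L - I) * coeff a I * coeff b (L - I)) * coeff c (K - L)) =
          (\<Sum>I\<in>Pow K. shuffle_sign I (K - I) * coeff a I *
            (\<Sum>J\<in>Pow (K - I). shuffle_sign J (K - I - J) * coeff b J * coeff c (K - I - J)))"
      (is "?l = ?r") for K
    proof -
      have "?l = (\<Sum>L\<in>Pow K. \<Sum>I\<in>Pow L. shuffle_sign L (K - L) *
            (shuffle_sign I (L - I) * coeff a I * coeff b (L - I)) * coeff c (K - L))"
        by (simp add: sum_distrib_left sum_distrib_right)
      also have "\<dots> = (\<Sum>(L, I)\<in>Sigma (Pow K) Pow. shuffle_sign L (K - L) *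
            (shuffle_sign I (L - I) * coeff a I * coeff b (L - I)) * coeff c (K - L))"
        by (subst sum.Sigma) (auto intro: fin)
      also have "\<dots> = (\<Sum>(I, J)\<in>Sigma (Pow K) (\<lambda>I. Pow (K - I)). shuffle_sign I (K - I) * coeff a I *
            (shuffle_sign J (K - I - J) * coeff b J * coeff c (K - I - J)))"
      proof (rule sum.reindex_bij_witness[where i = "\<lambda>(I, J). (I \<union> J, I)" and j = "\<lambda>(L, I). (I, L - I)"],
          goal_cases)
        case (5 x)
        obtain L I where x: "x = (L, I)" by (cases x)
        with 5 have LI: "L \<subseteq> K" "I \<subseteq> L" by auto
        have e1: "K - I - (L - I) = K - L" using LI by auto
        have "shuffle_sign L (K - L) = shuffle_sign I (K - L) * shuffle_sign (L - I) (K - L)"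
          using split1[of I "L - I" "K - L"] LI by (simp add: Un_absorb1)
        moreover have "K - I = (L - I) \<union> (K - L)" using LI by auto
        then have "shuffle_sign I (K - I) = shuffle_sign I (L - I) * shuffle_sign I (K - L)"
          using split2[of "L - I" "K - L" I] by (metis Diff_disjoint Diff_Int_distrib2 Diff_Diff_Int
            Int_Diff inf_bot_left inf_commute Diff_eq_empty_iff Int_lower2)
        ultimately show ?case unfolding x using e1 by simp
      qed auto
      also have "\<dots> = ?r"
        by (subst sum.Sigma[symmetric]) (auto intro: fin simp: sum_distrib_left)
      finally show ?thesis .
    qed
    then show ?thesis by (simp add: times_form_def)
  qed
  show "a + b + c = a + (b + c)" "a + b = b + a" "0 + a = a" "- a + a = 0" "a - b = a + - b"
    by (simp_all add: plus_form_def zero_form_def uminus_form_def minus_form_def algebra_simps)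
  show "(a + b) * c = a * c + b * c" "a * (b + c) = a * b + a * c"
    by (simp_all add: plus_form_def times_form_def algebra_simps sum.distrib)
  show "1 * a = a"
  proof -
    have "(\<Sum>I\<in>Pow K. shuffle_sign I (K - I) * coeff 1 I * coeff a (K - I)) = coeff a K" for K
    proof -
      have "(\<Sum>I\<in>Pow K. shuffle_sign I (K - I) * coeff 1 I * coeff a (K - I)) =
        (\<Sum>I\<in>{{}}. shuffle_sign I (K - I) * coeff 1 I * coeff a (K - I))"
        by (rule sum.mono_neutral_right) (auto intro: fin simp: one_form_def)
      then show ?thesis by (simp add: one_form_def s1)
    qed
    then show ?thesis by (simp add: times_form_def)
  qed
  show "a * 1 = a"
  proof -
    have "(\<Sum>I\<in>Pow K. shuffle_sign I (K - I) * coeff a I * coeff 1 (K - I)) = coeff a K" for K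
    proof -
      have "(\<Sum>I\<in>Pow K. shuffle_sign I (K - I) * coeff a I * coeff 1 (K - I)) =
        (\<Sum>I\<in>{K}. shuffle_sign I (K - I) * coeff a I * coeff 1 (K - I))"
        by (rule sum.mono_neutral_right) (auto intro: fin simp: one_form_def)
      then show ?thesis by (simp add: one_form_def s1)
    qed
    then show ?thesis by (simp add: times_form_def)
  qed
  show "(0 :: 'a form) \<noteq> 1"
    by (auto simp: zero_form_def one_form_def dest: fun_cong[of _ _ "{}"])
qed

end

definition fconst :: "complex \<Rightarrow> 'n form" where
  "fconst c = Form (\<lambda>I. if I = {} then c else 0)"

definition dx :: "'n \<Rightarrow> 'n form" where
  "dx i = Form (\<lambda>I. if I = {i} then 1 else 0)"

definition degree_part :: "nat \<Rightarrow> 'n form \<Rightarrow> 'n form" where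
  "degree_part k a = Form (\<lambda>I. if card I = k then coeff a I else 0)"

definition extd :: "('n coords \<Rightarrow> 'n::{finite, linorder} form) \<Rightarrow> 'n coords \<Rightarrow> 'n form" where
  "extd f x = (\<Sum>i\<in>UNIV. dx i *
     Form (\<lambda>I. frechet_derivative (\<lambda>y. coeff (f y) I) (at x) (axis i 1)))"

text \<open>
  The power series below are applied to forms (or matrices of forms) without component of degree
  less than two; these are nilpotent of order at most \<open>CARD('n)\<close>, so the sums contain all the nonzero terms.
\<close>

definition fexp :: "'n::{finite, linorder} form \<Rightarrow> 'n form" where
  "fexp a = (\<Sum>k\<le>CARD('n). fconst (1 / fact k) * a ^ k)"

text \<open>Square root of a form with constant term 1, by the binomial series.\<close>

definition fsqrt :: "'n::{finite, linorder} form \<Rightarrow> 'n form" where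
  "fsqrt a = (\<Sum>k\<le>CARD('n). fconst ((1/2) gchoose k) * (a - 1) ^ k)"

section \<open>Matrices\<close>

definition mtrace :: "'a::comm_monoid_add mat \<Rightarrow> 'a" where
  "mtrace A = (\<Sum>i<dim_row A. A $$ (i, i))"

text \<open>
  Leibniz formula; \<^const>\<open>Determinant.det\<close> is not available because the exterior algebra is not
  commutative. It is used for matrices of even forms only.
\<close>

definition fdet :: "'n::{finite, linorder} form mat \<Rightarrow> 'n form" where
  "fdet A = (\<Sum>p | p permutes {0..<dim_row A}.
     of_int (sign p) * prod_list (map (\<lambda>i. A $$ (i, p i)) [0..<dim_row A]))"

definition msum :: "nat \<Rightarrow> (nat \<Rightarrow> 'a::monoid_add mat) \<Rightarrow> nat list \<Rightarrow> 'a mat" where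
  "msum n f ks = foldr (+) (map f ks) (0\<^sub>m n n)"

definition minv :: "complex mat \<Rightarrow> complex mat" where
  "minv A = (THE B. B \<in> carrier_mat (dim_row A) (dim_row A) \<and>
     A * B = 1\<^sub>m (dim_row A) \<and> B * A = 1\<^sub>m (dim_row A))"

definition mexp :: "complex mat \<Rightarrow> complex mat" where
  "mexp X = mat (dim_row X) (dim_row X) (\<lambda>(i, j). \<Sum>k. (X ^\<^sub>m k) $$ (i, j) / fact k)"

definition kron :: "'a::times mat \<Rightarrow> 'a mat \<Rightarrow> 'a mat" where
  "kron A B = mat (dim_row A * dim_row B) (dim_col A * dim_col B)
     (\<lambda>(i, j). A $$ (i div dim_row B, j div dim_col B) * B $$ (i mod dim_row B, j mod dim_col B))"

text \<open>
  The basis of the \<open>k\<close>-th exterior power of \<open>n\<close>-space is indexed by the increasing lists of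
  length \<open>k\<close>. \<open>ext_mat\<close> is the action of an endomorphism on the exterior power as an algebra
  homomorphism, \<open>ext_der\<close> its action as a derivation.
\<close>

definition ext_basis :: "nat \<Rightarrow> nat \<Rightarrow> nat list list" where
  "ext_basis n k = filter (\<lambda>I. length I = k) (subseqs [0..<n])"

definition ext_mat :: "nat \<Rightarrow> complex mat \<Rightarrow> complex mat" where
  "ext_mat k A = (let B = ext_basis (dim_row A) k in mat (length B) (length B)
     (\<lambda>(p, q). det (mat k k (\<lambda>(r, s). A $$ (B ! p ! r, B ! q ! s)))))"

text \<open>The coefficient of the basis vector \<open>e\<^sub>I\<close> in \<open>e\<^bsub>J!0\<^esub> \<and> e\<^bsub>J!1\<^esub> \<and> \<dots>\<close>.\<close>

definition ext_pairing :: "nat list \<Rightarrow> nat list \<Rightarrow> complex" where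
  "ext_pairing I J = det (mat (length I) (length I) (\<lambda>(r, s). if I ! r = J ! s then 1 else 0))"

definition ext_der :: "nat \<Rightarrow> 'n::{finite, linorder} form mat \<Rightarrow> 'n form mat" where
  "ext_der k A = (let n = dim_row A; B = ext_basis n k in mat (length B) (length B)
     (\<lambda>(p, q). \<Sum>s<k. \<Sum>i<n. fconst (ext_pairing (B ! p) ((B ! q)[s := i])) * A $$ (i, B ! q ! s)))"

section \<open>Virtual bundles and their tensor operations\<close>

class tensor_bundle =
  fixes bundle_rank :: "'a \<Rightarrow> nat"
    and trivial :: "nat \<Rightarrow> 'a"
    and tensor :: "'a \<Rightarrow> 'a \<Rightarrow> 'a"
    and ext_power :: "nat \<Rightarrow> 'a \<Rightarrow> 'a"

text \<open>A virtual bundle is a formal integral combination of bundles.\<close>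

datatype 'b virt = Virt (summands: "(int \<times> 'b) list")

definition bun :: "'b \<Rightarrow> 'b virt" where "bun b = Virt [(1, b)]"

definition vscale :: "int \<Rightarrow> 'b virt \<Rightarrow> 'b virt" (infixr \<open>\<odot>\<close> 72) where
  "k \<odot> V = Virt (map (\<lambda>(n, b). (k * n, b)) (summands V))"

instantiation virt :: (type) "{zero, plus, uminus, minus}"
begin
definition "0 = Virt []"
definition "V + W = Virt (summands V @ summands W)"
definition "- V = (-1) \<odot> V"
definition "V - W = V + (- W :: 'a virt)"
instance ..
end

instantiation virt :: (tensor_bundle) "{one, times}"
begin
definition "1 = bun (trivial 1)"
definition "V * W = Virt [(m * n, tensor a b). (m, a) \<leftarrow> summands V, (n, b) \<leftarrow> summands W]"
instance ..
end

definition vsum :: "'b virt list \<Rightarrow> 'b virt" where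
  "vsum Vs = foldr (+) Vs 0"

definition reduced :: "'b::tensor_bundle \<Rightarrow> 'b virt" where
  "reduced b = bun b - bun (trivial (bundle_rank b))"

text \<open>
  Power series in \<open>t\<close> are sequences of virtual bundles. \<open>ext_mult F P\<close> is the product of \<open>P\<close>
  with the exterior power series of \<open>F\<close>, and \<open>ext_div F P\<close> the quotient.
\<close>

definition ext_mult :: "'b::tensor_bundle \<Rightarrow> (nat \<Rightarrow> 'b virt) \<Rightarrow> nat \<Rightarrow> 'b virt" where
  "ext_mult F P k = vsum (map (\<lambda>j. bun (ext_power j F) * P (k - j)) [0..<Suc k])"

fun ext_div :: "'b::tensor_bundle \<Rightarrow> (nat \<Rightarrow> 'b virt) \<Rightarrow> nat \<Rightarrow> 'b virt" where
  "ext_div F P k = P k - vsum (map (\<lambda>j. bun (ext_power j F) * ext_div F P (k - j)) [1..<Suc k])"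

definition vext :: "nat \<Rightarrow> 'b::tensor_bundle virt \<Rightarrow> 'b virt" where
  "vext k V = foldr
     (\<lambda>(n, F) P. if n \<ge> 0 then (ext_mult F ^^ nat n) P else (ext_div F ^^ nat (- n)) P)
     (summands V) (\<lambda>k. if k = 0 then 1 else 0) k"

text \<open>The coefficients of the inverse of the alternating exterior power series.\<close>

fun vsym :: "nat \<Rightarrow> 'b::tensor_bundle virt \<Rightarrow> 'b virt" where
  "vsym k V = (if k = 0 then 1
     else vsum (map (\<lambda>j. (-1) ^ (j + 1) \<odot> (vext j V * vsym (k - j) V)) [1..<Suc k]))"

subsection \<open>Bundles with connection\<close>

text \<open>
  A bundle over a coordinate domain with a frame and a connection: rank and connection matrix,
  the covariant derivative of the section with components \<open>s\<close> being \<open>ds + A s\<close>.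
\<close>

datatype 'n cbundle = CBundle (crank: nat) (conn: "'n coords \<Rightarrow> 'n form mat")

instantiation cbundle :: ("{finite, linorder}") tensor_bundle
begin
definition "bundle_rank b = crank b"
definition "trivial n = CBundle n (\<lambda>_. 0\<^sub>m n n)"
definition "tensor a b = CBundle (crank a * crank b)
  (\<lambda>x. kron (conn a x) (1\<^sub>m (crank b)) + kron (1\<^sub>m (crank a)) (conn b x))"
definition "ext_power k b = CBundle (length (ext_basis (crank b) k)) (\<lambda>x. ext_der k (conn b x))"
instance ..
end

definition curvature :: "'n::{finite, linorder} cbundle \<Rightarrow> 'n coords \<Rightarrow> 'n form mat" where
  "curvature b x =
     mat (crank b) (crank b) (\<lambda>(r, s). extd (\<lambda>y. conn b y $$ (r, s)) x) + conn b x * conn b x"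

text \<open>Trace of the exponential of \<open>\<i>/2\<pi>\<close> times the curvature.\<close>

definition chern_char :: "'n::{finite, linorder} cbundle \<Rightarrow> 'n coords \<Rightarrow> 'n form" where
  "chern_char b x = (\<Sum>k\<le>CARD('n).
     fconst ((\<i> / (2 * pi)) ^ k / fact k) * mtrace (curvature b x ^\<^sub>m k))"

definition ch :: "'n::{finite, linorder} cbundle virt \<Rightarrow> 'n coords \<Rightarrow> 'n form" where
  "ch V x = (\<Sum>(n, b)\<leftarrow>summands V. of_int n * chern_char b x)"

definition chern2 :: "'n::{finite, linorder} cbundle \<Rightarrow> 'n coords \<Rightarrow> 'n form" where
  "chern2 b x = degree_part 4
     (fdet (1\<^sub>m (crank b) + fconst (\<i> / (2 * pi)) \<cdot>\<^sub>m curvature b x))"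

text \<open>
  \<open>mat_x_over_sinh X\<close> is the inverse of \<open>sinh X / X = \<Sum> X\<^bsup>2k\<^esup>/(2k+1)!\<close>, computed by the
  geometric series.
\<close>

definition mat_x_over_sinh :: "'n::{finite, linorder} form mat \<Rightarrow> 'n form mat" where
  "mat_x_over_sinh X = (let n = dim_row X;
       S = msum n (\<lambda>k. fconst (1 / fact (2 * k + 1)) \<cdot>\<^sub>m (X ^\<^sub>m (2 * k))) [0..<Suc CARD('n)]
     in msum n (\<lambda>j. (1\<^sub>m n - S) ^\<^sub>m j) [0..<Suc CARD('n)])"

definition A_hat :: "'n::{finite, linorder} cbundle \<Rightarrow> 'n coords \<Rightarrow> 'n form" where
  "A_hat b x = fsqrt (fdet (mat_x_over_sinh (fconst (\<i> / (4 * pi)) \<cdot>\<^sub>m curvature b x)))"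

subsection \<open>Trivial bundles with automorphism\<close>

text \<open>Trivial bundle over a coordinate domain: rank and matrix of the automorphism.\<close>

datatype 'n abundle = ABundle (arank: nat) (aut: "'n coords \<Rightarrow> complex mat")

instantiation abundle :: (finite) tensor_bundle
begin
definition "bundle_rank b = arank b"
definition "trivial n = ABundle n (\<lambda>_. 1\<^sub>m n)"
definition "tensor a b = ABundle (arank a * arank b) (\<lambda>x. kron (aut a x) (aut b x))"
definition "ext_power k b = ABundle (length (ext_basis (arank b) k)) (\<lambda>x. ext_mat k (aut b x))"
instance ..
end

definition maurer_cartan :: "'n::{finite, linorder} abundle \<Rightarrow> 'n coords \<Rightarrow> 'n form mat" where
  "maurer_cartan b x = map_mat fconst (minv (aut b x)) *
     mat (arank b) (arank b) (\<lambda>(r, s). extd (\<lambda>y. fconst (aut b y $$ (r, s))) x)"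

text \<open>The terms of the series with \<open>n > CARD('n)\<close> vanish for degree reasons.\<close>

definition odd_chern_char :: "'n::{finite, linorder} abundle \<Rightarrow> 'n coords \<Rightarrow> 'n form" where
  "odd_chern_char b x = (\<Sum>n = 1..CARD('n).
     fconst (fact n / fact (2 * n + 1) * (1 / (2 * pi * \<i>)) ^ (n + 1)) *
     mtrace (maurer_cartan b x ^\<^sub>m (2 * n + 1)))"

definition odd_ch :: "'n::{finite, linorder} abundle virt \<Rightarrow> 'n coords \<Rightarrow> 'n form" where
  "odd_ch V x = (\<Sum>(n, b)\<leftarrow>summands V. of_int n * odd_chern_char b x)"

definition chern_form3 :: "'n::{finite, linorder} abundle \<Rightarrow> 'n coords \<Rightarrow> 'n form" where
  "chern_form3 b x = fconst ((1 / (2 * pi * \<i>)) ^ 2) * mtrace (maurer_cartan b x ^\<^sub>m 3)"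

section \<open>Oriented Riemannian 7-manifolds\<close>

primrec cont_diff :: "nat \<Rightarrow> (real^'n) set \<Rightarrow> (real^'n \<Rightarrow> 'b::real_normed_vector) \<Rightarrow> bool" where
  "cont_diff 0 S f = continuous_on S f"
| "cont_diff (Suc k) S f = ((\<forall>x\<in>S. f differentiable (at x)) \<and>
     (\<forall>i. cont_diff k S (\<lambda>x. frechet_derivative f (at x) (axis i 1))))"

text \<open>Meant for open \<open>S\<close>.\<close>

definition smooth_on :: "(real^'n) set \<Rightarrow> (real^'n \<Rightarrow> 'b::real_normed_vector) \<Rightarrow> bool" where
  "smooth_on S f = (\<forall>k. cont_diff k S f)"

definition smooth_mat_on ::
  "(real^'n) set \<Rightarrow> nat \<Rightarrow> (real^'n \<Rightarrow> 'b::real_normed_vector mat) \<Rightarrow> bool" where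
  "smooth_mat_on S n f = (\<forall>r<n. \<forall>s<n. smooth_on S (\<lambda>x. f x $$ (r, s)))"

definition dmat :: "nat \<Rightarrow> (real^'n \<Rightarrow> complex mat) \<Rightarrow> real^'n \<Rightarrow> real^'n \<Rightarrow> complex mat" where
  "dmat n f x v = mat n n (\<lambda>(r, s). frechet_derivative (\<lambda>y. f y $$ (r, s)) (at x) v)"

type_synonym 'a chart = "'a set \<times> ('a \<Rightarrow> real^7)"

record 'a manifold =
  space_of :: "'a topology"
  atlas :: "'a chart set"

definition chart_inv :: "'a chart \<Rightarrow> real^7 \<Rightarrow> 'a" where
  "chart_inv c = inv_into (fst c) (snd c)"

definition chart_change :: "'a chart \<Rightarrow> 'a chart \<Rightarrow> real^7 \<Rightarrow> real^7" where
  "chart_change c c' = snd c' \<circ> chart_inv c"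

definition dchange :: "'a chart \<Rightarrow> 'a chart \<Rightarrow> real^7 \<Rightarrow> real^7 \<Rightarrow> real^7" where
  "dchange c c' y = frechet_derivative (chart_change c c') (at y)"

text \<open>
  Determinant of the vectors \<open>e 0, \<dots>, e 6\<close>. The coordinates of \<open>real^7\<close> are the elements
  \<open>0, \<dots>, 6\<close> of type \<open>7\<close>.
\<close>

definition frame_det :: "(nat \<Rightarrow> real^7) \<Rightarrow> real" where
  "frame_det e = det (mat 7 7 (\<lambda>(r, s). vec_nth (e s) (of_nat r)))"

definition oriented_manifold :: "'a manifold \<Rightarrow> bool" where
  "oriented_manifold M \<longleftrightarrow>
     Hausdorff_space (space_of M) \<and> second_countable (space_of M) \<and>
     (\<Union>c\<in>atlas M. fst c) = topspace (space_of M) \<and>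
     (\<forall>(U, \<phi>)\<in>atlas M. openin (space_of M) U \<and> open (\<phi> ` U) \<and>
        homeomorphic_map (subtopology (space_of M) U) (top_of_set (\<phi> ` U)) \<phi>) \<and>
     (\<forall>c\<in>atlas M. \<forall>c'\<in>atlas M.
        smooth_on (snd c ` (fst c \<inter> fst c')) (chart_change c c') \<and>
        (\<forall>y\<in>snd c ` (fst c \<inter> fst c').
           frame_det (\<lambda>i. dchange c c' y (axis (of_nat i) 1)) > 0))"

definition smooth_map :: "'a manifold \<Rightarrow> 'a set \<Rightarrow> nat \<Rightarrow> ('a \<Rightarrow> 'b::real_normed_vector mat) \<Rightarrow> bool"
  where "smooth_map M U n f =
     (\<forall>c\<in>atlas M. smooth_mat_on (snd c ` (fst c \<inter> U)) n (f \<circ> chart_inv c))"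

text \<open>Metric tensors in charts: \<open>met c y v w\<close> is the product of \<open>v\<close> and \<open>w\<close> at the point \<open>y\<close>.\<close>

type_synonym 'a metric_tensor = "'a chart \<Rightarrow> real^7 \<Rightarrow> real^7 \<Rightarrow> real^7 \<Rightarrow> real"

definition riemannian_metric :: "'a manifold \<Rightarrow> 'a metric_tensor \<Rightarrow> bool" where
  "riemannian_metric M met \<longleftrightarrow>
     (\<forall>c\<in>atlas M.
        (\<forall>v w. smooth_on (snd c ` fst c) (\<lambda>y. met c y v w)) \<and>
        (\<forall>y\<in>snd c ` fst c.
           bilinear (met c y) \<and>
           (\<forall>v w. met c y v w = met c y w v) \<and> (\<forall>v. v \<noteq> 0 \<longrightarrow> met c y v v > 0)) \<and>
        (\<forall>c'\<in>atlas M. \<forall>y\<in>snd c ` (fst c \<inter> fst c'). \<forall>v w.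
           met c y v w = met c' (chart_change c c' y) (dchange c c' y v) (dchange c c' y w)))"

text \<open>
  The product of \<open>e i\<close> with the Levi-Civita covariant derivative of \<open>e j\<close> in direction \<open>v\<close>, for a
  metric \<open>h\<close> and a frame \<open>e\<close> on a coordinate domain; the second summand is the Christoffel symbol of
  the first kind.
\<close>

definition levi_civita :: "(real^7 \<Rightarrow> real^7 \<Rightarrow> real^7 \<Rightarrow> real) \<Rightarrow> (nat \<Rightarrow> real^7 \<Rightarrow> real^7) \<Rightarrow>
    nat \<Rightarrow> nat \<Rightarrow> real^7 \<Rightarrow> real^7 \<Rightarrow> real" where
  "levi_civita h e i j y v =
     h y (e i y) (frechet_derivative (e j) (at y) v) +
     (frechet_derivative (\<lambda>z. h z (e j y) (e i y)) (at y) v +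
      frechet_derivative (\<lambda>z. h z v (e i y)) (at y) (e j y) -
      frechet_derivative (\<lambda>z. h z v (e j y)) (at y) (e i y)) / 2"

definition one_form_mat :: "nat \<Rightarrow> ('n coords \<Rightarrow> complex mat) \<Rightarrow> 'n::{finite, linorder} form mat" where
  "one_form_mat n \<alpha> = mat n n (\<lambda>(r, s). \<Sum>i\<in>UNIV. fconst (\<alpha> (axis i 1) $$ (r, s)) * dx i)"

text \<open>The complexified tangent bundle with the Levi-Civita connection in the orthonormal frame \<open>e\<close>.\<close>

definition tangent_bundle ::
  "(real^7 \<Rightarrow> real^7 \<Rightarrow> real^7 \<Rightarrow> real) \<Rightarrow> (nat \<Rightarrow> real^7 \<Rightarrow> real^7) \<Rightarrow> 7 cbundle" where
  "tangent_bundle h e = CBundle 7 (\<lambda>y. one_form_mat 7 (\<lambda>v.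
     mat 7 7 (\<lambda>(i, j). of_real (levi_civita h e i j y v))))"

section \<open>Spin groups\<close>

text \<open>
  Hermitian Clifford generators \<open>gamma m 0, \<dots>, gamma m (2*m)\<close> of size \<open>2\<^sup>m\<close>, built from Pauli
  matrices.
\<close>

definition pauli1 :: "complex mat" where
  "pauli1 = mat_of_rows_list 2 [[0, 1], [1, 0]]"
definition pauli2 :: "complex mat" where
  "pauli2 = mat_of_rows_list 2 [[0, - \<i>], [\<i>, 0]]"
definition pauli3 :: "complex mat" where
  "pauli3 = mat_of_rows_list 2 [[1, 0], [0, - 1]]"

primrec gamma :: "nat \<Rightarrow> nat \<Rightarrow> complex mat" where
  "gamma 0 k = 1\<^sub>m 1"
| "gamma (Suc m) k =
     (if k = 0 then kron pauli1 (1\<^sub>m (2 ^ m))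
      else if k = 1 then kron pauli2 (1\<^sub>m (2 ^ m))
      else kron pauli3 (gamma m (k - 2)))"

text \<open>
  The generators \<open>clifford_gen n k\<close>, \<open>k < n\<close>, have square \<open>-1\<close> and anticommute. They define an
  irreducible complex module of the Clifford algebra of Euclidean \<open>n\<close>-space, which is faithful
  on the even part over the reals.
\<close>

definition spinor_dim :: "nat \<Rightarrow> nat" where
  "spinor_dim n = 2 ^ (n div 2)"

definition clifford_gen :: "nat \<Rightarrow> nat \<Rightarrow> complex mat" where
  "clifford_gen n k = \<i> \<cdot>\<^sub>m gamma (n div 2) k"

definition clifford :: "nat \<Rightarrow> real vec \<Rightarrow> complex mat" where
  "clifford n v = mat (spinor_dim n) (spinor_dim n)
     (\<lambda>(r, s). \<Sum>k<n. of_real (v $ k) * clifford_gen n k $$ (r, s))"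

inductive_set Spin :: "nat \<Rightarrow> complex mat set" for n where
  one: "1\<^sub>m (spinor_dim n) \<in> Spin n"
| mult: "\<lbrakk>a \<in> Spin n; v \<in> carrier_vec n; v \<bullet> v = 1; w \<in> carrier_vec n; w \<bullet> w = 1\<rbrakk> \<Longrightarrow>
     a * clifford n v * clifford n w \<in> Spin n"

definition SO :: "nat \<Rightarrow> real mat set" where
  "SO n = {A \<in> carrier_mat n n. transpose_mat A * A = 1\<^sub>m n \<and> det A = 1}"

text \<open>The covering of the special orthogonal group maps \<open>a\<close> to \<open>A\<close>.\<close>

definition spin_covers :: "nat \<Rightarrow> complex mat \<Rightarrow> real mat \<Rightarrow> bool" where
  "spin_covers n a A \<longleftrightarrow> a \<in> Spin n \<and> A \<in> SO n \<and>
     (\<forall>v\<in>carrier_vec n. a * clifford n v = clifford n (A *\<^sub>v v) * a)"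

section \<open>Principal bundles\<close>

text \<open>
  Principal bundles of a matrix group, given by the total space, the projection, the right action
  and an atlas of local sections. The sections yield equivariant local trivializations; the
  smooth structure of the total space is the one making these smooth.
\<close>

record ('a, 'p) pbundle =
  total :: "'p set"
  proj :: "'p \<Rightarrow> 'a"
  act :: "'p \<Rightarrow> complex mat \<Rightarrow> 'p"
  sections :: "('a set \<times> ('a \<Rightarrow> 'p)) set"

definition transition ::
  "complex mat set \<Rightarrow> ('a, 'p) pbundle \<Rightarrow> ('a \<Rightarrow> 'p) \<Rightarrow> ('a \<Rightarrow> 'p) \<Rightarrow> 'a \<Rightarrow> complex mat" where
  "transition G P s t x = (THE a. a \<in> G \<and> t x = act P (s x) a)"

definition principal_bundle ::
  "'a manifold \<Rightarrow> nat \<Rightarrow> complex mat set \<Rightarrow> ('a, 'p) pbundle \<Rightarrow> bool" where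
  "principal_bundle M d G P \<longleftrightarrow>
     proj P ` total P \<subseteq> topspace (space_of M) \<and>
     (\<forall>p\<in>total P. act P p (1\<^sub>m d) = p \<and>
        (\<forall>a\<in>G. act P p a \<in> total P \<and> proj P (act P p a) = proj P p \<and>
           (\<forall>b\<in>G. act P (act P p a) b = act P p (a * b)))) \<and>
     (\<forall>p\<in>total P. \<forall>q\<in>total P. proj P p = proj P q \<longrightarrow> (\<exists>!a. a \<in> G \<and> q = act P p a)) \<and>
     (\<Union>(U, s)\<in>sections P. U) = topspace (space_of M) \<and>
     (\<forall>(U, s)\<in>sections P. openin (space_of M) U \<and>
        (\<forall>x\<in>U. s x \<in> total P \<and> proj P (s x) = x)) \<and>
     (\<forall>(U, s)\<in>sections P. \<forall>(V, t)\<in>sections P. smooth_map M (U \<inter> V) d (transition G P s t))"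

text \<open>
  Connections as families of gauge potentials: \<open>A \<sigma> c y v\<close> is the pull back of the connection form
  by the section \<open>\<sigma>\<close>, in the chart \<open>c\<close>, at the point \<open>y\<close> on the vector \<open>v\<close>. For sections
  \<open>t = s\<cdot>a\<close> the transformation law is \<open>A\<^sub>t = a\<^sup>-\<^sup>1 A\<^sub>s a + a\<^sup>-\<^sup>1 da\<close>.
\<close>

type_synonym ('a, 'p) gauge_potential =
  "'a set \<times> ('a \<Rightarrow> 'p) \<Rightarrow> 'a chart \<Rightarrow> real^7 \<Rightarrow> real^7 \<Rightarrow> complex mat"

definition principal_connection :: "'a manifold \<Rightarrow> nat \<Rightarrow> complex mat set \<Rightarrow> complex mat set \<Rightarrow>
    ('a, 'p) pbundle \<Rightarrow> ('a, 'p) gauge_potential \<Rightarrow> bool" where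
  "principal_connection M d G \<gg> P A \<longleftrightarrow>
     (\<forall>\<sigma>\<in>sections P. \<forall>c\<in>atlas M.
        (\<forall>v. smooth_mat_on (snd c ` (fst c \<inter> fst \<sigma>)) d (\<lambda>y. A \<sigma> c y v)) \<and>
        (\<forall>y\<in>snd c ` (fst c \<inter> fst \<sigma>).
           (\<forall>v. A \<sigma> c y v \<in> \<gg>) \<and>
           (\<forall>r<d. \<forall>s<d. linear (\<lambda>v. A \<sigma> c y v $$ (r, s))) \<and>
           (\<forall>c'\<in>atlas M. y \<in> snd c ` (fst c \<inter> fst c' \<inter> fst \<sigma>) \<longrightarrow>
              (\<forall>v. A \<sigma> c y v = A \<sigma> c' (chart_change c c' y) (dchange c c' y v))) \<and>
           (\<forall>\<tau>\<in>sections P. y \<in> snd c ` (fst c \<inter> fst \<sigma> \<inter> fst \<tau>) \<longrightarrow>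
              (let a = transition G P (snd \<sigma>) (snd \<tau>) \<circ> chart_inv c in
               \<forall>v. a y * A \<tau> c y v = A \<sigma> c y v * a y + dmat d a y v))))"

text \<open>The derivative at the identity of a representation \<open>\<rho>\<close> of degree \<open>d\<close>.\<close>

definition drep :: "(complex mat \<Rightarrow> complex mat) \<Rightarrow> nat \<Rightarrow> complex mat \<Rightarrow> complex mat" where
  "drep \<rho> d X = mat d d (\<lambda>(r, s).
     vector_derivative (\<lambda>t. \<rho> (mexp (complex_of_real t \<cdot>\<^sub>m X)) $$ (r, s)) (at 0))"

text \<open>The bundle associated with \<open>\<rho>\<close>, with the induced connection, in the frame given by a section.\<close>

definition associated_bundle ::
  "(complex mat \<Rightarrow> complex mat) \<Rightarrow> nat \<Rightarrow> (real^7 \<Rightarrow> real^7 \<Rightarrow> complex mat) \<Rightarrow> 7 cbundle" where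
  "associated_bundle \<rho> d A = CBundle d (\<lambda>y. one_form_mat d (\<lambda>v. drep \<rho> d (A y v)))"

section \<open>Spin structures\<close>

text \<open>
  \<open>fr p c i\<close> are the components in the chart \<open>c\<close> of the \<open>i\<close>-th vector of the oriented orthonormal
  frame under \<open>p\<close>; so \<open>fr\<close> is an equivariant map from the principal bundle to the frame bundle.
\<close>

type_synonym ('a, 'p) frame_map = "'p \<Rightarrow> 'a chart \<Rightarrow> nat \<Rightarrow> real^7"

definition local_frame ::
  "('a, 'p) frame_map \<Rightarrow> 'a set \<times> ('a \<Rightarrow> 'p) \<Rightarrow> 'a chart \<Rightarrow> nat \<Rightarrow> real^7 \<Rightarrow> real^7" where
  "local_frame fr \<sigma> c i y = fr (snd \<sigma> (chart_inv c y)) c i"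

definition spin_structure :: "'a manifold \<Rightarrow> 'a metric_tensor \<Rightarrow> ('a, 'p) pbundle \<Rightarrow>
    ('a, 'p) frame_map \<Rightarrow> bool" where
  "spin_structure M met P fr \<longleftrightarrow>
     principal_bundle M (spinor_dim 7) (Spin 7) P \<and>
     (\<forall>p\<in>total P. \<forall>c\<in>atlas M. proj P p \<in> fst c \<longrightarrow>
        (\<forall>i<7. \<forall>j<7. met c (snd c (proj P p)) (fr p c i) (fr p c j) = (if i = j then 1 else 0)) \<and>
        frame_det (fr p c) > 0 \<and>
        (\<forall>c'\<in>atlas M. proj P p \<in> fst c' \<longrightarrow>
           (\<forall>i<7. fr p c' i = dchange c c' (snd c (proj P p)) (fr p c i))) \<and>
        (\<forall>a A. spin_covers 7 a A \<longrightarrow>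
           (\<forall>j<7. fr (act P p a) c j = (\<Sum>i<7. A $$ (i, j) *\<^sub>R fr p c i)))) \<and>
     (\<forall>\<sigma>\<in>sections P. \<forall>c\<in>atlas M. \<forall>i<7.
        smooth_on (snd c ` (fst c \<inter> fst \<sigma>)) (local_frame fr \<sigma> c i))"

text \<open>
  The spinor bundle with the lift of the Levi-Civita connection, in the frame given by a section
  of the spin structure over the orthonormal frame \<open>e\<close>. The connection matrix
  \<open>\<Sum>i j. \<omega> i j * c j * c i / 4\<close> is the element of the spin Lie algebra whose commutator with
  Clifford multiplication by \<open>v\<close> is Clifford multiplication by \<open>\<omega> v\<close>.
\<close>

definition spinor_bundle ::
  "(real^7 \<Rightarrow> real^7 \<Rightarrow> real^7 \<Rightarrow> real) \<Rightarrow> (nat \<Rightarrow> real^7 \<Rightarrow> real^7) \<Rightarrow> 7 cbundle" where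
  "spinor_bundle h e = CBundle (spinor_dim 7) (\<lambda>y. one_form_mat (spinor_dim 7) (\<lambda>v.
     mat (spinor_dim 7) (spinor_dim 7) (\<lambda>(r, s). \<Sum>i<7. \<Sum>j<7.
       of_real (levi_civita h e i j y v / 4) * (clifford_gen 7 j * clifford_gen 7 i) $$ (r, s))))"

section \<open>The compact group of type E8\<close>

text \<open>
  Elements of the root lattice are lists of the eight coordinates with respect to the simple
  roots (Bourbaki's numbering, starting with 0). The form \<open>e8_cocycle\<close> is bilinear and induces half
  the norm modulo 2. The roots are the vectors of norm 2; their coordinates are at most 6 in
  absolute value, and there are 240 of them.
\<close>

definition e8_edges :: "(nat \<times> nat) set" where
  "e8_edges = {(0, 2), (2, 3), (3, 4), (4, 5), (5, 6), (6, 7), (1, 3)}"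

definition e8_cocycle :: "int list \<Rightarrow> int list \<Rightarrow> int" where
  "e8_cocycle a b = (\<Sum>i<8. a ! i * b ! i) + (\<Sum>(i, j)\<in>e8_edges. a ! i * b ! j)"

definition e8_form :: "int list \<Rightarrow> int list \<Rightarrow> int" where
  "e8_form a b = 2 * (\<Sum>i<8. a ! i * b ! i) - (\<Sum>(i, j)\<in>e8_edges. a ! i * b ! j + a ! j * b ! i)"

definition e8_simple :: "nat \<Rightarrow> int list" where
  "e8_simple i = map (\<lambda>j. if j = i then 1 else 0) [0..<8]"

definition e8_roots :: "int list list" where
  "e8_roots = filter (\<lambda>a. e8_form a a = 2) (product_lists (replicate 8 [-6..6]))"

text \<open>
  The complex Lie algebra of type E8 in the basis consisting of the simple coroots (indices below 8)
  and the root vectors \<open>E\<^sub>\<alpha>\<close>, where \<open>\<alpha> = e8_roots ! (i - 8)\<close>. The brackets are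
  \<open>[h, E\<^sub>\<alpha>] = (\<alpha>, h) E\<^sub>\<alpha>\<close>, \<open>[E\<^sub>\<alpha>, E\<^bsub>-\<alpha>\<^esub>] = -\<alpha>\<close>, and
  \<open>[E\<^sub>\<alpha>, E\<^sub>\<beta>] = \<epsilon>(\<alpha>, \<beta>) E\<^bsub>\<alpha>+\<beta>\<^esub>\<close> if \<open>\<alpha> + \<beta>\<close> is a root, with
  \<open>\<epsilon>\<close> the sign given by \<open>e8_cocycle\<close>; see Kac, Infinite dimensional Lie algebras, section 7.8.
\<close>

definition e8_root :: "nat \<Rightarrow> int list" where
  "e8_root i = e8_roots ! (i - 8)"

definition e8_structure :: "nat \<Rightarrow> nat \<Rightarrow> nat \<Rightarrow> int" where
  "e8_structure i j k =
     (if i < 8 \<and> j < 8 then 0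
      else if i < 8 then (if k = j then e8_form (e8_simple i) (e8_root j) else 0)
      else if j < 8 then (if k = i then - e8_form (e8_simple j) (e8_root i) else 0)
      else let a = e8_root i; b = e8_root j; c = map2 (+) a b in
        if k < 8 then (if b = map uminus a then - (a ! k) else 0)
        else if e8_root k = c then (if even (e8_cocycle a b) then 1 else -1) else 0)"

definition e8_bracket :: "complex vec \<Rightarrow> complex vec \<Rightarrow> complex vec" where
  "e8_bracket x y = vec 248 (\<lambda>k. \<Sum>i<248. \<Sum>j<248. of_int (e8_structure i j k) * x $ i * y $ j)"

text \<open>
  The antilinear automorphism with \<open>\<alpha> \<mapsto> -\<alpha>\<close> on coroots and \<open>E\<^sub>\<alpha> \<mapsto> E\<^bsub>-\<alpha>\<^esub>\<close>, whose fixed points are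
  the compact real form.
\<close>

definition e8_conj :: "complex vec \<Rightarrow> complex vec" where
  "e8_conj x = vec 248 (\<lambda>k. if k < 8 then - cnj (x $ k)
     else \<Sum>i\<in>{i. 8 \<le> i \<and> i < 248 \<and> e8_root i = map uminus (e8_root k)}. cnj (x $ i))"

text \<open>
  The compact group is the automorphism group of the compact real form, in its adjoint
  representation on the complexification; its Lie algebra consists of the derivations of the
  compact real form.
\<close>

definition E8 :: "complex mat set" where
  "E8 = {A \<in> carrier_mat 248 248. invertible_mat A \<and>
     (\<forall>x\<in>carrier_vec 248. A *\<^sub>v e8_conj x = e8_conj (A *\<^sub>v x) \<and>
        (\<forall>y\<in>carrier_vec 248. A *\<^sub>v e8_bracket x y = e8_bracket (A *\<^sub>v x) (A *\<^sub>v y)))}"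

definition e8_compact :: "complex mat set" where
  "e8_compact = {X \<in> carrier_mat 248 248.
     (\<forall>x\<in>carrier_vec 248. X *\<^sub>v e8_conj x = e8_conj (X *\<^sub>v x) \<and>
        (\<forall>y\<in>carrier_vec 248.
           X *\<^sub>v e8_bracket x y = e8_bracket (X *\<^sub>v x) y + e8_bracket x (X *\<^sub>v y)))}"

definition E8_representation :: "nat \<Rightarrow> (complex mat \<Rightarrow> complex mat) \<Rightarrow> bool" where
  "E8_representation d \<rho> \<longleftrightarrow>
     (\<forall>A\<in>E8. \<rho> A \<in> carrier_mat d d) \<and> \<rho> (1\<^sub>m 248) = 1\<^sub>m d \<and>
     (\<forall>A\<in>E8. \<forall>B\<in>E8. \<rho> (A * B) = \<rho> A * \<rho> B) \<and>
     (\<forall>A B. (\<forall>n. A n \<in> E8) \<and> B \<in> E8 \<and>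
        (\<forall>r<248. \<forall>s<248. (\<lambda>n. A n $$ (r, s)) \<longlonglongrightarrow> B $$ (r, s)) \<longrightarrow>
        (\<forall>r<d. \<forall>s<d. (\<lambda>n. \<rho> (A n) $$ (r, s)) \<longlonglongrightarrow> \<rho> B $$ (r, s)))"

definition E8_irreducible :: "nat \<Rightarrow> (complex mat \<Rightarrow> complex mat) \<Rightarrow> bool" where
  "E8_irreducible d \<rho> \<longleftrightarrow> E8_representation d \<rho> \<and> d > 0 \<and>
     (\<forall>W \<subseteq> carrier_vec d.
        0\<^sub>v d \<in> W \<and> (\<forall>x\<in>W. \<forall>y\<in>W. x + y \<in> W) \<and> (\<forall>k. \<forall>x\<in>W. k \<cdot>\<^sub>v x \<in> W) \<and>
        (\<forall>A\<in>E8. \<forall>x\<in>W. \<rho> A *\<^sub>v x \<in> W) \<longrightarrow> W = {0\<^sub>v d} \<or> W = carrier_vec d)"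

text \<open>
  The representations on the pieces of degree 1 and 2 of the basic representation of affine E8: the
  adjoint representation, and the sum of the trivial, the adjoint and the irreducible
  representation \<open>\<rho>\<close> of dimension 3875.
\<close>

definition E8_V1 :: "complex mat \<Rightarrow> complex mat" where
  "E8_V1 A = A"

definition E8_V2 :: "(complex mat \<Rightarrow> complex mat) \<Rightarrow> complex mat \<Rightarrow> complex mat" where
  "E8_V2 \<rho> A = diag_block_mat [1\<^sub>m 1, A, \<rho> A]"

definition W_bundle :: "(real^7 \<Rightarrow> real^7 \<Rightarrow> complex mat) \<Rightarrow> 7 cbundle" where
  "W_bundle A = associated_bundle E8_V1 248 A"

definition Wbar_bundle ::
  "(complex mat \<Rightarrow> complex mat) \<Rightarrow> (real^7 \<Rightarrow> real^7 \<Rightarrow> complex mat) \<Rightarrow> 7 cbundle" where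
  "Wbar_bundle \<rho> A = associated_bundle (E8_V2 \<rho>) (1 + 248 + 3875) A"

section \<open>The characteristic forms\<close>

definition m0 :: "'n::{finite, linorder} form \<Rightarrow> 'n cbundle \<Rightarrow> 'n coords \<Rightarrow> 'n form" where
  "m0 \<kappa> S y = ch (bun S) y + \<kappa>"

definition m1 :: "'n::{finite, linorder} form \<Rightarrow> 'n cbundle \<Rightarrow> 'n cbundle \<Rightarrow> 'n coords \<Rightarrow> 'n form" where
  "m1 \<kappa> S TM y = (let T = reduced TM in
     ch (bun S * (2 \<odot> T)) y + \<kappa> * ch (T + vext 2 T) y)"

definition m2 :: "'n::{finite, linorder} form \<Rightarrow> 'n cbundle \<Rightarrow> 'n cbundle \<Rightarrow> 'n coords \<Rightarrow> 'n form" where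
  "m2 \<kappa> S TM y = (let T = reduced TM in
     ch (bun S * (2 \<odot> T + vext 2 T + T * T + vsym 2 T)) y +
     \<kappa> * ch (vext 4 T + vext 2 T * T + T * T + vsym 2 T + T) y)"

text \<open>In \<open>b1\<close> and \<open>b2\<close> the argument \<open>c\<close> is the value at \<open>y\<close> of the form \<open>c\<^sub>2(W\<^sub>i) + c\<^sub>2(W\<^sub>j)\<close>.\<close>

definition b1 :: "'n::{finite, linorder} form \<Rightarrow> 'n cbundle \<Rightarrow> 'n cbundle \<Rightarrow> 'n coords \<Rightarrow> 'n form" where
  "b1 c Wi Wj y = ch (bun Wi + bun Wj - bun (trivial 16)) y - fconst (1 / 30) * c"

definition b2 :: "'n::{finite, linorder} form \<Rightarrow> 'n cbundle \<Rightarrow> 'n cbundle \<Rightarrow> 'n cbundle \<Rightarrow> 'n cbundle \<Rightarrow>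
    'n coords \<Rightarrow> 'n form" where
  "b2 c Wi Wj Wbi Wbj y =
     ch ((-16) \<odot> bun Wi - 16 \<odot> bun Wj + bun Wi * bun Wj + bun Wbi + bun Wbj + bun (trivial 104)) y
     - fconst (1 / 30) * c * ch (bun Wi + bun Wj - bun (trivial 16)) y
     + fconst (1 / 2) * (- 6 + fconst (1 / 30) * c) * (fconst (1 / 30) * c)"

definition eta0 :: "'n::{finite, linorder} abundle \<Rightarrow> 'n coords \<Rightarrow> 'n form" where
  "eta0 S y = odd_ch (bun S) y"

definition eta1 :: "'n::{finite, linorder} abundle \<Rightarrow> 'n abundle \<Rightarrow> 'n coords \<Rightarrow> 'n form" where
  "eta1 S EC y = (let E = reduced EC in
     odd_ch (bun S * (2 \<odot> vext 2 E - E * E + E)) y)"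

definition eta2 :: "'n::{finite, linorder} abundle \<Rightarrow> 'n abundle \<Rightarrow> 'n coords \<Rightarrow> 'n form" where
  "eta2 S EC y = (let E = reduced EC in
     odd_ch (bun S * (vext 2 E * vext 2 E + 2 \<odot> vext 4 E - 2 \<odot> (E * vext 3 E) + 2 \<odot> (E * vext 2 E)
       - E * E * E + E + vext 2 E)) y)"

text \<open>
  The complexification of the trivial bundle of rank \<open>N\<close> with the automorphism \<open>g\<close>, and its spinor
  bundle with the automorphism given by the lift, in the chart \<open>c\<close>.
\<close>

definition vector_abundle :: "nat \<Rightarrow> ('a \<Rightarrow> real mat) \<Rightarrow> 'a chart \<Rightarrow> 7 abundle" where
  "vector_abundle N g c = ABundle N (\<lambda>y. map_mat of_real (g (chart_inv c y)))"

definition spinor_abundle :: "nat \<Rightarrow> ('a \<Rightarrow> complex mat) \<Rightarrow> 'a chart \<Rightarrow> 7 abundle" where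
  "spinor_abundle N g\<Delta> c = ABundle (spinor_dim N) (\<lambda>y. g\<Delta> (chart_inv c y))"

end

theory Submission
  imports Defs "HOL-Library.Sublist"
begin

text \<open>
  The odd Chern character of a bundle built from \<open>E\<close> and its spinor bundle is a combination of the
  traces of \<open>\<theta>\<^sub>F\<^bsup>2n+1\<^esup>\<close> for the induced Maurer--Cartan form \<open>\<theta>\<^sub>F\<close>. These are additive on tensor products
  in the way of a derivation over the rank, and for spinors and exterior powers they are multiples of
  the trace of \<open>\<theta>\<^sub>E\<^bsup>2n+1\<^esup>\<close>: write \<open>\<theta>\<^sub>F\<close> as a quadratic expression in Clifford generators, or in creation
  and annihilation operators, and move \<open>\<theta>\<^sub>F\<^sup>2\<close> around the trace; products of traces never occur, as
  even powers of \<open>\<theta>\<^sub>E\<close> have trace zero. The trace of \<open>\<theta>\<^sub>E\<^sup>3\<close> vanishes by assumption and that of \<open>\<theta>\<^sub>E\<^sup>5\<close>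
  because \<open>\<theta>\<^sub>E\<close> is skew. Hence all \<open>\<eta>\<^sub>i\<close> are concentrated in the top degree 7, with
  \<open>\<eta>\<^sub>1 = 240 \<eta>\<^sub>0\<close> and \<open>\<eta>\<^sub>2 = 2160 \<eta>\<^sub>0\<close>, and only the degree zero parts of the even forms matter:
  these are 1, 16, 0, 0, 480, 61920 for the prefactor, \<open>m\<^sub>0\<close>, \<open>m\<^sub>1\<close>, \<open>m\<^sub>2\<close>, \<open>b\<^sub>1\<close>, \<open>b\<^sub>2\<close>.
\<close>

section \<open>Homogeneous forms\<close>

text \<open>The constants come from modular forms: 1, 240, 2160 begin the Eisenstein series E_4 and
  1, 480, 61920 begin its square, so up to the factor 16 the claim is the relation a_2 = 196560 a_0
  - 24 a_1 for E_4^3 = 1 + 720 q + 179280 q^2 + ... The numbers 240 and 2160 arise as follows. In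
  degree 7 the trace for the exterior power series of a rank N bundle is (1 + t)^N times the sum of
  (-1)^(j-1) j^3 t^j, j > 0, times that of the bundle. Reduction divides by (1 + t)^N and leaves 1,
  -8, 27, -64. Spinors of rank d give -d/16, and products of two reduced factors drop out because
  both have rank 0. The obstacle is that one-forms anticommute, so a Maurer-Cartan form cannot be
  diagonalized and no splitting principle applies. Its place is taken by equivariance:
  differentiating the equivariance of Clifford or exterior multiplication gives a commutation
  relation. This relation determines the induced Maurer-Cartan form, by Schur's lemma up to a scalar
  or by the number operator, and it yields linear recursions for the traces.\<close>

lemma form_eqI: "(\<And>I. coeff a I = coeff b I) \<Longrightarrow> a = b"
  by (cases a; cases b) auto

lemma coeff_zero [simp]: "coeff 0 I = 0"
  and coeff_one: "coeff 1 I = (if I = {} then 1 else 0)"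
  and coeff_add [simp]: "coeff (a + b) I = coeff a I + coeff b I"
  and coeff_uminus [simp]: "coeff (- a) I = - coeff a I"
  and coeff_diff [simp]: "coeff (a - b) I = coeff a I - coeff b I"
  and coeff_mult: "coeff (a * b) K = (\<Sum>I\<in>Pow K. shuffle_sign I (K - I) * coeff a I * coeff b (K - I))"
  by (simp_all add: zero_form_def one_form_def plus_form_def uminus_form_def minus_form_def times_form_def)

lemma coeff_sum [simp]: "coeff (\<Sum>i\<in>S. f i) I = (\<Sum>i\<in>S. coeff (f i) I)"
  by (induction S rule: infinite_finite_induct) auto

lemma coeff_fconst: "coeff (fconst c) I = (if I = {} then c else 0)"
  by (simp add: fconst_def)

lemma shuffle_sign_empty [simp]: "shuffle_sign {} J = 1" "shuffle_sign I {} = 1"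
  by (simp_all add: shuffle_sign_def)

lemma coeff_fconst_mult [simp]: "coeff (fconst c * a) K = c * coeff (a::'n::{finite,linorder} form) K"
proof -
  have "coeff (fconst c * a) K = (\<Sum>I\<in>{{}}. shuffle_sign I (K - I) * coeff (fconst c) I * coeff a (K - I))"
    unfolding coeff_mult by (rule sum.mono_neutral_right) (auto simp: coeff_fconst)
  then show ?thesis by (simp add: coeff_fconst)
qed

lemma coeff_mult_fconst [simp]: "coeff (a * fconst c) K = c * coeff (a::'n::{finite,linorder} form) K"
proof -
  have "coeff (a * fconst c) K = (\<Sum>I\<in>{K}. shuffle_sign I (K - I) * coeff a I * coeff (fconst c) (K - I))"
    unfolding coeff_mult by (rule sum.mono_neutral_right) (auto simp: coeff_fconst)
  then show ?thesis by (simp add: coeff_fconst)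
qed

lemma mult_fconst: "a * fconst c = fconst c * (a::'n::{finite,linorder} form)"
  by (rule form_eqI) simp

lemma fconst_mult_mult: "a * (fconst c * b) = fconst c * (a * (b::'n::{finite,linorder} form))"
  by (metis mult.assoc mult_fconst)

text \<open>Provides the \<open>mat_hom\<close> facts for constant matrices inside matrices of
  forms.\<close>

global_interpretation fconst: ring_hom "fconst :: complex \<Rightarrow> 'n::{finite,linorder} form"
  by unfold_locales (auto intro!: form_eqI simp: coeff_fconst coeff_one)

lemma fconst_of_nat: "fconst (of_nat k) = (of_nat k :: 'n::{finite,linorder} form)"
  by (induction k) (simp_all add: fconst.hom_add)

lemma fconst_of_int: "fconst (of_int k) = (of_int k :: 'n::{finite,linorder} form)"
  by (cases k rule: int_cases2) (simp_all add: fconst_of_nat fconst.hom_uminus)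

lemma fconst_numeral: "fconst (numeral k) = (numeral k :: 'n::{finite,linorder} form)"
  using fconst_of_nat[of "numeral k"] by simp

text \<open>The augmentation of the exterior algebra. The even characteristic forms enter the final
  identity only through their images under it.\<close>

global_interpretation aug: ring_hom "\<lambda>a :: 'n::{finite,linorder} form. coeff a {}"
  by unfold_locales (auto simp: coeff_mult coeff_one)

lemma aug_fconst [simp]: "coeff (fconst c) {} = c"
  by (simp add: fconst_def)

lemma coeff_degree_part: "coeff (degree_part k a) I = (if card I = k then coeff a I else 0)"
  by (simp add: degree_part_def)

text \<open>Zero is homogeneous of every degree, so sums and products need no case
  distinction.\<close>

definition hdeg :: "nat \<Rightarrow> 'n form \<Rightarrow> bool" where
  "hdeg k a \<longleftrightarrow> (\<forall>I. coeff a I \<noteq> 0 \<longrightarrow> card I = k)"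

lemma hdeg_0 [simp]: "hdeg k (0 :: 'n::{finite,linorder} form)"
  by (simp add: hdeg_def)

lemma hdeg_fconst [simp]: "hdeg 0 (fconst c)"
  by (simp add: hdeg_def coeff_fconst)

lemma hdeg_one [simp]: "hdeg 0 (1 :: 'n::{finite,linorder} form)"
  by (simp add: hdeg_def coeff_one)

lemma hdeg_add: "hdeg k a \<Longrightarrow> hdeg k b \<Longrightarrow> hdeg k (a + b :: 'n::{finite,linorder} form)"
  unfolding hdeg_def by (metis add.right_neutral coeff_add)

lemma hdeg_uminus: "hdeg k a \<Longrightarrow> hdeg k (- a :: 'n::{finite,linorder} form)"
  by (simp add: hdeg_def)

lemma hdeg_diff: "hdeg k a \<Longrightarrow> hdeg k b \<Longrightarrow> hdeg k (a - b :: 'n::{finite,linorder} form)"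
  using hdeg_add[of k a "- b"] hdeg_uminus[of k b] by simp

lemma hdeg_sum: "(\<And>i. i \<in> S \<Longrightarrow> hdeg k (f i)) \<Longrightarrow> hdeg k (\<Sum>i\<in>S. f i :: 'n::{finite,linorder} form)"
  by (induction S rule: infinite_finite_induct) (auto intro: hdeg_add)

lemma hdeg_mult:
  assumes "hdeg k a" "hdeg l b"
  shows "hdeg (k + l) (a * b :: 'n::{finite,linorder} form)"
  unfolding hdeg_def
proof (intro allI impI)
  fix K assume "coeff (a * b) K \<noteq> 0"
  then obtain I where "I \<in> Pow K" "shuffle_sign I (K - I) * coeff a I * coeff b (K - I) \<noteq> 0"
    unfolding coeff_mult by (meson sum.not_neutral_contains_not_neutral)
  then have "I \<subseteq> K" "card I = k" "card (K - I) = l"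
    using assms by (auto simp: hdeg_def)
  then show "card K = k + l"
    by (metis card_Diff_subset card_mono finite le_add_diff_inverse)
qed

lemma hdeg_fconst_mult: "hdeg k a \<Longrightarrow> hdeg k (fconst c * a :: 'n::{finite,linorder} form)"
  by (simp add: hdeg_def)

lemma hdeg_dx [simp]: "hdeg 1 (dx i)"
  by (simp add: hdeg_def dx_def)

lemma hdeg_large_eq_0: "hdeg k (a :: 'n::{finite,linorder} form) \<Longrightarrow> CARD('n) < k \<Longrightarrow> a = 0"
  by (rule form_eqI) (metis card_mono finite hdeg_def leD subset_UNIV coeff_zero)

lemma hdeg_pos_aug: "hdeg k a \<Longrightarrow> k > 0 \<Longrightarrow> coeff a {} = 0"
  by (auto simp: hdeg_def)

text \<open>Each pair in the product of \<open>I\<close> and \<open>J\<close> is an inversion for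
  exactly one of the two orders, so the two inversion counts add up to
  \<open>card I * card J\<close>.\<close>

lemma shuffle_sign_swap:
  assumes "I \<inter> J = {}"
  shows "shuffle_sign J I = (-1) ^ (card I * card J) * shuffle_sign I (J :: 'n::{finite,linorder} set)"
proof -
  let ?A = "{(i, j). i \<in> I \<and> j \<in> J \<and> j < i}" and ?B = "{(i, j). i \<in> J \<and> j \<in> I \<and> j < i}"
  have cB: "card ?B = card (prod.swap ` ?B)" by (simp add: card_image)
  have B: "prod.swap ` ?B = {(i, j). i \<in> I \<and> j \<in> J \<and> i < j}"
  proof (rule Set.set_eqI)
    fix x show "x \<in> prod.swap ` ?B \<longleftrightarrow> x \<in> {(i, j). i \<in> I \<and> j \<in> J \<and> i < j}"
      by (cases x) (auto simp: pair_in_swap_image)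
  qed
  have ne: "j < i \<or> i < j" if "i \<in> I" "j \<in> J" for i j
    using assms that neq_iff[of j i] by blast
  have "?A \<union> prod.swap ` ?B = I \<times> J"
  proof (rule Set.set_eqI)
    fix x show "x \<in> ?A \<union> prod.swap ` ?B \<longleftrightarrow> x \<in> I \<times> J"
      unfolding B using ne[of "fst x" "snd x"] by (cases x) auto
  qed
  moreover have "?A \<inter> prod.swap ` ?B = {}" unfolding B by (auto dest: less_asym)
  ultimately have "card I * card J = card ?A + card ?B"
    using card_Un_disjoint[of ?A "prod.swap ` ?B"] cB by (simp add: card_cartesian_product)
  then show ?thesis
    by (simp add: shuffle_sign_def power_add flip: power_mult_distrib)
qed

lemma supercommute:
  assumes "hdeg k a" "hdeg l b"
  shows "b * a = (-1) ^ (k * l) * (a * b :: 'n::{finite,linorder} form)"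
proof -
  have "coeff (b * a) K = (-1) ^ (k * l) * coeff (a * b) K" for K
  proof -
    have "coeff (b * a) K = (\<Sum>I\<in>Pow K. shuffle_sign (K - I) I * coeff b (K - I) * coeff a I)"
      unfolding coeff_mult
      by (rule sum.reindex_bij_witness[where i = "\<lambda>I. K - I" and j = "\<lambda>I. K - I"])
        (auto simp: double_diff)
    also have "\<dots> = (\<Sum>I\<in>Pow K. (-1) ^ (k * l) * (shuffle_sign I (K - I) * coeff a I * coeff b (K - I)))"
    proof (rule sum.cong[OF refl])
      fix I assume "I \<in> Pow K"
      show "shuffle_sign (K - I) I * coeff b (K - I) * coeff a I =
        (-1) ^ (k * l) * (shuffle_sign I (K - I) * coeff a I * coeff b (K - I))"
      proof (cases "coeff a I = 0 \<or> coeff b (K - I) = 0")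
        case False
        then have "card I = k" "card (K - I) = l" using assms by (auto simp: hdeg_def)
        then show ?thesis using shuffle_sign_swap[of I "K - I"] by simp
      qed auto
    qed
    finally show ?thesis by (simp add: coeff_mult sum_distrib_left)
  qed
  moreover have "(-1 :: 'n form) ^ (k * l) = fconst ((-1) ^ (k * l))"
    by (simp add: fconst.hom_power fconst.hom_uminus)
  ultimately show ?thesis by (auto intro!: form_eqI)
qed

lemma even_commute: "hdeg k a \<Longrightarrow> even k \<Longrightarrow> hdeg l b \<Longrightarrow> a * b = b * (a :: 'n::{finite,linorder} form)"
  using supercommute[of k a l b] by simp

lemma odd_anticommute:
  "hdeg k a \<Longrightarrow> odd k \<Longrightarrow> hdeg l b \<Longrightarrow> odd l \<Longrightarrow> a * b = - (b * (a :: 'n::{finite,linorder} form))"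
  using supercommute[of k a l b] by simp

text \<open>A part of \<open>a\<close> of positive degree would push the product beyond the top
  degree. This is what reduces the theorem to an identity of constants.\<close>

lemma mult_top_degree:
  assumes "hdeg CARD('n) b"
  shows "a * b = fconst (coeff a {}) * (b :: 'n::{finite,linorder} form)"
proof (rule form_eqI)
  fix K :: "'n set"
  have "coeff (a * b) K = (\<Sum>I\<in>{{}}. shuffle_sign I (K - I) * coeff a I * coeff b (K - I))"
    unfolding coeff_mult
  proof (rule sum.mono_neutral_right)
    show "\<forall>I\<in>Pow K - {{}}. shuffle_sign I (K - I) * coeff a I * coeff b (K - I) = 0"
    proof
      fix I assume I: "I \<in> Pow K - {{}}"
      then have "K - I \<noteq> UNIV" by auto
      then have "card (K - I) \<noteq> CARD('n)" by (metis card_seteq finite order_refl subset_UNIV)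
      then show "shuffle_sign I (K - I) * coeff a I * coeff b (K - I) = 0"
        using assms by (auto simp: hdeg_def)
    qed
  qed auto
  then show "coeff (a * b) K = coeff (fconst (coeff a {}) * b) K" by simp
qed

lemma degree_part_eq: "hdeg k a \<Longrightarrow> degree_part k a = a"
  by (rule form_eqI) (auto simp: coeff_degree_part hdeg_def)

text \<open>The recursive calls stand below a \<open>map\<close> over a range depending on
  \<open>k\<close>, so as rewrite rules these equations can loop.\<close>

declare ext_div.simps [simp del] vsym.simps [simp del]

lemma length_ext_basis: "length (ext_basis n k) = n choose k"
proof -
  \<comment> \<open>Stated for arbitrary lists because \<open>subseqs\<close> recurses on the list;
    the induction step is Pascal's rule.\<close>
  have "length (filter (\<lambda>I. length I = k) (subseqs xs)) = length xs choose k" for xs :: "nat list"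
  proof (induction xs arbitrary: k)
    case Nil
    then show ?case by (cases k) auto
  next
    case (Cons x xs)
    then show ?case using Cons.IH[of 0] by (cases k) (auto simp: Let_def filter_map o_def)
  qed
  then show ?thesis by (simp add: ext_basis_def)
qed

section \<open>Evaluation of virtual bundles\<close>

text \<open>Used twice: with the rank, and with the pair of rank and odd Chern character as a dual
  number. The predicate \<open>good\<close> restricts multiplicativity to bundles whose matrices
  have the announced shape. The values on exterior powers stay free; only closure of
  \<open>good\<close> is required.\<close>

locale bundle_valuation =
  fixes good :: "'b::tensor_bundle \<Rightarrow> bool" and h :: "'b \<Rightarrow> 'r::comm_ring_1"
  assumes good_trivial [simp]: "good (trivial n)"
    and h_trivial: "h (trivial n) = of_nat n"
    and good_tensor: "good a \<Longrightarrow> good b \<Longrightarrow> good (tensor a b)"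
    and h_tensor: "good a \<Longrightarrow> good b \<Longrightarrow> h (tensor a b) = h a * h b"
    and good_ext_power: "good a \<Longrightarrow> good (ext_power k a)"
begin

definition vgood :: "'b virt \<Rightarrow> bool" where
  "vgood V \<longleftrightarrow> (\<forall>b\<in>snd ` set (summands V). good b)"

definition hv :: "'b virt \<Rightarrow> 'r" where
  "hv V = (\<Sum>(n, b)\<leftarrow>summands V. of_int n * h b)"

lemma hv_add [simp]: "hv (V + W) = hv V + hv W"
  by (simp add: hv_def plus_virt_def)

lemma hv_scale [simp]: "hv (k \<odot> V) = of_int k * hv V"
proof -
  have "(\<Sum>(n, b)\<leftarrow>map (\<lambda>(n, b). (k * n, b)) xs. of_int n * h b) =
    of_int k * (\<Sum>(n, b)\<leftarrow>xs. of_int n * h b)" for xs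
    by (induction xs) (auto simp: algebra_simps)
  then show ?thesis by (simp add: hv_def vscale_def)
qed

lemma hv_uminus [simp]: "hv (- V) = - hv V"
  by (simp add: uminus_virt_def)

lemma hv_diff [simp]: "hv (V - W) = hv V - hv W"
  by (simp add: minus_virt_def)

lemma hv_0 [simp]: "hv 0 = 0"
  by (simp add: hv_def zero_virt_def)

lemma hv_bun [simp]: "hv (bun b) = h b"
  by (simp add: hv_def bun_def)

lemma hv_1 [simp]: "hv 1 = 1"
  by (simp add: one_virt_def h_trivial)

lemma vgood_add [simp]: "vgood V \<Longrightarrow> vgood W \<Longrightarrow> vgood (V + W)"
  by (auto simp: vgood_def plus_virt_def)

lemma vgood_scale [simp]: "vgood V \<Longrightarrow> vgood (k \<odot> V)"
  by (force simp: vgood_def vscale_def)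

lemma vgood_uminus [simp]: "vgood V \<Longrightarrow> vgood (- V)"
  by (simp add: uminus_virt_def)

lemma vgood_diff [simp]: "vgood V \<Longrightarrow> vgood W \<Longrightarrow> vgood (V - W)"
  by (simp add: minus_virt_def)

lemma vgood_0 [simp]: "vgood 0"
  by (simp add: vgood_def zero_virt_def)

lemma vgood_bun [simp]: "vgood (bun b) \<longleftrightarrow> good b"
  by (simp add: vgood_def bun_def)

lemma vgood_1 [simp]: "vgood 1"
  by (simp add: one_virt_def)

lemma vgood_mult [simp]: "vgood V \<Longrightarrow> vgood W \<Longrightarrow> vgood (V * W)"
  by (fastforce simp: vgood_def times_virt_def intro!: good_tensor)

lemma hv_mult [simp]:
  assumes "vgood V" "vgood W"
  shows "hv (V * W) = hv V * hv W"
proof -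
  have 1: "(\<Sum>(n, b)\<leftarrow>map (\<lambda>(n, b). (m * n, tensor a b)) ys. of_int n * h b) =
      of_int m * h a * (\<Sum>(n, b)\<leftarrow>ys. of_int n * h b)"
    if "good a" "\<forall>b\<in>snd ` set ys. good b" for m a ys
    using that by (induction ys) (auto simp: algebra_simps h_tensor)
  have "(\<Sum>(n, b)\<leftarrow>concat (map (\<lambda>(m, a). map (\<lambda>(n, b). (m * n, tensor a b)) ys) xs). of_int n * h b) =
      (\<Sum>(n, b)\<leftarrow>xs. of_int n * h b) * (\<Sum>(n, b)\<leftarrow>ys. of_int n * h b)"
    if "\<forall>b\<in>snd ` set xs. good b" "\<forall>b\<in>snd ` set ys. good b" for xs ys
    using that by (induction xs) (auto simp: algebra_simps 1 simp del: map_map)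
  then show ?thesis
    using assms by (simp add: hv_def vgood_def times_virt_def)
qed

lemma hv_vsum: "hv (vsum Vs) = (\<Sum>V\<leftarrow>Vs. hv V)"
  by (induction Vs) (simp_all add: vsum_def)

lemma vgood_vsum: "(\<And>V. V \<in> set Vs \<Longrightarrow> vgood V) \<Longrightarrow> vgood (vsum Vs)"
  by (induction Vs) (simp_all add: vsum_def)

lemma vgood_ext_mult:
  assumes "good F" "\<And>k. vgood (P k)"
  shows "vgood (ext_mult F P k)"
  unfolding ext_mult_def by (rule vgood_vsum) (auto intro!: vgood_mult assms good_ext_power)

lemma hv_ext_mult:
  assumes "good F" "\<And>k. vgood (P k)"
  shows "hv (ext_mult F P k) = (\<Sum>j\<leftarrow>[0..<Suc k]. h (ext_power j F) * hv (P (k - j)))"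
  unfolding ext_mult_def hv_vsum using assms
  by (simp add: o_def good_ext_power cong: map_cong del: upt_Suc)

lemma vgood_ext_div:
  assumes "good F" "\<And>k. vgood (P k)"
  shows "vgood (ext_div F P k)"
proof (induction k rule: less_induct)
  case (less k)
  then show ?case unfolding ext_div.simps[of F P k]
    by (intro vgood_diff vgood_vsum) (auto intro!: vgood_mult assms good_ext_power)
qed

lemma hv_ext_div:
  assumes "good F" "\<And>k. vgood (P k)"
  shows "hv (ext_div F P k) =
    hv (P k) - (\<Sum>j\<leftarrow>[1..<Suc k]. h (ext_power j F) * hv (ext_div F P (k - j)))"
  unfolding ext_div.simps[of F P k] hv_diff hv_vsum using assms
  by (simp add: o_def good_ext_power vgood_ext_div cong: map_cong del: upt_Suc)

text \<open>The denominator of the exterior power series of a reduced bundle. In both instances of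
  the locale the values are the coefficients of (1 + t)^(-n).\<close>

definition inv_ext :: "nat \<Rightarrow> nat \<Rightarrow> 'r" where
  "inv_ext n k = hv (ext_div (trivial n) (\<lambda>k. if k = 0 then 1 else 0) k)"

lemma inv_ext_rec:
  "inv_ext n k = (if k = 0 then 1 else 0) - (\<Sum>j\<leftarrow>[1..<Suc k]. h (ext_power j (trivial n)) * inv_ext n (k - j))"
  unfolding inv_ext_def by (subst hv_ext_div) (auto simp del: upt_Suc)

text \<open>The trivial summand has multiplicity -1, so the fold in \<open>vext\<close> performs one
  division and one multiplication.\<close>

lemma vext_reduced:
  "vext k (reduced b) = ext_mult b (ext_div (trivial (bundle_rank b)) (\<lambda>k. if k = 0 then 1 else 0)) k"
  by (simp add: vext_def reduced_def bun_def minus_virt_def uminus_virt_def plus_virt_def vscale_def)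

lemma vgood_vext_reduced [simp]: "good b \<Longrightarrow> vgood (vext k (reduced b))"
  unfolding vext_reduced by (intro vgood_ext_mult vgood_ext_div) auto

lemma hv_vext_reduced:
  assumes "good b"
  shows "hv (vext k (reduced b)) = (\<Sum>j\<leftarrow>[0..<Suc k]. h (ext_power j b) * inv_ext (bundle_rank b) (k - j))"
  unfolding vext_reduced inv_ext_def
  by (rule hv_ext_mult) (use assms in \<open>auto intro!: vgood_ext_div\<close>)

lemma vgood_reduced [simp]: "good b \<Longrightarrow> vgood (reduced b)"
  by (simp add: reduced_def)

lemma hv_reduced: "hv (reduced b) = h b - of_nat (bundle_rank b)"
  by (simp add: reduced_def h_trivial)

lemma vgood_vsym_2: "(\<And>k. vgood (vext k V)) \<Longrightarrow> vgood (vsym 2 V)"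
  by (simp add: vsym.simps[of "Suc (Suc 0)"] vsym.simps[of "Suc 0"] vsym.simps[of 0] numeral_2_eq_2 vsum_def)

text \<open>The coefficient of t^2 in the equation that the symmetric power series is inverse to the
  alternating exterior one.\<close>

lemma hv_vsym_2: "(\<And>k. vgood (vext k V)) \<Longrightarrow> hv (vsym 2 V) = hv (vext 1 V) ^ 2 - hv (vext 2 V)"
  by (simp add: vsym.simps[of "Suc (Suc 0)"] vsym.simps[of "Suc 0"] vsym.simps[of 0] numeral_2_eq_2 vsum_def)

end

section \<open>Ranks\<close>

lemma aug_extd [simp]: "coeff (extd f x) {} = 0"
proof -
  have "coeff (dx i :: 'a form) {} = 0" for i by (simp add: dx_def)
  then show ?thesis by (simp add: extd_def aug.hom_mult)
qed

lemma aug_mult_mat_zero: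
  assumes "A \<in> carrier_mat n n" "B \<in> carrier_mat n n" "\<And>i j. i < n \<Longrightarrow> j < n \<Longrightarrow> coeff (A $$ (i, j)) {} = 0"
    "i < n" "j < n"
  shows "coeff ((A * B :: 'n::{finite,linorder} form mat) $$ (i, j)) {} = 0"
  using assms by (auto simp: scalar_prod_def aug.hom_mult)

text \<open>Records only that constant terms are absent. This is stable under tensor products and
  exterior powers and suffices to see that the curvature has no degree zero part.\<close>

definition nilpotent_conn :: "'n coords \<Rightarrow> 'n::{finite,linorder} cbundle \<Rightarrow> bool" where
  "nilpotent_conn x b \<longleftrightarrow> conn b x \<in> carrier_mat (crank b) (crank b) \<and>
     (\<forall>r<crank b. \<forall>s<crank b. coeff (conn b x $$ (r, s)) {} = 0)"

lemma curvature_carrier: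
  "nilpotent_conn x b \<Longrightarrow> curvature b x \<in> carrier_mat (crank b) (crank b)"
  by (auto simp: curvature_def nilpotent_conn_def)

lemma aug_curvature:
  assumes "nilpotent_conn x b" "r < crank b" "s < crank b"
  shows "coeff (curvature b x $$ (r, s)) {} = 0"
proof -
  have "coeff ((conn b x * conn b x) $$ (r, s)) {} = 0"
    using assms by (intro aug_mult_mat_zero[of _ "crank b"]) (auto simp: nilpotent_conn_def)
  then show ?thesis using assms by (auto simp: curvature_def nilpotent_conn_def)
qed

lemma map_mat_aug_curvature:
  "nilpotent_conn x b \<Longrightarrow> map_mat (\<lambda>a. coeff a {}) (curvature b x) = 0\<^sub>m (crank b) (crank b)"
  using curvature_carrier[of x b] by (intro eq_matI) (auto simp: aug_curvature)

lemma pow_0_mat: "(0\<^sub>m n n :: 'a::semiring_1 mat) ^\<^sub>m k = (if k = 0 then 1\<^sub>m n else 0\<^sub>m n n)"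
  by (cases k) auto

lemma aug_mtrace:
  assumes "A \<in> carrier_mat n n"
  shows "coeff (mtrace A) {} = mtrace (map_mat (\<lambda>a. coeff a {}) (A :: 'n::{finite,linorder} form mat))"
  using assms by (auto simp: mtrace_def)

text \<open>The curvature has zero augmentation, so only the term \<open>k = 0\<close>, the trace of
  the identity, contributes.\<close>

lemma aug_chern_char:
  assumes "nilpotent_conn x b"
  shows "coeff (chern_char b x) {} = of_nat (crank (b :: 'n::{finite,linorder} cbundle))"
proof -
  have "coeff (mtrace (curvature b x ^\<^sub>m k)) {} = (if k = 0 then of_nat (crank b) else 0)" for k
  proof -
    have "coeff (mtrace (curvature b x ^\<^sub>m k)) {} = mtrace (map_mat (\<lambda>a. coeff a {}) (curvature b x) ^\<^sub>m k)"
      using curvature_carrier[OF assms]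
      by (subst aug_mtrace[of _ "crank b"]) (auto simp: aug.mat_hom_pow[of _ "crank b"])
    then show ?thesis
      by (simp add: map_mat_aug_curvature[OF assms] pow_0_mat mtrace_def)
  qed
  then show ?thesis
    by (simp add: chern_char_def if_distrib[of "\<lambda>x. _ * x"] sum.delta cong: if_cong)
qed

section \<open>Connections on tensor products and exterior powers\<close>

lemma kron_carrier [simp]:
  "A \<in> carrier_mat a b \<Longrightarrow> B \<in> carrier_mat c d \<Longrightarrow> kron A B \<in> carrier_mat (a * c) (b * d)"
  by (auto simp: kron_def)

lemma kron_index:
  assumes "A \<in> carrier_mat a b" "B \<in> carrier_mat c d" "i < a * c" "j < b * d"
  shows "kron A B $$ (i, j) = A $$ (i div c, j div d) * B $$ (i mod c, j mod d)"
  using assms by (auto simp: kron_def)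

lemma div_mod_less: "i < a * c \<Longrightarrow> i div c < a \<and> i mod c < (c :: nat)"
  by (metis less_mult_imp_div_less mod_less_divisor mult_0_right not_gr_zero not_less0)

lemma nilpotent_conn_tensor:
  assumes "nilpotent_conn x a" "nilpotent_conn x b"
  shows "nilpotent_conn x (tensor a b)"
proof -
  let ?m = "crank a" and ?n = "crank b"
  have c: "conn a x \<in> carrier_mat ?m ?m" "conn b x \<in> carrier_mat ?n ?n"
    using assms by (auto simp: nilpotent_conn_def)
  have "coeff ((kron (conn a x) (1\<^sub>m ?n) + kron (1\<^sub>m ?m) (conn b x)) $$ (r, s)) {} = 0"
    if "r < ?m * ?n" "s < ?m * ?n" for r s
  proof -
    note [simp] = div_mod_less[OF that(1)] div_mod_less[OF that(2)]
    have "(kron (conn a x) (1\<^sub>m ?n) + kron (1\<^sub>m ?m) (conn b x)) $$ (r, s) =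
      conn a x $$ (r div ?n, s div ?n) * 1\<^sub>m ?n $$ (r mod ?n, s mod ?n) +
      1\<^sub>m ?m $$ (r div ?n, s div ?n) * conn b x $$ (r mod ?n, s mod ?n)"
      using c that carrier_matD[OF kron_carrier[OF one_carrier_mat[of ?m] c(2)]]
      by (subst index_add_mat) (auto simp: kron_index[OF c(1) one_carrier_mat] kron_index[OF one_carrier_mat c(2)])
    then show ?thesis
      using assms by (auto simp: aug.hom_mult nilpotent_conn_def)
  qed
  moreover have "kron (conn a x) (1\<^sub>m ?n) + kron (1\<^sub>m ?m) (conn b x) \<in> carrier_mat (?m * ?n) (?m * ?n)"
    using c by (intro add_carrier_mat kron_carrier) auto
  ultimately show ?thesis by (auto simp: nilpotent_conn_def tensor_cbundle_def)
qed

lemma sorted_wrt_subseq: "subseq xs ys \<Longrightarrow> sorted_wrt P ys \<Longrightarrow> sorted_wrt P xs"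
  by (induction rule: list_emb.induct) (auto elim: list_emb_set)

lemma ext_basis_nth:
  assumes "p < length (ext_basis n k)"
  shows "length (ext_basis n k ! p) = k" "set (ext_basis n k ! p) \<subseteq> {0..<n}" "sorted_wrt (<) (ext_basis n k ! p)"
proof -
  have "ext_basis n k ! p \<in> set (ext_basis n k)" using assms by simp
  then have *: "ext_basis n k ! p \<in> set (subseqs [0..<n])" "length (ext_basis n k ! p) = k"
    unfolding ext_basis_def by (simp_all add: ext_basis_def)
  then show "length (ext_basis n k ! p) = k" by simp
  have sub: "subseq (ext_basis n k ! p) [0..<n]" using * by simp
  then show "set (ext_basis n k ! p) \<subseteq> {0..<n}"
    by (auto elim: list_emb_set)
  show "sorted_wrt (<) (ext_basis n k ! p)"
    using sub sorted_wrt_upt by (rule sorted_wrt_subseq)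
qed

lemma nilpotent_conn_ext_power:
  assumes "nilpotent_conn x b"
  shows "nilpotent_conn x (ext_power k b)"
proof -
  have c: "dim_row (conn b x) = crank b" using assms by (auto simp: nilpotent_conn_def)
  have "coeff (conn b x $$ (i, ext_basis (crank b) k ! q ! s)) {} = 0"
    if "q < length (ext_basis (crank b) k)" "s < k" "i < crank b" for q i s
  proof -
    have "ext_basis (crank b) k ! q ! s \<in> {0..<crank b}"
      using ext_basis_nth(2)[OF that(1)] nth_mem[of s "ext_basis (crank b) k ! q"] that(2)
      by (simp add: ext_basis_nth(1)[OF that(1)] subset_iff)
    then show ?thesis using assms that by (auto simp: nilpotent_conn_def)
  qed
  then show ?thesis
    unfolding nilpotent_conn_def ext_power_cbundle_def
    by (simp add: ext_der_def Let_def c aug.hom_mult)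
qed

lemma rank_valuation: "bundle_valuation (nilpotent_conn x) (\<lambda>b. of_nat (crank b) :: complex)"
proof unfold_locales
  show "nilpotent_conn x (trivial n)" for n
    by (simp add: trivial_cbundle_def nilpotent_conn_def)
qed (simp_all add: nilpotent_conn_tensor nilpotent_conn_ext_power, simp_all add: trivial_cbundle_def tensor_cbundle_def)

lemma aug_ch:
  assumes "bundle_valuation.vgood (nilpotent_conn x) V"
  shows "coeff (ch V x) {} = bundle_valuation.hv (\<lambda>b. of_nat (crank b)) V"
proof -
  interpret bundle_valuation "nilpotent_conn x" "\<lambda>b. of_nat (crank b) :: complex"
    by (rule rank_valuation)
  have "coeff (\<Sum>(n, b)\<leftarrow>xs. of_int n * chern_char b x) {} = (\<Sum>(n, b)\<leftarrow>xs. of_int n * of_nat (crank b))"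
    if "\<forall>b\<in>snd ` set xs. nilpotent_conn x b" for xs
    using that
    by (induction xs) (auto simp: aug.hom_mult aug_chern_char simp flip: fconst_of_int)
  then show ?thesis using assms by (simp add: ch_def hv_def vgood_def)
qed

text \<open>On ranks the exterior power series of a reduced bundle is (1 + t)^n / (1 + t)^n = 1. The
  recursion for \<open>inv_ext\<close> is precisely the cancellation of the coefficient of
  t^k.\<close>

lemma
  assumes "nilpotent_conn x b" "k > 0"
  shows rank_vext_reduced:
    "bundle_valuation.hv (\<lambda>b. of_nat (crank b) :: complex) (vext k (reduced b)) = 0"
proof -
  interpret bundle_valuation "nilpotent_conn x" "\<lambda>b. of_nat (crank b) :: complex"
    by (rule rank_valuation)
  have r: "crank (ext_power j b) = crank b choose j" "crank (ext_power j (trivial n :: 'a cbundle)) = n choose j" for j n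
    by (simp_all add: ext_power_cbundle_def trivial_cbundle_def length_ext_basis)
  have "hv (vext k (reduced b)) = inv_ext (crank b) k +
    (\<Sum>j\<leftarrow>[1..<Suc k]. of_nat (crank b choose j) * inv_ext (crank b) (k - j))"
    unfolding hv_vext_reduced[OF assms(1)]
    by (simp add: r bundle_rank_cbundle_def upt_conv_Cons[of 0] del: upt_Suc)
  also have "\<dots> = 0"
    using assms(2) by (subst (1) inv_ext_rec) (simp add: r del: upt_Suc)
  finally show ?thesis .
qed

section \<open>Degree zero parts of the characteristic forms\<close>

lemma aug_numeral [simp]: "coeff (numeral k :: 'n::{finite,linorder} form) {} = numeral k"
  by (simp flip: fconst_numeral)

lemma aug_fexp:
  assumes "coeff a {} = 0"
  shows "coeff (fexp a) {} = 1"
  using assms by (simp add: fexp_def aug.hom_mult aug.hom_power power_0_left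
      if_distrib[of "\<lambda>x. _ * x"] cong: if_cong)

lemma aug_fsqrt:
  assumes "coeff a {} = 1"
  shows "coeff (fsqrt a) {} = 1"
  using assms by (simp add: fsqrt_def aug.hom_mult aug.hom_power aug.hom_minus power_0_left coeff_one
      if_distrib[of "\<lambda>x. _ * x"] cong: if_cong)

text \<open>The augmentation takes values in a commutative ring, so the Leibniz sum becomes the
  usual determinant, here of the identity.\<close>

lemma aug_fdet:
  assumes A: "A \<in> carrier_mat n n" and 1: "map_mat (\<lambda>a. coeff a {}) (A :: 'n::{finite,linorder} form mat) = 1\<^sub>m n"
  shows "coeff (fdet A) {} = 1"
proof -
  have prod: "coeff (prod_list fs) {} = prod_list (map (\<lambda>a. coeff a {}) fs)" for fs :: "'n form list"
    by (induction fs) (simp_all add: aug.hom_mult coeff_one)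
  have sgn: "coeff (of_int k * f) {} = of_int k * coeff f {}" for k and f :: "'n form"
    by (simp flip: fconst_of_int)
  have entry: "coeff (A $$ (i, p i)) {} = 1\<^sub>m n $$ (i, p i)" if "p permutes {0..<n}" "i \<in> {0..<n}" for i p
    using arg_cong[OF 1, of "\<lambda>B. B $$ (i, p i)"] A that permutes_in_image[OF that(1), of i] by simp
  have "coeff (fdet A) {} = (\<Sum>p | p permutes {0..<n}. of_int (sign p) * (\<Prod>i = 0..<n. coeff (A $$ (i, p i)) {}))"
    unfolding fdet_def using A
    by (auto simp: sgn prod o_def prod.distinct_set_conv_list[symmetric])
  also have "\<dots> = (\<Sum>p | p permutes {0..<n}. of_int (sign p) * (\<Prod>i = 0..<n. 1\<^sub>m n $$ (i, p i)))"
    by (intro sum.cong refl arg_cong2[of _ _ _ _ "(*)"] prod.cong) (use entry in blast)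
  also have "\<dots> = det (1\<^sub>m n :: complex mat)"
    by (simp add: det_def)
  finally show ?thesis by simp
qed

lemma map_mat_aug_add:
  "A \<in> carrier_mat n m \<Longrightarrow> B \<in> carrier_mat n m \<Longrightarrow> map_mat (\<lambda>a. coeff a {}) (A + B :: 'n::{finite,linorder} form mat) =
    map_mat (\<lambda>a. coeff a {}) A + map_mat (\<lambda>a. coeff a {}) B"
  by (auto intro!: eq_matI)

lemma map_mat_aug_msum:
  assumes "\<And>k. f k \<in> carrier_mat n n"
  shows "map_mat (\<lambda>a. coeff a {}) (msum n f ks :: 'n::{finite,linorder} form mat) =
    msum n (\<lambda>k. map_mat (\<lambda>a. coeff a {}) (f k)) ks \<and> msum n f ks \<in> carrier_mat n n"
proof (induction ks)
  case Nil
  then show ?case by (auto simp: msum_def)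
next
  case (Cons k ks)
  then show ?case using assms[of k] by (auto simp: msum_def map_mat_aug_add)
qed

lemma map_mat_aug_smult:
  "map_mat (\<lambda>a. coeff a {}) (c \<cdot>\<^sub>m A :: 'n::{finite,linorder} form mat) = coeff c {} \<cdot>\<^sub>m map_mat (\<lambda>a. coeff a {}) A"
  by (auto intro!: eq_matI simp: aug.hom_mult)

lemma msum_first:
  fixes A :: "'a::ring_1 mat"
  assumes "A \<in> carrier_mat n n" "\<And>k. k > 0 \<Longrightarrow> f k = 0\<^sub>m n n" "f 0 = A"
  shows "msum n f [0..<Suc d] = A"
proof -
  have "msum n f ks = 0\<^sub>m n n" if "0 \<notin> set ks" for ks
    using that by (induction ks) (auto simp: msum_def assms(2))
  then have "msum n f [1..<Suc d] = 0\<^sub>m n n" by simp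
  then have "A + msum n f [1..<Suc d] = A" using assms(1) by simp
  then show ?thesis
    using assms(3) by (simp add: msum_def upt_conv_Cons[of 0 "Suc d"] del: upt_Suc)
qed

text \<open>Under the augmentation both series reduce to their zeroth terms: \<open>S\<close> goes
  to the identity, hence \<open>1 - S\<close> to zero.\<close>

lemma aug_mat_x_over_sinh:
  fixes X :: "'n::{finite,linorder} form mat"
  assumes X: "X \<in> carrier_mat n n" and 0: "map_mat (\<lambda>a. coeff a {}) X = 0\<^sub>m n n"
  shows "map_mat (\<lambda>a. coeff a {}) (mat_x_over_sinh X) = 1\<^sub>m n" "mat_x_over_sinh X \<in> carrier_mat n n"
proof -
  let ?h = "map_mat (\<lambda>a. coeff a {})"
  define S where "S = msum n (\<lambda>k. fconst (1 / fact (2 * k + 1)) \<cdot>\<^sub>m (X ^\<^sub>m (2 * k))) [0..<Suc CARD('n)]"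
  have cS: "fconst (1 / fact (2 * k + 1)) \<cdot>\<^sub>m (X ^\<^sub>m (2 * k)) \<in> carrier_mat n n" for k
    using X by simp
  have hS: "?h S = 1\<^sub>m n" unfolding S_def map_mat_aug_msum[OF cS, THEN conjunct1]
  proof (rule msum_first)
    show "?h (fconst (1 / fact (2 * k + 1)) \<cdot>\<^sub>m X ^\<^sub>m (2 * k)) = 0\<^sub>m n n" if "k > 0" for k
      using X that by (simp add: map_mat_aug_smult aug.mat_hom_pow[OF X] 0 pow_0_mat)
    show "?h (fconst (1 / fact (2 * 0 + 1)) \<cdot>\<^sub>m X ^\<^sub>m (2 * 0)) = 1\<^sub>m n"
      using X by (auto simp: map_mat_aug_smult aug.mat_hom_one)
  qed auto
  have S: "S \<in> carrier_mat n n" unfolding S_def by (rule map_mat_aug_msum[THEN conjunct2], rule cS)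
  have D: "1\<^sub>m n - S \<in> carrier_mat n n" by (rule minus_carrier_mat[OF S])
  have hD: "?h (1\<^sub>m n - S) = 0\<^sub>m n n"
  proof (rule eq_matI)
    fix i j assume "i < dim_row (0\<^sub>m n n :: complex mat)" "j < dim_col (0\<^sub>m n n :: complex mat)"
    then show "?h (1\<^sub>m n - S) $$ (i, j) = 0\<^sub>m n n $$ (i, j)"
      using arg_cong[OF hS, of "\<lambda>B. B $$ (i, j)"] S by (auto simp: coeff_one)
  qed (use S in auto)
  have cD: "(1\<^sub>m n - S) ^\<^sub>m k \<in> carrier_mat n n" for k using D by simp
  have eq: "mat_x_over_sinh X = msum n (\<lambda>j. (1\<^sub>m n - S) ^\<^sub>m j) [0..<Suc CARD('n)]"
    using X by (simp add: mat_x_over_sinh_def Let_def S_def)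
  show "mat_x_over_sinh X \<in> carrier_mat n n" unfolding eq by (rule map_mat_aug_msum[THEN conjunct2], rule cD)
  show "?h (mat_x_over_sinh X) = 1\<^sub>m n"
    unfolding eq map_mat_aug_msum[OF cD, THEN conjunct1]
    by (rule msum_first) (use S in \<open>auto simp: aug.mat_hom_pow[OF D] hD pow_0_mat aug.mat_hom_one\<close>)
qed

lemma aug_A_hat:
  assumes "nilpotent_conn x b"
  shows "coeff (A_hat b x) {} = 1"
proof -
  let ?X = "fconst (\<i> / (4 * pi)) \<cdot>\<^sub>m curvature b x"
  have c: "?X \<in> carrier_mat (crank b) (crank b)" using curvature_carrier[OF assms] by simp
  have "map_mat (\<lambda>a. coeff a {}) ?X = 0\<^sub>m (crank b) (crank b)"
    using map_mat_aug_curvature[OF assms] by (simp add: map_mat_aug_smult)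
  from aug_mat_x_over_sinh[OF c this] show ?thesis
    unfolding A_hat_def by (intro aug_fsqrt aug_fdet)
qed

context
  fixes x :: "'n::{finite,linorder} coords"
begin

interpretation bundle_valuation "nilpotent_conn x" "\<lambda>b. of_nat (crank b) :: complex"
  by (rule rank_valuation)

lemma aug_m0:
  assumes "nilpotent_conn x S"
  shows "coeff (m0 \<kappa> S x) {} = of_nat (crank S) + coeff \<kappa> {}"
  using assms by (simp add: m0_def aug_ch)

lemma hv_reduced_rank: "hv (reduced b) = 0"
  by (simp add: hv_reduced bundle_rank_cbundle_def)

lemma aug_m1:
  assumes "nilpotent_conn x S" "nilpotent_conn x TM"
  shows "coeff (m1 \<kappa> S TM x) {} = 0"
  using assms
  by (simp add: m1_def Let_def aug_ch aug.hom_mult hv_reduced_rank rank_vext_reduced[of x])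

text \<open>Every summand contains a factor built from the reduced tangent bundle, of rank zero; the
  symmetric square is first rewritten by exterior powers.\<close>

lemma aug_m2:
  assumes "nilpotent_conn x S" "nilpotent_conn x TM"
  shows "coeff (m2 \<kappa> S TM x) {} = 0"
  using assms
  by (simp add: m2_def Let_def aug_ch aug.hom_mult hv_reduced_rank rank_vext_reduced[of x]
      vgood_vsym_2 hv_vsym_2)

lemma aug_b1:
  assumes "nilpotent_conn x Wi" "nilpotent_conn x Wj" "coeff c {} = 0"
  shows "coeff (b1 c Wi Wj x) {} = of_nat (crank Wi) + of_nat (crank Wj) - 16"
  using assms by (simp add: b1_def aug_ch h_trivial)

lemma aug_b2:
  assumes "nilpotent_conn x Wi" "nilpotent_conn x Wj" "nilpotent_conn x Wbi" "nilpotent_conn x Wbj"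
    "coeff c {} = 0"
  shows "coeff (b2 c Wi Wj Wbi Wbj x) {} = - 16 * of_nat (crank Wi) - 16 * of_nat (crank Wj) +
    of_nat (crank Wi) * of_nat (crank Wj) + of_nat (crank Wbi) + of_nat (crank Wbj) + 104"
  using assms by (simp add: b2_def aug_ch h_trivial aug.hom_mult)

end

section \<open>The bundles of the theorem in local frames\<close>

lemma hdeg_one_form_mat:
  "r < n \<Longrightarrow> s < n \<Longrightarrow> hdeg 1 (one_form_mat n \<alpha> $$ (r, s))"
  by (auto simp: one_form_mat_def intro!: hdeg_sum hdeg_fconst_mult hdeg_dx[simplified])

lemma nilpotent_conn_one_form_mat: "nilpotent_conn x (CBundle n (\<lambda>y. one_form_mat n (\<alpha> y)))"
  using hdeg_pos_aug[OF hdeg_one_form_mat[of _ n _ "\<alpha> x"]]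
  by (auto simp: nilpotent_conn_def) (auto simp: one_form_mat_def)

lemma nilpotent_conn_characteristic:
  "nilpotent_conn x (tangent_bundle hh e)" "nilpotent_conn x (spinor_bundle hh e)"
  "nilpotent_conn x (W_bundle A)" "nilpotent_conn x (Wbar_bundle \<rho> A)"
  by (simp_all add: tangent_bundle_def spinor_bundle_def W_bundle_def Wbar_bundle_def
      associated_bundle_def nilpotent_conn_one_form_mat)

text \<open>The spinor rank is 2^3 as \<open>7 div 2 = 3\<close>, and 4124 = 1 + 248 + 3875.\<close>

lemma crank_characteristic:
  "crank (tangent_bundle hh e) = 7" "crank (spinor_bundle hh e) = 8"
  "crank (W_bundle A) = 248" "crank (Wbar_bundle \<rho> A) = 4124"
  by (simp_all add: tangent_bundle_def spinor_bundle_def W_bundle_def Wbar_bundle_def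
      associated_bundle_def spinor_dim_def)

text \<open>Every term is a multiple of \<open>\<tau>\<close>, and after division by
  \<open>e\<close> the claim is the equation 16 * (2160 + 480 * 240 + 61920) = 16 * (196560 - 24 *
  (240 + 480)), both sides being 16 * 179280.\<close>

lemma top_degree_reduction:
  fixes \<mu>0 :: "7 form"
  assumes \<tau>: "hdeg 7 \<tau>" "\<eta>0 = fconst e * \<tau>" "\<eta>1 = fconst (240 * e) * \<tau>" "\<eta>2 = fconst (2160 * e) * \<tau>"
    and aug: "coeff q {} = 1" "coeff \<mu>0 {} = 16" "coeff \<mu>1 {} = 0" "coeff \<mu>2 {} = 0"
      "coeff \<beta>1 {} = 480" "coeff \<beta>2 {} = 61920"
  shows "degree_part 7 (q * (\<mu>2 * \<eta>0 + \<mu>1 * \<eta>1 + \<mu>0 * \<eta>2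
               + \<beta>1 * (\<mu>1 * \<eta>0 + \<mu>0 * \<eta>1) + \<beta>2 * \<mu>0 * \<eta>0))
           = 196560 * degree_part 7 (q * \<mu>0 * \<eta>0)
             - 24 * degree_part 7 (q * (\<mu>1 * \<eta>0 + \<mu>0 * \<eta>1 + \<beta>1 * \<mu>0 * \<eta>0))"
proof -
  have "hdeg CARD(7) \<tau>" using \<tau>(1) by simp
  then have top: "a * (fconst c * \<tau>) = fconst (coeff a {} * c) * \<tau>" for a c
    using mult_top_degree[of \<tau> "a * fconst c"] by (simp add: mult.assoc aug.hom_mult)
  have deg: "degree_part 7 (fconst c * \<tau>) = fconst c * \<tau>" for c
    by (intro degree_part_eq hdeg_fconst_mult \<tau>(1))
  have add: "fconst c * \<tau> + fconst d * \<tau> = fconst (c + d) * \<tau>" for c d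
    by (simp add: fconst.hom_add distrib_right)
  have diff: "fconst c * \<tau> - fconst d * \<tau> = fconst (c - d) * \<tau>" for c d
    by (simp add: fconst.hom_minus left_diff_distrib)
  have fc: "fconst c * (fconst d * \<tau>) = fconst (c * d) * \<tau>" for c d
    by (simp add: fconst.hom_mult mult.assoc)
  have num: "196560 * a = fconst 196560 * a" "24 * a = fconst 24 * a" for a :: "7 form"
    by (simp_all add: fconst_numeral)
  show ?thesis
    unfolding \<tau>(2-4) mult.assoc
    by (simp only: top add deg num aug fc diff)
      (rule arg_cong[of _ _ "\<lambda>c. fconst c * \<tau>"], simp)
qed

section \<open>Matrices over noncommutative rings\<close>

text \<open>Entries of products are expanded on demand by \<open>index_mult_mat_sum\<close>, as sums
  over \<open>{..<m}\<close> instead of scalar products of rows and columns.\<close>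

declare index_mult_mat(1) [simp del]

lemma pow_mat_Suc_left:
  assumes "(A :: 'a::semiring_1 mat) \<in> carrier_mat n n"
  shows "A ^\<^sub>m Suc k = A * A ^\<^sub>m k"
proof (induction k)
  case (Suc k)
  have "A ^\<^sub>m Suc (Suc k) = (A * A ^\<^sub>m k) * A" using Suc by simp
  also have "\<dots> = A * A ^\<^sub>m Suc k"
    using assms by (simp add: assoc_mult_mat[OF assms pow_carrier_mat[OF assms] assms])
  finally show ?case .
qed (use assms in simp)

lemma pow_mat_add:
  assumes "(A :: 'a::semiring_1 mat) \<in> carrier_mat n n"
  shows "A ^\<^sub>m (k + l) = A ^\<^sub>m k * A ^\<^sub>m l"
proof (induction l)
  case (Suc l)
  then show ?case
    by (simp add: assoc_mult_mat[OF pow_carrier_mat[OF assms] pow_carrier_mat[OF assms] assms])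
qed (use assms in simp)

lemma pow_mat_mult2:
  assumes "(A :: 'a::semiring_1 mat) \<in> carrier_mat n n"
  shows "(A * A) ^\<^sub>m k = A ^\<^sub>m (2 * k)"
proof (induction k)
  case (Suc k)
  have "A ^\<^sub>m (2 * Suc k) = A ^\<^sub>m (2 * k) * A ^\<^sub>m 2"
    by (subst pow_mat_add[OF assms, symmetric]) simp
  moreover have "A ^\<^sub>m 2 = A * A" using assms by (simp add: numeral_2_eq_2)
  ultimately show ?case using Suc by simp
qed (use assms in simp)

lemma index_mult_mat_sum:
  assumes "A \<in> carrier_mat n m" "B \<in> carrier_mat m k" "i < n" "j < k"
  shows "(A * B) $$ (i, j) = (\<Sum>l<m. A $$ (i, l) * B $$ (l, j))"
  using assms by (auto simp: index_mult_mat(1) scalar_prod_def atLeast0LessThan)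

lemma mtrace_carrier: "A \<in> carrier_mat n m \<Longrightarrow> mtrace A = (\<Sum>i<n. A $$ (i, i))"
  by (auto simp: mtrace_def)

lemma mtrace_add: "A \<in> carrier_mat n n \<Longrightarrow> B \<in> carrier_mat n n \<Longrightarrow> mtrace (A + B) = mtrace A + mtrace B"
  by (auto simp: mtrace_def sum.distrib)

lemma mtrace_smult: "A \<in> carrier_mat n n \<Longrightarrow> mtrace (c \<cdot>\<^sub>m A) = c * mtrace (A :: 'a::semiring_0 mat)"
  by (auto simp: mtrace_def sum_distrib_left)

subsection \<open>Linear combinations\<close>

definition lincomb :: "nat \<Rightarrow> nat \<Rightarrow> nat \<Rightarrow> (nat \<Rightarrow> 'a::semiring_0) \<Rightarrow> (nat \<Rightarrow> 'a mat) \<Rightarrow> 'a mat" where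
  "lincomb r s N t M = mat r s (\<lambda>(p, q). \<Sum>i<N. t i * M i $$ (p, q))"

lemma lincomb_carrier [simp]: "lincomb r s N t M \<in> carrier_mat r s"
  and lincomb_dim [simp]: "dim_row (lincomb r s N t M) = r" "dim_col (lincomb r s N t M) = s"
  and lincomb_index [simp]: "p < r \<Longrightarrow> q < s \<Longrightarrow> lincomb r s N t M $$ (p, q) = (\<Sum>i<N. t i * M i $$ (p, q))"
  by (simp_all add: lincomb_def)

lemma lincomb_cong:
  assumes "\<And>i. i < N \<Longrightarrow> t i = t' i" "\<And>i. i < N \<Longrightarrow> M i = M' i"
  shows "lincomb r s N t M = lincomb r s N t' M'"
  using assms by (intro eq_matI) auto

lemma lincomb_mult_right:
  assumes "\<And>i. i < N \<Longrightarrow> M i \<in> carrier_mat r n" "B \<in> carrier_mat n s"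
  shows "lincomb r n N t M * B = lincomb r s N t (\<lambda>i. M i * B)"
proof (rule eq_matI)
  fix p q assume "p < dim_row (lincomb r s N t (\<lambda>i. M i * B))" "q < dim_col (lincomb r s N t (\<lambda>i. M i * B))"
  then have pq: "p < r" "q < s" by auto
  have "(lincomb r n N t M * B) $$ (p, q) = (\<Sum>l<n. (\<Sum>i<N. t i * M i $$ (p, l)) * B $$ (l, q))"
    using pq assms by (simp add: index_mult_mat_sum[of _ r n])
  also have "\<dots> = (\<Sum>i<N. t i * (\<Sum>l<n. M i $$ (p, l) * B $$ (l, q)))"
    unfolding sum_distrib_left sum_distrib_right by (subst sum.swap) (simp add: mult.assoc)
  also have "\<dots> = lincomb r s N t (\<lambda>i. M i * B) $$ (p, q)"
    using pq assms by (simp add: index_mult_mat_sum[of _ r n])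
  finally show "(lincomb r n N t M * B) $$ (p, q) = lincomb r s N t (\<lambda>i. M i * B) $$ (p, q)" .
qed (use assms in auto)

text \<open>Scalars stand on the left and are forms, so pulling \<open>A\<close> inside may change
  them: \<open>u\<close> is \<open>t\<close> if one side is even and \<open>- t\<close> if both are
  odd.\<close>

lemma lincomb_mult_left:
  fixes A :: "'a::ring_1 mat"
  assumes "\<And>i. i < N \<Longrightarrow> M i \<in> carrier_mat n s" "A \<in> carrier_mat r n"
    and "\<And>i p q. i < N \<Longrightarrow> p < r \<Longrightarrow> q < n \<Longrightarrow> A $$ (p, q) * t i = u i * A $$ (p, q)"
  shows "A * lincomb n s N t M = lincomb r s N u (\<lambda>i. A * M i)"
proof (rule eq_matI)
  fix p q assume "p < dim_row (lincomb r s N u (\<lambda>i. A * M i))" "q < dim_col (lincomb r s N u (\<lambda>i. A * M i))"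
  then have pq: "p < r" "q < s" by auto
  have "(A * lincomb n s N t M) $$ (p, q) = (\<Sum>l<n. A $$ (p, l) * (\<Sum>i<N. t i * M i $$ (l, q)))"
    using pq by (simp add: index_mult_mat_sum[OF assms(2) lincomb_carrier])
  also have "\<dots> = (\<Sum>l<n. \<Sum>i<N. u i * (A $$ (p, l) * M i $$ (l, q)))"
    unfolding sum_distrib_left
    by (intro sum.cong refl) (use assms(3) pq in \<open>simp flip: mult.assoc\<close>)
  also have "\<dots> = (\<Sum>i<N. u i * (\<Sum>l<n. A $$ (p, l) * M i $$ (l, q)))"
    by (subst sum.swap) (simp add: sum_distrib_left)
  also have "\<dots> = lincomb r s N u (\<lambda>i. A * M i) $$ (p, q)"
    using pq assms(1) by (simp add: index_mult_mat_sum[OF assms(2), of _ s])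
  finally show "(A * lincomb n s N t M) $$ (p, q) = lincomb r s N u (\<lambda>i. A * M i) $$ (p, q)" .
qed (use assms in auto)

lemma lincomb_lincomb:
  "lincomb r s N t (\<lambda>i. lincomb r s K (u i) M) = lincomb r s K (\<lambda>k. \<Sum>i<N. t i * u i k) M"
proof (rule eq_matI)
  fix p q assume "p < dim_row (lincomb r s K (\<lambda>k. \<Sum>i<N. t i * u i k) M)"
    "q < dim_col (lincomb r s K (\<lambda>k. \<Sum>i<N. t i * u i k) M)"
  then have pq: "p < r" "q < s" by auto
  have "(\<Sum>i<N. t i * (\<Sum>k<K. u i k * M k $$ (p, q))) = (\<Sum>i<N. \<Sum>k<K. t i * u i k * M k $$ (p, q))"
    by (simp add: sum_distrib_left mult.assoc)
  also have "\<dots> = (\<Sum>k<K. (\<Sum>i<N. t i * u i k) * M k $$ (p, q))"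
    by (subst sum.swap) (simp add: sum_distrib_right)
  finally show "lincomb r s N t (\<lambda>i. lincomb r s K (u i) M) $$ (p, q) =
    lincomb r s K (\<lambda>k. \<Sum>i<N. t i * u i k) M $$ (p, q)"
    using pq by simp
qed auto

lemma lincomb_delta:
  fixes M :: "nat \<Rightarrow> 'a::semiring_1 mat"
  assumes "M j \<in> carrier_mat r s" "j < N"
  shows "lincomb r s N (\<lambda>i. if i = j then 1 else 0) M = M j"
  using assms by (intro eq_matI) (auto simp: if_distrib[of "\<lambda>x. x * _"] cong: if_cong)

lemma mtrace_lincomb:
  assumes "\<And>i. i < N \<Longrightarrow> M i \<in> carrier_mat r r"
  shows "mtrace (lincomb r r N t M) = (\<Sum>i<N. t i * mtrace (M i))"
proof -
  have "mtrace (lincomb r r N t M) = (\<Sum>p<r. \<Sum>i<N. t i * M i $$ (p, p))"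
    by (simp add: mtrace_def)
  also have "\<dots> = (\<Sum>i<N. t i * (\<Sum>p<r. M i $$ (p, p)))"
    by (subst sum.swap) (simp add: sum_distrib_left)
  finally show ?thesis using assms by (simp add: mtrace_carrier[of _ r r])
qed

lemma lincomb_add_right:
  assumes "\<And>i. i < N \<Longrightarrow> M i \<in> carrier_mat r s" "\<And>i. i < N \<Longrightarrow> M' i \<in> carrier_mat r s"
  shows "lincomb r s N t (\<lambda>i. M i + M' i) = lincomb r s N t M + lincomb r s N t M'"
proof (rule eq_matI)
  fix p q assume "p < dim_row (lincomb r s N t M + lincomb r s N t M')"
    "q < dim_col (lincomb r s N t M + lincomb r s N t M')"
  then have pq: "p < r" "q < s" by auto
  then have "(M i + M' i) $$ (p, q) = M i $$ (p, q) + M' i $$ (p, q)" if "i < N" for i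
    using assms(1)[OF that] assms(2)[OF that] by auto
  then show "lincomb r s N t (\<lambda>i. M i + M' i) $$ (p, q) = (lincomb r s N t M + lincomb r s N t M') $$ (p, q)"
    using pq by (simp add: distrib_left sum.distrib)
qed auto

subsection \<open>Kronecker products\<close>

lemma sum_div_mod: "(\<Sum>k<a * c. f (k div c) (k mod c)) = (\<Sum>p<a. \<Sum>q<(c::nat). f p q)"
proof -
  have "(\<Sum>p<a. \<Sum>q<c. f p q) = (\<Sum>(p, q)\<in>{..<a} \<times> {..<c}. f p q)"
    by (rule sum.cartesian_product)
  also have "\<dots> = (\<Sum>k<a * c. f (k div c) (k mod c))"
  proof (rule sum.reindex_bij_witness[where i = "\<lambda>k. (k div c, k mod c)" and j = "\<lambda>(p, q). p * c + q"], goal_cases)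
    case (2 x)
    then obtain p q where "x = (p, q)" "p < a" "q < c" by auto
    moreover from this have "p * c + q < a * c"
      using mult_le_mono1[of "Suc p" a c] by simp
    ultimately show ?case by auto
  qed (auto simp: div_mod_less)
  finally show ?thesis ..
qed

text \<open>Forming the product exchanges the entries of \<open>B\<close> and \<open>C\<close>; for
  odd forms this costs the central sign \<open>s\<close>, so the mixed product rule holds only up to
  \<open>s\<close>.\<close>

lemma kron_mult_sign:
  fixes A :: "'a::ring_1 mat"
  assumes A: "A \<in> carrier_mat a b" and B: "B \<in> carrier_mat c d"
    and C: "C \<in> carrier_mat b e" and D: "D \<in> carrier_mat d f"
    and comm: "\<And>i j k l. i < c \<Longrightarrow> j < d \<Longrightarrow> k < b \<Longrightarrow> l < e \<Longrightarrow>
      B $$ (i, j) * C $$ (k, l) = s * (C $$ (k, l) * B $$ (i, j))"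
    and cent: "\<And>x. s * x = x * s"
  shows "kron A B * kron C D = s \<cdot>\<^sub>m kron (A * C) (B * D)"
proof (rule eq_matI)
  fix i j assume "i < dim_row (s \<cdot>\<^sub>m kron (A * C) (B * D))" "j < dim_col (s \<cdot>\<^sub>m kron (A * C) (B * D))"
  then have ij: "i < a * c" "j < e * f" using A B C D by (auto simp: kron_def)
  note dm = div_mod_less[OF ij(1)] div_mod_less[OF ij(2)]
  have "(kron A B * kron C D) $$ (i, j) = (\<Sum>k<b * d.
      A $$ (i div c, k div d) * B $$ (i mod c, k mod d) * (C $$ (k div d, j div f) * D $$ (k mod d, j mod f)))"
    using ij A B C D by (subst index_mult_mat_sum[of _ "a * c" "b * d" _ "e * f"]) (auto simp: kron_index)
  also have "\<dots> = (\<Sum>p<b. \<Sum>q<d.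
      A $$ (i div c, p) * B $$ (i mod c, q) * (C $$ (p, j div f) * D $$ (q, j mod f)))"
    by (rule sum_div_mod)
  also have "\<dots> = (\<Sum>p<b. \<Sum>q<d. s *
      ((A $$ (i div c, p) * C $$ (p, j div f)) * (B $$ (i mod c, q) * D $$ (q, j mod f))))"
  proof (intro sum.cong refl)
    fix p q assume "p \<in> {..<b}" "q \<in> {..<d}"
    then have "B $$ (i mod c, q) * C $$ (p, j div f) = s * (C $$ (p, j div f) * B $$ (i mod c, q))"
      using comm dm by auto
    then have "A $$ (i div c, p) * (B $$ (i mod c, q) * C $$ (p, j div f)) * D $$ (q, j mod f) =
      (A $$ (i div c, p) * s) * (C $$ (p, j div f) * B $$ (i mod c, q)) * D $$ (q, j mod f)"
      by (simp add: mult.assoc)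
    then show "A $$ (i div c, p) * B $$ (i mod c, q) * (C $$ (p, j div f) * D $$ (q, j mod f)) =
      s * ((A $$ (i div c, p) * C $$ (p, j div f)) * (B $$ (i mod c, q) * D $$ (q, j mod f)))"
      unfolding cent[symmetric] by (simp add: mult.assoc)
  qed
  also have "\<dots> = s * ((\<Sum>p<b. A $$ (i div c, p) * C $$ (p, j div f)) * (\<Sum>q<d. B $$ (i mod c, q) * D $$ (q, j mod f)))"
    by (subst sum_product) (simp only: sum_distrib_left)
  also have "\<dots> = (s \<cdot>\<^sub>m kron (A * C) (B * D)) $$ (i, j)"
    using ij dm carrier_matD[OF kron_carrier[OF mult_carrier_mat[OF A C] mult_carrier_mat[OF B D]]]
    by (simp add: kron_index[OF mult_carrier_mat[OF A C] mult_carrier_mat[OF B D]]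
        index_mult_mat_sum[OF A C] index_mult_mat_sum[OF B D])
  finally show "(kron A B * kron C D) $$ (i, j) = (s \<cdot>\<^sub>m kron (A * C) (B * D)) $$ (i, j)" .
qed (use A B C D in \<open>auto simp: kron_def\<close>)

lemma smult_one_mat: "(1 :: 'a::semiring_1) \<cdot>\<^sub>m A = A"
  by (intro eq_matI) auto

lemma kron_mult:
  fixes A :: "'a::ring_1 mat"
  assumes "A \<in> carrier_mat a b" "B \<in> carrier_mat c d" "C \<in> carrier_mat b e" "D \<in> carrier_mat d f"
    and "\<And>i j k l. i < c \<Longrightarrow> j < d \<Longrightarrow> k < b \<Longrightarrow> l < e \<Longrightarrow>
      B $$ (i, j) * C $$ (k, l) = C $$ (k, l) * B $$ (i, j)"
  shows "kron A B * kron C D = kron (A * C) (B * D)"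
  using kron_mult_sign[of A a b B c d C e D f 1] assms by (simp add: smult_one_mat)

lemma mtrace_kron:
  assumes "A \<in> carrier_mat a a" "B \<in> carrier_mat c c"
  shows "mtrace (kron A B) = mtrace A * mtrace (B :: 'a::semiring_0 mat)"
proof -
  have "mtrace (kron A B) = (\<Sum>k<a * c. A $$ (k div c, k div c) * B $$ (k mod c, k mod c))"
    using assms by (auto simp: mtrace_carrier[OF kron_carrier[OF assms]] kron_index[OF assms] intro!: sum.cong)
  also have "\<dots> = (\<Sum>p<a. \<Sum>q<c. A $$ (p, p) * B $$ (q, q))" by (rule sum_div_mod)
  finally show ?thesis using assms by (simp add: mtrace_carrier sum_product)
qed

lemma kron_one: "kron (1\<^sub>m a) (1\<^sub>m c) = (1\<^sub>m (a * c) :: 'a::semiring_1 mat)"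
proof (rule eq_matI)
  fix i j assume "i < dim_row (1\<^sub>m (a * c) :: 'a mat)" "j < dim_col (1\<^sub>m (a * c) :: 'a mat)"
  then have ij: "i < a * c" "j < a * c" by auto
  have "i = j \<longleftrightarrow> i div c = j div c \<and> i mod c = j mod c" by (metis div_mult_mod_eq)
  then show "kron (1\<^sub>m a) (1\<^sub>m c) $$ (i, j) = (1\<^sub>m (a * c) :: 'a mat) $$ (i, j)"
    using ij div_mod_less[OF ij(1)] div_mod_less[OF ij(2)]
    by (simp add: kron_index[OF one_carrier_mat one_carrier_mat])
qed (auto simp: kron_def)

lemma kron_add_right:
  assumes "A \<in> carrier_mat a b" "B \<in> carrier_mat c d" "B' \<in> carrier_mat c d"
  shows "kron A (B + B' :: 'a::semiring_0 mat) = kron A B + kron A B'"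
proof (rule eq_matI)
  fix i j assume "i < dim_row (kron A B + kron A B')" "j < dim_col (kron A B + kron A B')"
  then have ij: "i < a * c" "j < b * d" using assms by (auto simp: kron_def)
  then show "kron A (B + B') $$ (i, j) = (kron A B + kron A B') $$ (i, j)"
    using assms carrier_matD[OF kron_carrier[OF assms(1,3)]] div_mod_less[OF ij(1)] div_mod_less[OF ij(2)]
    by (simp add: kron_index[OF assms(1,2)] kron_index[OF assms(1,3)]
        kron_index[OF assms(1) add_carrier_mat[OF assms(3)]] distrib_left)
qed (use assms in \<open>auto simp: kron_def\<close>)

section \<open>Matrices of homogeneous forms\<close>

definition mdeg :: "nat \<Rightarrow> 'n form mat \<Rightarrow> bool" where
  "mdeg k A \<longleftrightarrow> (\<forall>i<dim_row A. \<forall>j<dim_col A. hdeg k (A $$ (i, j)))"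

lemma mdegD: "mdeg k A \<Longrightarrow> A \<in> carrier_mat n m \<Longrightarrow> i < n \<Longrightarrow> j < m \<Longrightarrow> hdeg k (A $$ (i, j))"
  by (auto simp: mdeg_def)

lemma mdeg_mult:
  fixes A :: "'n::{finite,linorder} form mat"
  assumes "mdeg k A" "mdeg l B" "A \<in> carrier_mat n m" "B \<in> carrier_mat m r"
  shows "mdeg (k + l) (A * B)"
  unfolding mdeg_def
proof (intro allI impI)
  fix i j assume "i < dim_row (A * B)" "j < dim_col (A * B)"
  then have "i < n" "j < r" using assms by auto
  then show "hdeg (k + l) ((A * B) $$ (i, j))"
    using assms mdegD[OF assms(1,3)] mdegD[OF assms(2,4)]
    by (auto simp: index_mult_mat_sum[OF assms(3,4)] intro!: hdeg_sum hdeg_mult)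
qed

lemma mdeg_one [simp]: "mdeg 0 (1\<^sub>m n :: 'n::{finite,linorder} form mat)"
  by (simp add: mdeg_def)

lemma mdeg_map_fconst [simp]: "mdeg 0 (map_mat fconst A)"
  by (simp add: mdeg_def)

lemma mdeg_pow:
  fixes A :: "'n::{finite,linorder} form mat"
  assumes "mdeg d A" "A \<in> carrier_mat n n"
  shows "mdeg (k * d) (A ^\<^sub>m k)"
proof (induction k)
  case (Suc k)
  then show ?case using mdeg_mult[OF Suc assms(1) pow_carrier_mat assms(2)] assms
    by (simp add: add.commute)
qed simp

lemma hdeg_mtrace: "mdeg k A \<Longrightarrow> A \<in> carrier_mat n n \<Longrightarrow> hdeg k (mtrace (A :: 'n::{finite,linorder} form mat))"
  by (auto simp: mtrace_def mdeg_def intro!: hdeg_sum)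

lemma mtrace_supercomm:
  fixes A :: "'n::{finite,linorder} form mat"
  assumes "A \<in> carrier_mat n m" "B \<in> carrier_mat m n" "mdeg k A" "mdeg l B"
  shows "mtrace (A * B) = (-1) ^ (k * l) * mtrace (B * A)"
proof -
  have "mtrace (A * B) = (\<Sum>i<n. \<Sum>j<m. A $$ (i, j) * B $$ (j, i))"
    using assms by (simp add: mtrace_carrier[OF mult_carrier_mat[OF assms(1,2)]] index_mult_mat_sum[OF assms(1,2)])
  also have "\<dots> = (\<Sum>i<n. \<Sum>j<m. (-1) ^ (k * l) * (B $$ (j, i) * A $$ (i, j)))"
    using assms mdegD[OF assms(3,1)] mdegD[OF assms(4,2)]
    by (intro sum.cong refl, subst supercommute[of l _ k]) (auto simp: mult.commute)
  also have "\<dots> = (-1) ^ (k * l) * (\<Sum>j<m. \<Sum>i<n. B $$ (j, i) * A $$ (i, j))"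
    by (subst sum.swap) (simp add: sum_distrib_left)
  finally show ?thesis
    using assms by (simp add: mtrace_carrier[OF mult_carrier_mat[OF assms(2,1)]] index_mult_mat_sum[OF assms(2,1)])
qed

lemma mtrace_comm_even:
  fixes A :: "'n::{finite,linorder} form mat"
  assumes "A \<in> carrier_mat n m" "B \<in> carrier_mat m n" "mdeg k A" "mdeg l B" "even k \<or> even l"
  shows "mtrace (A * B) = mtrace (B * A)"
  using mtrace_supercomm[OF assms(1-4)] assms(5) by auto

lemma form_double_eq_0:
  assumes "a = - (a :: 'n::{finite,linorder} form)"
  shows "a = 0"
proof (rule form_eqI)
  fix I have "coeff a I = - coeff a I" using arg_cong[OF assms, of "\<lambda>f. coeff f I"] by simp
  then show "coeff a I = coeff 0 I" by simp
qed

text \<open>Cyclicity moves one odd factor past an odd number of odd factors, so the trace equals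
  its own negative.\<close>

lemma mtrace_even_power:
  fixes A :: "'n::{finite,linorder} form mat"
  assumes "A \<in> carrier_mat n n" "mdeg 1 A" "even k" "k > 0"
  shows "mtrace (A ^\<^sub>m k) = 0"
proof -
  obtain j where k: "k = Suc j" "odd j" using assms(3,4) by (cases k) auto
  have "mtrace (A ^\<^sub>m j * A) = (-1) ^ (j * 1) * mtrace (A * A ^\<^sub>m j)"
    using assms mdeg_pow[OF assms(2,1), of j] by (intro mtrace_supercomm) auto
  then have "mtrace (A ^\<^sub>m k) = - mtrace (A ^\<^sub>m k)"
    using k pow_mat_Suc_left[OF assms(1), of j] by simp
  then show ?thesis by (rule form_double_eq_0)
qed

section \<open>Differentials of matrix functions\<close>

definition dfun :: "('n coords \<Rightarrow> complex) \<Rightarrow> 'n coords \<Rightarrow> 'n::{finite,linorder} form" where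
  "dfun h x = extd (\<lambda>y. fconst (h y)) x"

lemma dfun_eq: "dfun h x = (\<Sum>i\<in>UNIV. fconst (frechet_derivative h (at x) (axis i 1)) * dx i)"
proof -
  have "Form (\<lambda>I :: 'a set. frechet_derivative (\<lambda>y. coeff (fconst (h y)) I) (at x) (axis i 1)) =
    fconst (frechet_derivative h (at x) (axis i 1))" for i
    by (rule form_eqI) (simp add: coeff_fconst)
  then show ?thesis by (simp add: dfun_def extd_def mult_fconst)
qed

lemma hdeg_dfun: "hdeg 1 (dfun h x)"
  unfolding dfun_eq by (intro hdeg_sum hdeg_fconst_mult hdeg_dx)

lemma dfun_const [simp]: "dfun (\<lambda>y. c) x = 0"
  by (simp add: dfun_eq)

lemma dfun_transform:
  assumes "h differentiable at x" "open X" "x \<in> X" "\<And>y. y \<in> X \<Longrightarrow> h y = h' y"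
  shows "dfun h x = dfun h' x"
  using frechet_derivative_transform_within_open[OF assms] by (simp add: dfun_eq)

lemma frechet_derivative_eqI: "(f has_derivative f') (at x) \<Longrightarrow> frechet_derivative f (at x) = f'"
  by (metis frechet_derivative_at)

lemma dfun_sum:
  assumes "\<And>i. i \<in> S \<Longrightarrow> h i differentiable at x"
  shows "dfun (\<lambda>y. \<Sum>i\<in>S. h i y) x = (\<Sum>i\<in>S. dfun (h i) x)"
proof -
  have "((\<lambda>y. \<Sum>i\<in>S. h i y) has_derivative (\<lambda>v. \<Sum>i\<in>S. frechet_derivative (h i) (at x) v)) (at x)"
    using assms by (intro has_derivative_sum) (simp add: frechet_derivative_works)
  then have "frechet_derivative (\<lambda>y. \<Sum>i\<in>S. h i y) (at x) = (\<lambda>v. \<Sum>i\<in>S. frechet_derivative (h i) (at x) v)"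
    by (rule frechet_derivative_eqI)
  then show ?thesis
    by (simp add: dfun_eq fconst.hom_sum sum_distrib_right sum.swap[of _ UNIV])
qed

lemma dfun_mult:
  assumes "h differentiable at x" "k differentiable at x"
  shows "dfun (\<lambda>y. h y * k y) x = fconst (h x) * dfun k x + fconst (k x) * dfun h x"
proof -
  have "((\<lambda>y. h y * k y) has_derivative
      (\<lambda>v. h x * frechet_derivative k (at x) v + frechet_derivative h (at x) v * k x)) (at x)"
    using assms by (intro has_derivative_mult) (simp_all add: frechet_derivative_works)
  then have "frechet_derivative (\<lambda>y. h y * k y) (at x) =
      (\<lambda>v. h x * frechet_derivative k (at x) v + frechet_derivative h (at x) v * k x)"
    by (rule frechet_derivative_eqI)
  then show ?thesis
    by (simp add: dfun_eq fconst.hom_add fconst.hom_mult sum_distrib_left algebra_simps sum.distrib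
        mult.commute[of _ "k x"])
qed

definition dmx :: "nat \<Rightarrow> nat \<Rightarrow> ('n coords \<Rightarrow> complex mat) \<Rightarrow> 'n coords \<Rightarrow> 'n::{finite,linorder} form mat" where
  "dmx r s f x = mat r s (\<lambda>(i, j). dfun (\<lambda>y. f y $$ (i, j)) x)"

lemma dmx_carrier [simp]: "dmx r s f x \<in> carrier_mat r s"
  and dmx_dim [simp]: "dim_row (dmx r s f x) = r" "dim_col (dmx r s f x) = s"
  and dmx_index [simp]: "i < r \<Longrightarrow> j < s \<Longrightarrow> dmx r s f x $$ (i, j) = dfun (\<lambda>y. f y $$ (i, j)) x"
  by (simp_all add: dmx_def)

lemma mdeg_dmx [simp]: "mdeg 1 (dmx r s f x)" "mdeg (Suc 0) (dmx r s f x)"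
  using hdeg_dfun by (auto simp: mdeg_def)

abbreviation cmat :: "complex mat \<Rightarrow> 'n::{finite,linorder} form mat" where
  "cmat \<equiv> map_mat fconst"

text \<open>The shape is required on all of \<open>X\<close>, since products of nearby values are
  expanded entrywise before differentiating; differentiability is required at \<open>x\<close>
  only.\<close>

definition mfun :: "'n coords set \<Rightarrow> 'n coords \<Rightarrow> nat \<Rightarrow> nat \<Rightarrow> ('n::finite coords \<Rightarrow> complex mat) \<Rightarrow> bool" where
  "mfun X x r s f \<longleftrightarrow> (\<forall>y\<in>X. f y \<in> carrier_mat r s) \<and>
     (\<forall>i<r. \<forall>j<s. (\<lambda>y. f y $$ (i, j)) differentiable at x)"

lemma mfun_const: "A \<in> carrier_mat r s \<Longrightarrow> mfun X x r s (\<lambda>y. A)"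
  by (simp add: mfun_def)

lemma differentiable_transform_within_open:
  assumes "f differentiable at x" "open X" "x \<in> X" "\<And>y. y \<in> X \<Longrightarrow> f y = g y"
  shows "g differentiable at x"
  using assms has_derivative_transform_within_open unfolding differentiable_def by blast

text \<open>All computations are made at one point \<open>x\<close>; the set \<open>X\<close> is
  where the functional identities hold that get differentiated there.\<close>

locale open_nbhd =
  fixes X :: "'n::{finite,linorder} coords set" and x :: "'n coords"
  assumes X: "open X" "x \<in> X"
begin

lemma mfun_mult:
  assumes "mfun X x r n f" "mfun X x n s g"
  shows "mfun X x r s (\<lambda>y. f y * g y)"
  unfolding mfun_def
proof (intro conjI ballI allI impI)
  fix i j assume ij: "i < r" "j < s"
  have "(\<lambda>y. \<Sum>l<n. f y $$ (i, l) * g y $$ (l, j)) differentiable at x"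
    using assms ij by (intro differentiable_sum differentiable_mult) (auto simp: mfun_def)
  then show "(\<lambda>y. (f y * g y) $$ (i, j)) differentiable at x"
    by (rule differentiable_transform_within_open[OF _ X])
      (use assms ij in \<open>auto simp: mfun_def index_mult_mat_sum[of _ r n _ s]\<close>)
qed (use assms in \<open>auto simp: mfun_def\<close>)

lemma dmx_mult:
  assumes "mfun X x r n f" "mfun X x n s g"
  shows "dmx r s (\<lambda>y. f y * g y) x = cmat (f x) * dmx n s g x + dmx r n f x * cmat (g x)"
proof (rule eq_matI)
  have c: "cmat (f x) \<in> carrier_mat r n" "cmat (g x) \<in> carrier_mat n s"
    using assms X by (auto simp: mfun_def)
  fix i j assume "i < dim_row (cmat (f x) * dmx n s g x + dmx r n f x * cmat (g x))"
    "j < dim_col (cmat (f x) * dmx n s g x + dmx r n f x * cmat (g x))"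
  then have ij: "i < r" "j < s" using c by auto
  have d: "(\<lambda>y. f y $$ (i, l)) differentiable at x" "(\<lambda>y. g y $$ (l, j)) differentiable at x" if "l < n" for l
    using that ij assms by (auto simp: mfun_def)
  have "dfun (\<lambda>y. (f y * g y) $$ (i, j)) x = dfun (\<lambda>y. \<Sum>l<n. f y $$ (i, l) * g y $$ (l, j)) x"
    using mfun_mult[OF assms] ij assms
    by (intro dfun_transform[OF _ X]) (auto simp: mfun_def index_mult_mat_sum[of _ r n _ s])
  also have "\<dots> = (\<Sum>l<n. fconst (f x $$ (i, l)) * dfun (\<lambda>y. g y $$ (l, j)) x +
      fconst (g x $$ (l, j)) * dfun (\<lambda>y. f y $$ (i, l)) x)"
    using d by (subst dfun_sum) (auto intro!: differentiable_mult dfun_mult sum.cong)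
  also have "\<dots> = (cmat (f x) * dmx n s g x + dmx r n f x * cmat (g x)) $$ (i, j)"
    using ij c by (simp add: index_mult_mat_sum[OF c(1) dmx_carrier] index_mult_mat_sum[OF dmx_carrier c(2)]
        sum.distrib mult_fconst)
  finally show "dmx r s (\<lambda>y. f y * g y) x $$ (i, j) =
    (cmat (f x) * dmx n s g x + dmx r n f x * cmat (g x)) $$ (i, j)"
    using ij by simp
qed (use assms X in \<open>auto simp: mfun_def\<close>)

lemma dmx_const: "dmx r s (\<lambda>y. A) x = 0\<^sub>m r s"
  by (intro eq_matI) auto

lemma dmx_transform:
  assumes "mfun X x r s f" "\<And>y. y \<in> X \<Longrightarrow> f y = g y"
  shows "dmx r s f x = dmx r s g x"
proof (rule eq_matI)
  fix i j assume "i < dim_row (dmx r s g x)" "j < dim_col (dmx r s g x)"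
  then show "dmx r s f x $$ (i, j) = dmx r s g x $$ (i, j)"
    using assms by (auto simp: mfun_def intro!: dfun_transform[OF _ X])
qed auto

lemma dmx_lincomb:
  assumes "\<And>i. i < N \<Longrightarrow> (\<lambda>y. t y i) differentiable at x" "\<And>i. i < N \<Longrightarrow> mfun X x r s (\<lambda>y. M y i)"
  shows "dmx r s (\<lambda>y. lincomb r s N (t y) (M y)) x =
    lincomb r s N (\<lambda>i. dfun (\<lambda>y. t y i) x) (\<lambda>i. cmat (M x i)) +
    lincomb r s N (\<lambda>i. fconst (t x i)) (\<lambda>i. dmx r s (\<lambda>y. M y i) x)"
proof (rule eq_matI)
  let ?R = "lincomb r s N (\<lambda>i. dfun (\<lambda>y. t y i) x) (\<lambda>i. cmat (M x i)) +
    lincomb r s N (\<lambda>i. fconst (t x i)) (\<lambda>i. dmx r s (\<lambda>y. M y i) x)"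
  fix p q assume "p < dim_row ?R" "q < dim_col ?R"
  then have pq: "p < r" "q < s" by auto
  have M: "M x i \<in> carrier_mat r s" if "i < N" for i
    using assms(2)[OF that] X by (auto simp: mfun_def)
  have d: "(\<lambda>y. M y i $$ (p, q)) differentiable at x" if "i < N" for i
    using assms(2)[OF that] pq by (auto simp: mfun_def)
  have "dfun (\<lambda>y. \<Sum>i<N. t y i * M y i $$ (p, q)) x =
    (\<Sum>i<N. fconst (t x i) * dfun (\<lambda>y. M y i $$ (p, q)) x + fconst (M x i $$ (p, q)) * dfun (\<lambda>y. t y i) x)"
    using d assms(1) by (subst dfun_sum) (auto intro!: differentiable_mult dfun_mult sum.cong)
  also have "\<dots> = (\<Sum>i<N. dfun (\<lambda>y. t y i) x * cmat (M x i) $$ (p, q)) +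
      (\<Sum>i<N. fconst (t x i) * dmx r s (\<lambda>y. M y i) x $$ (p, q))"
    unfolding sum.distrib[symmetric] using pq M carrier_matD[OF M]
    by (intro sum.cong) (auto simp: mult_fconst add.commute)
  finally show "dmx r s (\<lambda>y. lincomb r s N (t y) (M y)) x $$ (p, q) = ?R $$ (p, q)"
    using pq by simp
qed auto

section \<open>Maurer--Cartan forms\<close>

definition regular :: "'n abundle \<Rightarrow> bool" where
  "regular b \<longleftrightarrow> mfun X x (arank b) (arank b) (aut b) \<and>
     (\<exists>B\<in>carrier_mat (arank b) (arank b). aut b x * B = 1\<^sub>m (arank b) \<and> B * aut b x = 1\<^sub>m (arank b))"

lemma minv_eq:
  assumes "A \<in> carrier_mat n n" "B \<in> carrier_mat n n" "A * B = 1\<^sub>m n" "B * A = 1\<^sub>m n"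
  shows "minv A = B"
  unfolding minv_def
proof (rule the_equality)
  fix C assume "C \<in> carrier_mat (dim_row A) (dim_row A) \<and> A * C = 1\<^sub>m (dim_row A) \<and> C * A = 1\<^sub>m (dim_row A)"
  then have C: "C \<in> carrier_mat n n" "A * C = 1\<^sub>m n" using assms by auto
  have "B * A * C = B * (A * C)" by (rule assoc_mult_mat[OF assms(2,1) C(1)])
  then show "C = B" using assms C by simp
qed (use assms in auto)

lemma minv_props:
  assumes "regular b"
  shows "minv (aut b x) \<in> carrier_mat (arank b) (arank b)"
    "aut b x * minv (aut b x) = 1\<^sub>m (arank b)" "minv (aut b x) * aut b x = 1\<^sub>m (arank b)"
    "aut b x \<in> carrier_mat (arank b) (arank b)"
proof -
  obtain B where B: "B \<in> carrier_mat (arank b) (arank b)" "aut b x * B = 1\<^sub>m (arank b)" "B * aut b x = 1\<^sub>m (arank b)"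
    using assms by (auto simp: regular_def)
  have A: "aut b x \<in> carrier_mat (arank b) (arank b)" using assms X by (auto simp: regular_def mfun_def)
  show "minv (aut b x) \<in> carrier_mat (arank b) (arank b)"
    "aut b x * minv (aut b x) = 1\<^sub>m (arank b)" "minv (aut b x) * aut b x = 1\<^sub>m (arank b)"
    "aut b x \<in> carrier_mat (arank b) (arank b)"
    using minv_eq[OF A B(1-3)] A B by simp_all
qed

lemma maurer_cartan_eq: "maurer_cartan b x = cmat (minv (aut b x)) * dmx (arank b) (arank b) (aut b) x"
  by (simp add: maurer_cartan_def dmx_def dfun_def)

lemma maurer_cartan_carrier: "regular b \<Longrightarrow> maurer_cartan b x \<in> carrier_mat (arank b) (arank b)"
  using minv_props(1)[of b] by (simp add: maurer_cartan_eq)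

lemma mdeg_maurer_cartan: "regular b \<Longrightarrow> mdeg 1 (maurer_cartan b x)"
  unfolding maurer_cartan_eq
  using mdeg_mult[of 0 "cmat (minv (aut b x))" 1 "dmx (arank b) (arank b) (aut b) x" "arank b" "arank b" "arank b"]
    minv_props(1)[of b] by simp

end

subsection \<open>Tensor products\<close>

lemma map_kron:
  assumes "A \<in> carrier_mat a b" "B \<in> carrier_mat c d"
  shows "cmat (kron A B) = (kron (cmat A) (cmat B) :: 'n::{finite,linorder} form mat)"
proof (rule eq_matI)
  fix i j assume "i < dim_row (kron (cmat A) (cmat B) :: 'n form mat)" "j < dim_col (kron (cmat A) (cmat B) :: 'n form mat)"
  then have ij: "i < a * c" "j < b * d" using assms by (auto simp: kron_def)
  then show "cmat (kron A B) $$ (i, j) = (kron (cmat A) (cmat B) :: 'n form mat) $$ (i, j)"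
    using assms div_mod_less[OF ij(1)] div_mod_less[OF ij(2)] by (simp add: kron_def fconst.hom_mult)
qed (use assms in \<open>auto simp: kron_def\<close>)

lemma smult_smult_mat: "a \<cdot>\<^sub>m (b \<cdot>\<^sub>m M) = (a * b) \<cdot>\<^sub>m (M :: 'a::semiring_0 mat)"
  by (intro eq_matI) (auto simp: mult.assoc)

lemma smult_mult_mat: "M \<in> carrier_mat n m \<Longrightarrow> M' \<in> carrier_mat m k \<Longrightarrow>
    (a \<cdot>\<^sub>m M) * M' = a \<cdot>\<^sub>m (M * (M' :: 'a::semiring_0 mat))"
  by (intro eq_matI) (auto simp: index_mult_mat_sum[of _ n m _ k] sum_distrib_left mult.assoc)

text \<open>The cross terms in the expansion of an odd power of \<open>A \<otimes> 1 + 1 \<otimes> B\<close>: one of \<open>i\<close>, \<open>j\<close> is even and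
  positive, so the trace vanishes because even powers of a matrix of one-forms have trace zero.\<close>

inductive_set mixed_terms :: "'n::{finite,linorder} form mat \<Rightarrow> 'n form mat \<Rightarrow> nat \<Rightarrow> 'n form mat set"
  for A B m where
  mixed: "\<lbrakk>i > 0; j > 0; i + j = m\<rbrakk> \<Longrightarrow> s \<cdot>\<^sub>m kron (A ^\<^sub>m i) (B ^\<^sub>m j) \<in> mixed_terms A B m"
| mixed_zero: "0\<^sub>m (dim_row A * dim_row B) (dim_row A * dim_row B) \<in> mixed_terms A B m"
| mixed_add: "M \<in> mixed_terms A B m \<Longrightarrow> M' \<in> mixed_terms A B m \<Longrightarrow> M + M' \<in> mixed_terms A B m"

context
  fixes A B :: "'n::{finite,linorder} form mat" and p q
  assumes A: "A \<in> carrier_mat p p" "mdeg 1 A" and B: "B \<in> carrier_mat q q" "mdeg 1 B"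
begin

lemma mixed_terms_carrier: "M \<in> mixed_terms A B m \<Longrightarrow> M \<in> carrier_mat (p * q) (p * q)"
  by (induction rule: mixed_terms.induct) (use A B in auto)

lemma mtrace_mixed_terms:
  assumes "M \<in> mixed_terms A B m" "odd m"
  shows "mtrace M = 0"
  using assms
proof (induction rule: mixed_terms.induct)
  case (mixed i j s)
  have "even i \<or> even j" using mixed by presburger
  then have "mtrace (kron (A ^\<^sub>m i) (B ^\<^sub>m j)) = 0"
    using A B mixed by (auto simp: mtrace_kron[of _ p _ q] mtrace_even_power)
  then show ?case using A B by (simp add: mtrace_smult[of _ "p * q"])
next
  case mixed_zero
  then show ?case by (simp add: mtrace_def)
next
  case (mixed_add M M')
  then show ?case using mtrace_add[OF mixed_terms_carrier mixed_terms_carrier] by simp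
qed

lemma kron_pow_mult:
  shows "kron (A ^\<^sub>m i) (B ^\<^sub>m j) * kron A (1\<^sub>m q) = (-1) ^ j \<cdot>\<^sub>m kron (A ^\<^sub>m Suc i) (B ^\<^sub>m j)"
    and "kron (A ^\<^sub>m i) (B ^\<^sub>m j) * kron (1\<^sub>m p) B = kron (A ^\<^sub>m i) (B ^\<^sub>m Suc j)"
proof -
  have c: "A ^\<^sub>m i \<in> carrier_mat p p" "B ^\<^sub>m j \<in> carrier_mat q q" using A B by auto
  have "kron (A ^\<^sub>m i) (B ^\<^sub>m j) * kron A (1\<^sub>m q) = (-1) ^ j \<cdot>\<^sub>m kron (A ^\<^sub>m i * A) (B ^\<^sub>m j * 1\<^sub>m q)"
  proof (rule kron_mult_sign[OF c A(1) one_carrier_mat])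
    show "(B ^\<^sub>m j) $$ (r, s) * A $$ (k, l) = (-1) ^ j * (A $$ (k, l) * (B ^\<^sub>m j) $$ (r, s))"
      if "r < q" "s < q" "k < p" "l < p" for r s k l
      using supercommute[OF mdegD[OF A(2,1) that(3,4)] mdegD[OF mdeg_pow[OF B(2,1)] c(2) that(1,2)]] by simp
    show "(-1) ^ j * a = a * (-1) ^ j" for a :: "'n form"
      by (cases "even j") auto
  qed
  then show "kron (A ^\<^sub>m i) (B ^\<^sub>m j) * kron A (1\<^sub>m q) = (-1) ^ j \<cdot>\<^sub>m kron (A ^\<^sub>m Suc i) (B ^\<^sub>m j)"
    using c right_mult_one_mat[OF c(2)] by simp
  have "kron (A ^\<^sub>m i) (B ^\<^sub>m j) * kron (1\<^sub>m p) B = kron (A ^\<^sub>m i * 1\<^sub>m p) (B ^\<^sub>m j * B)"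
    by (rule kron_mult[OF c one_carrier_mat B(1)]) auto
  then show "kron (A ^\<^sub>m i) (B ^\<^sub>m j) * kron (1\<^sub>m p) B = kron (A ^\<^sub>m i) (B ^\<^sub>m Suc j)"
    using c right_mult_one_mat[OF c(1)] by simp
qed

private abbreviation (input) "PQ \<equiv> kron A (1\<^sub>m q) + kron (1\<^sub>m p) B"

lemma PQ_carrier: "kron A (1\<^sub>m q) \<in> carrier_mat (p * q) (p * q)"
  "kron (1\<^sub>m p) B \<in> carrier_mat (p * q) (p * q)" "PQ \<in> carrier_mat (p * q) (p * q)"
  using A B by (auto intro!: add_carrier_mat)

lemma mixed_terms_step:
  assumes "M \<in> mixed_terms A B m"
  shows "M * PQ \<in> mixed_terms A B (Suc m)"
  using assms
proof (induction rule: mixed_terms.induct)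
  case (mixed i j s)
  have c: "kron (A ^\<^sub>m i) (B ^\<^sub>m j) \<in> carrier_mat (p * q) (p * q)" using A B by simp
  have "(s \<cdot>\<^sub>m kron (A ^\<^sub>m i) (B ^\<^sub>m j)) * PQ =
      (s * (-1) ^ j) \<cdot>\<^sub>m kron (A ^\<^sub>m Suc i) (B ^\<^sub>m j) + s \<cdot>\<^sub>m kron (A ^\<^sub>m i) (B ^\<^sub>m Suc j)"
    using c PQ_carrier
    by (simp add: mult_add_distrib_mat[OF smult_carrier_mat[OF c] PQ_carrier(1,2)] smult_mult_mat[OF c]
        kron_pow_mult smult_smult_mat del: pow_mat.simps)
  also have "\<dots> \<in> mixed_terms A B (Suc m)"
    using mixed by (intro mixed_terms.intros) auto
  finally show ?case .
next
  case mixed_zero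
  then show ?case using A B left_mult_zero_mat[OF PQ_carrier(3)] mixed_terms.mixed_zero[of A B "Suc m"] by simp
next
  case (mixed_add M M')
  then show ?case
    using add_mult_distrib_mat[OF mixed_terms_carrier mixed_terms_carrier PQ_carrier(3)]
    by (simp add: mixed_terms.mixed_add)
qed

text \<open>The coefficients of the mixed terms are not computed: membership in
  \<open>mixed_terms\<close> is enough to know that their traces vanish for odd exponents.\<close>

lemma PQ_pow:
  "m > 0 \<Longrightarrow> \<exists>M\<in>mixed_terms A B m. PQ ^\<^sub>m m = kron (A ^\<^sub>m m) (1\<^sub>m q) + kron (1\<^sub>m p) (B ^\<^sub>m m) + M"
proof (induction m)
  case (Suc m)
  show ?case
  proof (cases "m = 0")
    case True
    have "PQ ^\<^sub>m 1 = kron A (1\<^sub>m q) + kron (1\<^sub>m p) B + 0\<^sub>m (p * q) (p * q)"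
      using PQ_carrier by simp
    then show ?thesis
      using True A B mixed_terms.mixed_zero[of A B 1] by (intro bexI[of _ "0\<^sub>m (p * q) (p * q)"]) auto
  next
    case False
    then obtain M where M: "M \<in> mixed_terms A B m"
      "PQ ^\<^sub>m m = kron (A ^\<^sub>m m) (1\<^sub>m q) + kron (1\<^sub>m p) (B ^\<^sub>m m) + M"
      using Suc.IH by auto
    let ?P = "kron (A ^\<^sub>m m) (1\<^sub>m q)" and ?Q = "kron (1\<^sub>m p) (B ^\<^sub>m m)"
    have c: "?P \<in> carrier_mat (p * q) (p * q)" "?Q \<in> carrier_mat (p * q) (p * q)" using A B by auto
    note P = kron_pow_mult[of m 0] and Q = kron_pow_mult[of 0 m]
    have 1: "?P * PQ = kron (A ^\<^sub>m Suc m) (1\<^sub>m q) + kron (A ^\<^sub>m m) B"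
      using P A B by (simp add: mult_add_distrib_mat[OF c(1) PQ_carrier(1,2)] smult_one_mat)
    have 2: "?Q * PQ = (-1) ^ m \<cdot>\<^sub>m kron A (B ^\<^sub>m m) + kron (1\<^sub>m p) (B ^\<^sub>m Suc m)"
      using Q A B by (simp add: mult_add_distrib_mat[OF c(2) PQ_carrier(1,2)])
    define M' where "M' = kron (A ^\<^sub>m m) B + (-1) ^ m \<cdot>\<^sub>m kron A (B ^\<^sub>m m) + M * PQ"
    have "1 \<cdot>\<^sub>m kron (A ^\<^sub>m m) (B ^\<^sub>m 1) + (-1) ^ m \<cdot>\<^sub>m kron (A ^\<^sub>m 1) (B ^\<^sub>m m) + M * PQ \<in> mixed_terms A B (Suc m)"
      using False by (intro mixed_terms.intros mixed_terms_step M) auto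
    then have M': "M' \<in> mixed_terms A B (Suc m)"
      using A B by (simp add: M'_def smult_one_mat)
    have M1: "M * PQ \<in> carrier_mat (p * q) (p * q)"
      using mixed_terms_carrier[OF M(1)] PQ_carrier(3) by simp
    have "PQ ^\<^sub>m Suc m = ?P * PQ + ?Q * PQ + M * PQ"
      using c mixed_terms_carrier[OF M(1)] PQ_carrier(3) M(2)
      by (simp add: add_mult_distrib_mat[of _ "p * q" "p * q"]
          assoc_add_mat[OF mult_carrier_mat[OF c(1) PQ_carrier(3)] mult_carrier_mat[OF c(2) PQ_carrier(3)] M1])
    also have "\<dots> = kron (A ^\<^sub>m Suc m) (1\<^sub>m q) + kron (1\<^sub>m p) (B ^\<^sub>m Suc m) + M'"
      unfolding 1 2 M'_def using A B M1 by (intro eq_matI) (auto simp: kron_def)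
    finally show ?thesis using M' by blast
  qed
qed simp

lemma mtrace_kron_sum_pow:
  assumes "odd m"
  shows "mtrace (PQ ^\<^sub>m m) = of_nat q * mtrace (A ^\<^sub>m m) + of_nat p * mtrace (B ^\<^sub>m m)"
proof -
  have "m > 0" using assms by (cases m) auto
  from PQ_pow[OF this] obtain M where M: "M \<in> mixed_terms A B m"
    "PQ ^\<^sub>m m = kron (A ^\<^sub>m m) (1\<^sub>m q) + kron (1\<^sub>m p) (B ^\<^sub>m m) + M" by auto
  have one: "mtrace (1\<^sub>m k :: 'n form mat) = of_nat k" for k by (simp add: mtrace_def)
  have c: "kron (A ^\<^sub>m m) (1\<^sub>m q) \<in> carrier_mat (p * q) (p * q)" "kron (1\<^sub>m p) (B ^\<^sub>m m) \<in> carrier_mat (p * q) (p * q)"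
    using A B by auto
  have "mtrace (PQ ^\<^sub>m m) = mtrace (kron (A ^\<^sub>m m) (1\<^sub>m q)) + mtrace (kron (1\<^sub>m p) (B ^\<^sub>m m)) + mtrace M"
    unfolding M(2) using c mixed_terms_carrier[OF M(1)]
    by (simp add: mtrace_add[of _ "p * q"] mtrace_add[OF add_carrier_mat])
  also have "\<dots> = of_nat q * mtrace (A ^\<^sub>m m) + of_nat p * mtrace (B ^\<^sub>m m)"
    using A B mtrace_mixed_terms[OF M(1) assms]
    by (simp add: mtrace_kron[of _ p _ q] one flip: fconst_of_nat) (simp add: mult_fconst)
  finally show ?thesis .
qed

end

context open_nbhd
begin

text \<open>The Leibniz rule for \<open>kron\<close>. The automorphisms and their inverses consist
  of constants, so the mixed product rule applies without signs.\<close>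

lemma regular_tensor:
  assumes "regular a" "regular b"
  shows "regular (tensor a b)"
    and "maurer_cartan (tensor a b) x =
      kron (maurer_cartan a x) (1\<^sub>m (arank b)) + kron (1\<^sub>m (arank a)) (maurer_cartan b x)"
proof -
  let ?p = "arank a" and ?q = "arank b"
  note a = minv_props[OF assms(1)] and b = minv_props[OF assms(2)]
  have kron1: "kron (aut a x) (aut b x) * kron (minv (aut a x)) (minv (aut b x)) = 1\<^sub>m (?p * ?q)"
    using a b by (subst kron_mult[of _ ?p ?p _ ?q ?q _ ?p _ ?q]) (auto simp: kron_one)
  have kron2: "kron (minv (aut a x)) (minv (aut b x)) * kron (aut a x) (aut b x) = 1\<^sub>m (?p * ?q)"
    using a b by (subst kron_mult[of _ ?p ?p _ ?q ?q _ ?p _ ?q]) (auto simp: kron_one)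
  have ma: "mfun X x ?p ?p (aut a)" and mb: "mfun X x ?q ?q (aut b)" using assms by (auto simp: regular_def)
  have m: "mfun X x (?p * ?q) (?p * ?q) (\<lambda>y. kron (aut a y) (aut b y))"
    unfolding mfun_def
  proof (intro conjI ballI allI impI)
    fix i j assume ij: "i < ?p * ?q" "j < ?p * ?q"
    have "(\<lambda>y. aut a y $$ (i div ?q, j div ?q) * aut b y $$ (i mod ?q, j mod ?q)) differentiable at x"
      using ma mb div_mod_less[OF ij(1)] div_mod_less[OF ij(2)]
      by (intro differentiable_mult) (auto simp: mfun_def)
    then show "(\<lambda>y. kron (aut a y) (aut b y) $$ (i, j)) differentiable at x"
      by (rule differentiable_transform_within_open[OF _ X])
        (use ma mb ij in \<open>auto simp: mfun_def kron_index[of _ ?p ?p _ ?q ?q]\<close>)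
  qed (use ma mb in \<open>auto simp: mfun_def\<close>)
  show "regular (tensor a b)"
    unfolding regular_def using m kron1 kron2 a b
    by (auto simp: tensor_abundle_def intro!: bexI[of _ "kron (minv (aut a x)) (minv (aut b x))"])
  have inv: "minv (kron (aut a x) (aut b x)) = kron (minv (aut a x)) (minv (aut b x))"
    using kron1 kron2 a b by (intro minv_eq[of _ "?p * ?q"]) auto
  have ka: "(cmat (minv (aut a x)) :: 'n form mat) \<in> carrier_mat ?p ?p" "(cmat (aut a x) :: 'n form mat) \<in> carrier_mat ?p ?p" using a by auto
  have kb: "(cmat (minv (aut b x)) :: 'n form mat) \<in> carrier_mat ?q ?q" "(cmat (aut b x) :: 'n form mat) \<in> carrier_mat ?q ?q" using b by auto
  have d: "dmx (?p * ?q) (?p * ?q) (\<lambda>y. kron (aut a y) (aut b y)) x =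
    kron (cmat (aut a x)) (dmx ?q ?q (aut b) x) + kron (dmx ?p ?p (aut a) x) (cmat (aut b x))" (is "_ = ?R")
  proof (rule eq_matI)
    fix i j assume "i < dim_row ?R" "j < dim_col ?R"
    then have ij: "i < ?p * ?q" "j < ?p * ?q" using a b by (auto simp: kron_def)
    note dm = div_mod_less[OF ij(1)] div_mod_less[OF ij(2)]
    have "dfun (\<lambda>y. kron (aut a y) (aut b y) $$ (i, j)) x =
      dfun (\<lambda>y. aut a y $$ (i div ?q, j div ?q) * aut b y $$ (i mod ?q, j mod ?q)) x"
      using m ma mb ij by (intro dfun_transform[OF _ X]) (auto simp: mfun_def kron_index[of _ ?p ?p _ ?q ?q])
    also have "\<dots> = ?R $$ (i, j)"
      using ij dm ma mb a b carrier_matD[OF kron_carrier[OF dmx_carrier[of ?p ?p "aut a" x] kb(2)]]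
      by (subst dfun_mult) (auto simp: mfun_def kron_index[of _ ?p ?p _ ?q ?q] mult_fconst)
    finally show "dmx (?p * ?q) (?p * ?q) (\<lambda>y. kron (aut a y) (aut b y)) x $$ (i, j) = ?R $$ (i, j)"
      using ij by simp
  qed (use a b in \<open>auto simp: kron_def\<close>)
  have hom: "cmat (minv (aut a x)) * cmat (aut a x) = (1\<^sub>m ?p :: 'n form mat)"
    "cmat (minv (aut b x)) * cmat (aut b x) = (1\<^sub>m ?q :: 'n form mat)"
    using a b by (simp_all add: fconst.mat_hom_mult[OF a(1) a(4), symmetric]
        fconst.mat_hom_mult[OF b(1) b(4), symmetric] fconst.mat_hom_one)
  have "maurer_cartan (tensor a b) x = kron (cmat (minv (aut a x))) (cmat (minv (aut b x))) *
    (kron (cmat (aut a x)) (dmx ?q ?q (aut b) x) + kron (dmx ?p ?p (aut a) x) (cmat (aut b x)))"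
    using a b by (simp add: maurer_cartan_eq tensor_abundle_def inv d map_kron[of _ ?p ?p _ ?q ?q])
  also have "\<dots> = kron (1\<^sub>m ?p) (maurer_cartan b x) + kron (maurer_cartan a x) (1\<^sub>m ?q)"
  proof -
    have "kron (cmat (minv (aut a x))) (cmat (minv (aut b x))) * kron (cmat (aut a x)) (dmx ?q ?q (aut b) x) =
        kron (1\<^sub>m ?p) (maurer_cartan b x)"
      using kb by (subst kron_mult[OF ka(1) kb(1) ka(2) dmx_carrier]) (simp_all add: hom maurer_cartan_eq mult_fconst)
    moreover have "kron (cmat (minv (aut a x))) (cmat (minv (aut b x))) * kron (dmx ?p ?p (aut a) x) (cmat (aut b x)) =
        kron (maurer_cartan a x) (1\<^sub>m ?q)"
      using kb b by (subst kron_mult[OF ka(1) kb(1) dmx_carrier kb(2)]) (simp_all add: hom maurer_cartan_eq mult_fconst)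
    ultimately show ?thesis
      using mult_add_distrib_mat[OF kron_carrier[OF ka(1) kb(1)] kron_carrier[OF ka(2) dmx_carrier]
        kron_carrier[OF dmx_carrier kb(2)]] by simp
  qed
  also have "\<dots> = kron (maurer_cartan a x) (1\<^sub>m ?q) + kron (1\<^sub>m ?p) (maurer_cartan b x)"
    using maurer_cartan_carrier[OF assms(1)] maurer_cartan_carrier[OF assms(2)]
    by (intro comm_add_mat[of _ "?p * ?q" "?p * ?q"]) auto
  finally show "maurer_cartan (tensor a b) x = kron (maurer_cartan a x) (1\<^sub>m ?q) + kron (1\<^sub>m ?p) (maurer_cartan b x)" .
qed

lemma odd_chern_char_tensor:
  assumes "regular a" "regular b"
  shows "odd_chern_char (tensor a b) x =
    of_nat (arank b) * odd_chern_char a x + of_nat (arank a) * odd_chern_char b x"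
proof -
  have "mtrace (maurer_cartan (tensor a b) x ^\<^sub>m (2 * n + 1)) =
    fconst (of_nat (arank b)) * mtrace (maurer_cartan a x ^\<^sub>m (2 * n + 1)) +
    fconst (of_nat (arank a)) * mtrace (maurer_cartan b x ^\<^sub>m (2 * n + 1))" for n
    unfolding regular_tensor(2)[OF assms]
    using mtrace_kron_sum_pow[OF maurer_cartan_carrier[OF assms(1)] mdeg_maurer_cartan[OF assms(1)]
        maurer_cartan_carrier[OF assms(2)] mdeg_maurer_cartan[OF assms(2)], of "2 * n + 1"]
    by (simp add: fconst_of_nat)
  then show ?thesis
    unfolding odd_chern_char_def fconst_of_nat[symmetric] sum_distrib_left sum.distrib[symmetric]
    by (intro sum.cong refl form_eqI) (simp only: coeff_fconst_mult coeff_add algebra_simps)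
qed

lemma regular_trivial: "regular (trivial n)"
  by (auto simp: regular_def trivial_abundle_def mfun_const)

lemma maurer_cartan_trivial: "maurer_cartan (trivial n) x = 0\<^sub>m n n"
  using minv_props(1)[OF regular_trivial, of n]
  by (simp add: maurer_cartan_eq trivial_abundle_def dmx_const)

end

section \<open>Intertwiners\<close>

lemma cmat_lincomb:
  assumes "\<And>i. i < N \<Longrightarrow> M i \<in> carrier_mat r s"
  shows "cmat (lincomb r s N t M) = (lincomb r s N (\<lambda>i. fconst (t i)) (\<lambda>i. cmat (M i)) :: 'n::{finite,linorder} form mat)"
proof (rule eq_matI)
  fix p q assume "p < dim_row (lincomb r s N (\<lambda>i. fconst (t i)) (\<lambda>i. cmat (M i)) :: 'n form mat)"
    "q < dim_col (lincomb r s N (\<lambda>i. fconst (t i)) (\<lambda>i. cmat (M i)) :: 'n form mat)"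
  then have pq: "p < r" "q < s" by auto
  have "(cmat (M i) :: 'n form mat) $$ (p, q) = fconst (M i $$ (p, q))" if "i < N" for i
    using assms[OF that] pq by auto
  then show "cmat (lincomb r s N t M) $$ (p, q) = (lincomb r s N (\<lambda>i. fconst (t i)) (\<lambda>i. cmat (M i)) :: 'n form mat) $$ (p, q)"
    using pq by (simp add: fconst.hom_sum fconst.hom_mult)
qed auto

text \<open>The relation says that the \<open>c j\<close> are the components of an equivariant map from the tensor product
  of the bundles \<open>G\<close> and \<open>F'\<close> to \<open>F\<close>; the conclusion is its derivative. It is used for Clifford
  multiplication and for exterior multiplication.\<close>

lemma (in open_nbhd) maurer_cartan_intertwine:
  fixes c :: "nat \<Rightarrow> complex mat"
  defines "mc \<equiv> \<lambda>b. maurer_cartan b x"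
  assumes reg: "regular F" "regular F'" "regular G"
    and c: "\<And>j. j < arank G \<Longrightarrow> c j \<in> carrier_mat (arank F) (arank F')"
    and rel: "\<And>y j. y \<in> X \<Longrightarrow> j < arank G \<Longrightarrow>
      aut F y * c j = lincomb (arank F) (arank F') (arank G) (\<lambda>i. aut G y $$ (i, j)) (\<lambda>i. c i * aut F' y)"
    and j: "j < arank G"
  shows "mc F * cmat (c j) = cmat (c j) * mc F' +
    lincomb (arank F) (arank F') (arank G) (\<lambda>i. mc G $$ (i, j)) (\<lambda>i. cmat (c i))"
proof -
  let ?f = "arank F" and ?f' = "arank F'" and ?N = "arank G"
  note F = minv_props[OF reg(1)] and F' = minv_props[OF reg(2)] and G = minv_props[OF reg(3)]
  let ?FI = "minv (aut F x)" and ?FI' = "minv (aut F' x)" and ?GI = "minv (aut G x)"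
  have GI: "(\<Sum>k<?N. aut G x $$ (i, k) * ?GI $$ (k, l)) = (if i = l then 1 else 0)"
    and IG: "(\<Sum>k<?N. ?GI $$ (i, k) * aut G x $$ (k, l)) = (if i = l then 1 else 0)"
    if "i < ?N" "l < ?N" for i l
    using arg_cong[OF G(2), of "\<lambda>A. A $$ (i, l)"] arg_cong[OF G(3), of "\<lambda>A. A $$ (i, l)"] that
    by (simp_all add: index_mult_mat_sum[OF G(4,1)] index_mult_mat_sum[OF G(1,4)])
  have cF': "c l * aut F' x \<in> carrier_mat ?f ?f'" if "l < ?N" for l
    using c[OF that] F' by simp
  \<comment> \<open>The relation at \<open>x\<close>, solved for the inverse of
    \<open>aut F x\<close>: the family \<open>c\<close> then transforms by the inverse of
    \<open>aut G x\<close>.\<close>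
  have inv: "?FI * (c l * aut F' x) = lincomb ?f ?f' ?N (\<lambda>k. ?GI $$ (k, l)) c" if l: "l < ?N" for l
  proof -
    let ?L = "lincomb ?f ?f' ?N (\<lambda>k. ?GI $$ (k, l)) c"
    have "aut F x * ?L = lincomb ?f ?f' ?N (\<lambda>k. ?GI $$ (k, l)) (\<lambda>k. aut F x * c k)"
      using c F by (intro lincomb_mult_left[of _ _ ?f]) auto
    also have "\<dots> = lincomb ?f ?f' ?N (\<lambda>k. ?GI $$ (k, l))
        (\<lambda>k. lincomb ?f ?f' ?N (\<lambda>i. aut G x $$ (i, k)) (\<lambda>i. c i * aut F' x))"
      using rel X by (intro lincomb_cong) auto
    also have "\<dots> = lincomb ?f ?f' ?N (\<lambda>i. if i = l then 1 else 0) (\<lambda>i. c i * aut F' x)"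
      unfolding lincomb_lincomb using GI l by (intro lincomb_cong) (auto simp: mult.commute)
    also have "\<dots> = c l * aut F' x"
      using lincomb_delta[of "\<lambda>i. c i * aut F' x" l ?f ?f' ?N] cF' l by simp
    finally have "?FI * (c l * aut F' x) = ?FI * (aut F x * ?L)" by simp
    also have "\<dots> = (?FI * aut F x) * ?L" by (rule assoc_mult_mat[symmetric, OF F(1,4) lincomb_carrier])
    also have "\<dots> = ?L" using F by simp
    finally show ?thesis .
  qed
  have mF: "mfun X x ?f ?f (aut F)" and mF': "mfun X x ?f' ?f' (aut F')" and mG: "mfun X x ?N ?N (aut G)"
    using reg by (auto simp: regular_def)
  let ?dF = "dmx ?f ?f (aut F) x" and ?dF' = "dmx ?f' ?f' (aut F') x" and ?dG = "\<lambda>i. dfun (\<lambda>y. aut G y $$ (i, j)) x"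
  have mc': "mfun X x ?f ?f' (\<lambda>y. c i * aut F' y)" if "i < ?N" for i
    by (rule mfun_mult[OF mfun_const[OF c[OF that]] mF'])
  have cc: "cmat (c i) \<in> carrier_mat ?f ?f'" if "i < ?N" for i using c[OF that] by simp
  have aG: "(\<lambda>y. aut G y $$ (i, j)) differentiable at x" if "i < ?N" for i
    using mG that j by (auto simp: mfun_def)
  have th: "mc F' \<in> carrier_mat ?f' ?f'" "mc F = cmat ?FI * ?dF" "mc F' = cmat ?FI' * ?dF'"
    using maurer_cartan_carrier[OF reg(2)] by (auto simp: mc_def maurer_cartan_eq)
  have cFI: "cmat ?FI \<in> carrier_mat ?f ?f" "cmat ?FI' \<in> carrier_mat ?f' ?f'"
      "cmat (aut F' x) \<in> carrier_mat ?f' ?f'" using F F' by auto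
  have dF': "cmat (aut F' x) * mc F' = ?dF'"
  proof -
    have "cmat (aut F' x) * mc F' = (cmat (aut F' x) * cmat ?FI') * ?dF'"
      unfolding th(3) by (rule assoc_mult_mat[symmetric, OF cFI(3,2) dmx_carrier])
    also have "\<dots> = ?dF'"
      using F' by (simp add: fconst.mat_hom_mult[OF F'(4,1), symmetric] fconst.mat_hom_one)
    finally show ?thesis .
  qed
  have cdF': "cmat (c i) * ?dF' = cmat (c i * aut F' x) * mc F'" if "i < ?N" for i
    using assoc_mult_mat[OF cc[OF that] cFI(3) th(1)] dF'
    by (simp add: fconst.mat_hom_mult[OF c[OF that] F'(4)])
  \<comment> \<open>Both sides of \<open>rel\<close> are differentiated at \<open>x\<close>; on the
    left \<open>c j\<close> is constant, on the right both the coefficients and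
    \<open>aut F'\<close> vary.\<close>
  have "?dF * cmat (c j) = dmx ?f ?f' (\<lambda>y. aut F y * c j) x"
    using dmx_mult[OF mF mfun_const[OF c[OF j]]] F j left_add_zero_mat[OF mult_carrier_mat[OF dmx_carrier[of ?f ?f "aut F" x] cc[OF j]]]
    by (simp add: dmx_const)
  also have "\<dots> = dmx ?f ?f' (\<lambda>y. lincomb ?f ?f' ?N (\<lambda>i. aut G y $$ (i, j)) (\<lambda>i. c i * aut F' y)) x"
    by (rule dmx_transform[OF mfun_mult[OF mF mfun_const[OF c[OF j]]] rel[OF _ j]])
  also have "\<dots> = lincomb ?f ?f' ?N ?dG (\<lambda>i. cmat (c i * aut F' x)) +
      lincomb ?f ?f' ?N (\<lambda>i. fconst (aut G x $$ (i, j))) (\<lambda>i. dmx ?f ?f' (\<lambda>y. c i * aut F' y) x)"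
    by (rule dmx_lincomb[OF aG mc'])
  also have "lincomb ?f ?f' ?N (\<lambda>i. fconst (aut G x $$ (i, j))) (\<lambda>i. dmx ?f ?f' (\<lambda>y. c i * aut F' y) x) =
      lincomb ?f ?f' ?N (\<lambda>i. fconst (aut G x $$ (i, j))) (\<lambda>i. cmat (c i * aut F' x) * mc F')"
  proof (rule lincomb_cong[OF refl])
    fix i assume i: "i < ?N"
    show "dmx ?f ?f' (\<lambda>y. c i * aut F' y) x = cmat (c i * aut F' x) * mc F'"
      using dmx_mult[OF mfun_const[OF c[OF i]] mF'] cdF'[OF i] cFI(3) mult_carrier_mat[OF cc[OF i] dmx_carrier[of ?f' ?f' "aut F'" x]]
      by (simp add: dmx_const)
  qed
  finally have 1: "?dF * cmat (c j) = lincomb ?f ?f' ?N ?dG (\<lambda>i. cmat (c i * aut F' x)) +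
      lincomb ?f ?f' ?N (\<lambda>i. fconst (aut G x $$ (i, j))) (\<lambda>i. cmat (c i * aut F' x) * mc F')" .
  have FIc: "cmat ?FI * cmat (c i * aut F' x) = lincomb ?f ?f' ?N (\<lambda>k. fconst (?GI $$ (k, i))) (\<lambda>k. cmat (c k))"
    if "i < ?N" for i
    by (simp add: fconst.mat_hom_mult[OF F(1) cF'[OF that], symmetric] inv[OF that] cmat_lincomb[of ?N c ?f ?f'] c)
  have ccF: "cmat (c i * aut F' x) \<in> carrier_mat ?f ?f'" if "i < ?N" for i using cF'[OF that] by simp
  \<comment> \<open>Multiplication by the inverse of \<open>aut F x\<close> turns the differentials
    into Maurer-Cartan forms, the factors \<open>aut G x\<close> and \<open>aut F' x\<close> being
    absorbed by \<open>inv\<close>.\<close>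
  have "mc F * cmat (c j) = cmat ?FI * (?dF * cmat (c j))"
    unfolding th(2) by (rule assoc_mult_mat[OF cFI(1) dmx_carrier cc[OF j]])
  also have "\<dots> = cmat ?FI * lincomb ?f ?f' ?N ?dG (\<lambda>i. cmat (c i * aut F' x)) +
      cmat ?FI * lincomb ?f ?f' ?N (\<lambda>i. fconst (aut G x $$ (i, j))) (\<lambda>i. cmat (c i * aut F' x) * mc F')"
    unfolding 1 by (rule mult_add_distrib_mat[OF cFI(1) lincomb_carrier lincomb_carrier])
  also have "cmat ?FI * lincomb ?f ?f' ?N ?dG (\<lambda>i. cmat (c i * aut F' x)) =
      lincomb ?f ?f' ?N ?dG (\<lambda>i. cmat ?FI * cmat (c i * aut F' x))"
    using cFI ccF F by (intro lincomb_mult_left[of _ _ ?f]) (auto simp: mult_fconst)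
  also have "\<dots> = lincomb ?f ?f' ?N (\<lambda>i. mc G $$ (i, j)) (\<lambda>i. cmat (c i))"
  proof -
    have "lincomb ?f ?f' ?N ?dG (\<lambda>i. cmat ?FI * cmat (c i * aut F' x)) =
      lincomb ?f ?f' ?N ?dG (\<lambda>i. lincomb ?f ?f' ?N (\<lambda>k. fconst (?GI $$ (k, i))) (\<lambda>k. cmat (c k)))"
      by (rule lincomb_cong[OF refl FIc])
    also have "\<dots> = lincomb ?f ?f' ?N (\<lambda>i. mc G $$ (i, j)) (\<lambda>i. cmat (c i))"
      unfolding lincomb_lincomb
    proof (rule lincomb_cong[OF _ refl])
      fix k assume k: "k < ?N"
      have "cmat ?GI \<in> carrier_mat ?N ?N" using G by simp
      from index_mult_mat_sum[OF this dmx_carrier k j, of "aut G" x]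
      show "(\<Sum>i<?N. ?dG i * fconst (?GI $$ (k, i))) = mc G $$ (k, j)"
        using G k j by (simp add: mc_def maurer_cartan_eq mult_fconst)
    qed
    finally show ?thesis .
  qed
  also have "cmat ?FI * lincomb ?f ?f' ?N (\<lambda>i. fconst (aut G x $$ (i, j))) (\<lambda>i. cmat (c i * aut F' x) * mc F') =
      cmat (c j) * mc F'"
  proof -
    have "cmat ?FI * lincomb ?f ?f' ?N (\<lambda>i. fconst (aut G x $$ (i, j))) (\<lambda>i. cmat (c i * aut F' x) * mc F') =
      cmat ?FI * (lincomb ?f ?f' ?N (\<lambda>i. fconst (aut G x $$ (i, j))) (\<lambda>i. cmat (c i * aut F' x)) * mc F')"
      using lincomb_mult_right[OF ccF th(1)] by simp
    also have "\<dots> = (cmat ?FI * lincomb ?f ?f' ?N (\<lambda>i. fconst (aut G x $$ (i, j))) (\<lambda>i. cmat (c i * aut F' x))) * mc F'"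
      by (rule assoc_mult_mat[symmetric, OF cFI(1) lincomb_carrier th(1)])
    also have "(cmat ?FI :: 'n form mat) * lincomb ?f ?f' ?N (\<lambda>i. fconst (aut G x $$ (i, j))) (\<lambda>i. cmat (c i * aut F' x)) =
      lincomb ?f ?f' ?N (\<lambda>i. fconst (aut G x $$ (i, j))) (\<lambda>i. cmat ?FI * cmat (c i * aut F' x))"
      by (intro lincomb_mult_left[of _ _ ?f] mult_fconst) (use cFI ccF in auto)
    also have "\<dots> = lincomb ?f ?f' ?N (\<lambda>i. fconst (aut G x $$ (i, j)))
        (\<lambda>i. lincomb ?f ?f' ?N (\<lambda>k. fconst (?GI $$ (k, i))) (\<lambda>k. cmat (c k)))"
      by (rule lincomb_cong[OF refl FIc])
    also have "\<dots> = lincomb ?f ?f' ?N (\<lambda>k. if k = j then 1 else 0) (\<lambda>k. cmat (c k))"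
      unfolding lincomb_lincomb
    proof (rule lincomb_cong[OF _ refl])
      fix k assume "k < ?N"
      have "(\<Sum>i<?N. fconst (aut G x $$ (i, j)) * fconst (?GI $$ (k, i))) =
        (fconst (\<Sum>i<?N. ?GI $$ (k, i) * aut G x $$ (i, j)) :: 'n form)"
        by (simp add: fconst.hom_sum fconst.hom_mult mult.commute)
      then show "(\<Sum>i<?N. fconst (aut G x $$ (i, j)) * fconst (?GI $$ (k, i))) = (if k = j then 1 else (0 :: 'n form))"
        using IG[OF \<open>k < ?N\<close> j] by simp
    qed
    also have "\<dots> = cmat (c j)" using cc[OF j] j by (rule lincomb_delta)
    finally show ?thesis .
  qed
  finally show ?thesis
    by (subst comm_add_mat[of _ ?f ?f']) (use mult_carrier_mat[OF cc[OF j] th(1)] in auto)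
qed

text \<open>The relation is applied twice. Entries of \<open>U\<close> and \<open>T\<close>
  anticommute, so the cross terms with \<open>C i * U'\<close> cancel, and reordering two entries of
  \<open>T\<close> makes the remaining sign positive. The result has the same shape, now with even
  entries.\<close>

lemma square_intertwine:
  fixes U U' T :: "'n::{finite,linorder} form mat"
  assumes U: "U \<in> carrier_mat f f" "mdeg 1 U" and U': "U' \<in> carrier_mat f' f'"
    and T: "T \<in> carrier_mat N N" "mdeg 1 T"
    and C: "\<And>j. j < N \<Longrightarrow> C j \<in> carrier_mat f f'"
    and rel: "\<And>j. j < N \<Longrightarrow> U * C j = C j * U' + lincomb f f' N (\<lambda>i. T $$ (i, j)) C"
    and j: "j < N"
  shows "(U * U) * C j = C j * (U' * U') + lincomb f f' N (\<lambda>i. (T * T) $$ (i, j)) C"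
proof -
  define L where "L j = lincomb f f' N (\<lambda>i. T $$ (i, j)) C" for j
  have L: "L j \<in> carrier_mat f f'" for j by (simp add: L_def)
  have c: "C j * U' \<in> carrier_mat f f'" if "j < N" for j using C[OF that] U' by simp
  let ?L' = "lincomb f f' N (\<lambda>i. - T $$ (i, j)) (\<lambda>i. C i * U')"
  have UL: "U * L j = ?L' + lincomb f f' N (\<lambda>i. (T * T) $$ (i, j)) C"
  proof -
    have "U * L j = lincomb f f' N (\<lambda>i. - T $$ (i, j)) (\<lambda>i. U * C i)"
      unfolding L_def using mdegD[OF U(2,1)] mdegD[OF T(2,1)] j
      by (intro lincomb_mult_left[of _ _ f] C U) (auto intro: odd_anticommute[of 1 _ 1])
    also have "\<dots> = lincomb f f' N (\<lambda>i. - T $$ (i, j)) (\<lambda>i. C i * U' + L i)"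
      using rel by (intro lincomb_cong) (auto simp: L_def)
    also have "\<dots> = ?L' + lincomb f f' N (\<lambda>i. - T $$ (i, j)) L"
      using c L by (intro lincomb_add_right)
    also have "lincomb f f' N (\<lambda>i. - T $$ (i, j)) L = lincomb f f' N (\<lambda>i. (T * T) $$ (i, j)) C"
      unfolding L_def lincomb_lincomb
    proof (rule lincomb_cong[OF _ refl])
      fix k assume k: "k < N"
      have "- T $$ (i, j) * T $$ (k, i) = T $$ (k, i) * T $$ (i, j)" if "i < N" for i
        using odd_anticommute[OF mdegD[OF T(2,1) that j] _ mdegD[OF T(2,1) k that]] by simp
      then show "(\<Sum>i<N. - T $$ (i, j) * T $$ (k, i)) = (T * T) $$ (k, j)"
        using k j by (simp add: index_mult_mat_sum[OF T(1) T(1)])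
    qed
    finally show ?thesis .
  qed
  have canc: "L j * U' + ?L' = 0\<^sub>m f f'"
  proof -
    have "L j * U' = lincomb f f' N (\<lambda>i. T $$ (i, j)) (\<lambda>i. C i * U')"
      unfolding L_def by (rule lincomb_mult_right[OF C U'])
    then show ?thesis by (intro eq_matI) (auto simp: sum_negf)
  qed
  have "(U * U) * C j = U * (U * C j)" by (rule assoc_mult_mat[OF U(1) U(1) C[OF j]])
  also have "\<dots> = U * (C j * U') + U * L j"
    unfolding rel[OF j] L_def by (rule mult_add_distrib_mat[OF U(1) c[OF j] lincomb_carrier])
  also have "U * (C j * U') = (U * C j) * U'"
    by (rule assoc_mult_mat[symmetric, OF U(1) C[OF j] U'])
  also have "\<dots> = C j * U' * U' + L j * U'"
    unfolding rel[OF j] L_def by (rule add_mult_distrib_mat[OF c[OF j] lincomb_carrier U'])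
  also have "C j * U' * U' = C j * (U' * U')"
    by (rule assoc_mult_mat[OF C[OF j] U' U'])
  also have "C j * (U' * U') + L j * U' + U * L j =
    C j * (U' * U') + ((L j * U' + ?L') + lincomb f f' N (\<lambda>i. (T * T) $$ (i, j)) C)"
    unfolding UL using mult_carrier_mat[OF C[OF j] mult_carrier_mat[OF U' U']] mult_carrier_mat[OF L U']
    by (intro eq_matI) (auto simp: add.assoc)
  also have "\<dots> = C j * (U' * U') + lincomb f f' N (\<lambda>i. (T * T) $$ (i, j)) C"
    unfolding canc using mult_carrier_mat[OF C[OF j] mult_carrier_mat[OF U' U']] by simp
  finally show ?thesis .
qed

text \<open>Equals the sum of (a choose s) * q (b + s) over s up to a. In particular the sequence of
  powers of j is sent to j^b * (j + 1)^a.\<close>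

fun binomial_shift :: "(nat \<Rightarrow> complex) \<Rightarrow> nat \<Rightarrow> nat \<Rightarrow> complex" where
  "binomial_shift q 0 b = q b"
| "binomial_shift q (Suc a) b = binomial_shift q a (Suc b) + binomial_shift q a b"

text \<open>Trading factors on the left of \<open>C j\<close> for factors on the right connects two
  cyclic arrangements of a trace; comparing them gives equations for its value.\<close>

definition shifted_trace ::
  "'n::{finite,linorder} form mat \<Rightarrow> 'n form mat \<Rightarrow> 'n form mat \<Rightarrow> (nat \<Rightarrow> 'n form mat) \<Rightarrow> nat \<Rightarrow> nat \<Rightarrow> nat \<Rightarrow> 'n form" where
  "shifted_trace W W' A C a b j = mtrace (A * (W ^\<^sub>m a * (C j * W' ^\<^sub>m b)))"

context
  fixes W W' T A :: "'n::{finite,linorder} form mat" and C :: "nat \<Rightarrow> 'n form mat" and f f' N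
  assumes W: "W \<in> carrier_mat f f" "mdeg 2 W" and W': "W' \<in> carrier_mat f' f'"
    and T: "T \<in> carrier_mat N N" "mdeg 2 T"
    and C: "\<And>j. j < N \<Longrightarrow> C j \<in> carrier_mat f f'"
    and A: "A \<in> carrier_mat f' f" "mdeg 0 A"
    and rel: "\<And>j. j < N \<Longrightarrow> W * C j = C j * W' + lincomb f f' N (\<lambda>i. T $$ (i, j)) C"
begin

lemma shifted_trace_Suc:
  assumes j: "j < N"
  shows "shifted_trace W W' A C (Suc a) b j = shifted_trace W W' A C a (Suc b) j + (\<Sum>l<N. T $$ (l, j) * shifted_trace W W' A C a b l)"
proof -
  have c: "C l * W' ^\<^sub>m b \<in> carrier_mat f f'" if "l < N" for b l using C[OF that] W' by simp
  have Wa: "W ^\<^sub>m a \<in> carrier_mat f f" "mdeg (a * 2) (W ^\<^sub>m a)" using W mdeg_pow[OF W(2,1)] by auto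
  have c2: "W ^\<^sub>m a * (C l * W' ^\<^sub>m b) \<in> carrier_mat f f'" if "l < N" for l b
    using c[OF that] Wa by simp
  have "W ^\<^sub>m Suc a * (C j * W' ^\<^sub>m b) = W ^\<^sub>m a * (W * (C j * W' ^\<^sub>m b))"
    using assoc_mult_mat[OF Wa(1) W(1) c[OF j]] by simp
  also have "W * (C j * W' ^\<^sub>m b) = (W * C j) * W' ^\<^sub>m b"
    using W' by (intro assoc_mult_mat[symmetric, OF W(1) C[OF j]]) auto
  also have "\<dots> = C j * W' * W' ^\<^sub>m b + lincomb f f' N (\<lambda>i. T $$ (i, j)) C * W' ^\<^sub>m b"
    unfolding rel[OF j] using W' C[OF j] by (intro add_mult_distrib_mat[of _ f f']) auto
  also have "C j * W' * W' ^\<^sub>m b = C j * W' ^\<^sub>m Suc b"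
    unfolding pow_mat_Suc_left[OF W'] using W' by (intro assoc_mult_mat[OF C[OF j]]) auto
  also have "lincomb f f' N (\<lambda>i. T $$ (i, j)) C * W' ^\<^sub>m b =
      lincomb f f' N (\<lambda>i. T $$ (i, j)) (\<lambda>i. C i * W' ^\<^sub>m b)"
    using W' by (intro lincomb_mult_right C) auto
  also have "W ^\<^sub>m a * (C j * W' ^\<^sub>m Suc b + lincomb f f' N (\<lambda>i. T $$ (i, j)) (\<lambda>i. C i * W' ^\<^sub>m b)) =
      W ^\<^sub>m a * (C j * W' ^\<^sub>m Suc b) + W ^\<^sub>m a * lincomb f f' N (\<lambda>i. T $$ (i, j)) (\<lambda>i. C i * W' ^\<^sub>m b)"
    by (rule mult_add_distrib_mat[OF Wa(1) c[OF j] lincomb_carrier])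
  also have "W ^\<^sub>m a * lincomb f f' N (\<lambda>i. T $$ (i, j)) (\<lambda>i. C i * W' ^\<^sub>m b) =
      lincomb f f' N (\<lambda>i. T $$ (i, j)) (\<lambda>i. W ^\<^sub>m a * (C i * W' ^\<^sub>m b))"
    using c Wa mdegD[OF Wa(2,1)] mdegD[OF T(2,1)] j
    by (intro lincomb_mult_left[of _ _ f]) (auto intro: even_commute[of "a * 2" _ 2])
  finally have eq: "W ^\<^sub>m Suc a * (C j * W' ^\<^sub>m b) = W ^\<^sub>m a * (C j * W' ^\<^sub>m Suc b) +
      lincomb f f' N (\<lambda>i. T $$ (i, j)) (\<lambda>i. W ^\<^sub>m a * (C i * W' ^\<^sub>m b))" .
  have "A * lincomb f f' N (\<lambda>i. T $$ (i, j)) (\<lambda>i. W ^\<^sub>m a * (C i * W' ^\<^sub>m b)) =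
      lincomb f' f' N (\<lambda>i. T $$ (i, j)) (\<lambda>i. A * (W ^\<^sub>m a * (C i * W' ^\<^sub>m b)))"
    using c2 A mdegD[OF A(2,1)] mdegD[OF T(2,1)] j
    by (intro lincomb_mult_left[of _ _ f]) (auto intro: even_commute[of 0 _ 2])
  then have "A * (W ^\<^sub>m Suc a * (C j * W' ^\<^sub>m b)) = A * (W ^\<^sub>m a * (C j * W' ^\<^sub>m Suc b)) +
      lincomb f' f' N (\<lambda>i. T $$ (i, j)) (\<lambda>i. A * (W ^\<^sub>m a * (C i * W' ^\<^sub>m b)))"
    unfolding eq by (simp only: mult_add_distrib_mat[OF A(1) c2[OF j] lincomb_carrier])
  then show ?thesis
    unfolding shifted_trace_def
    by (simp only: mtrace_add[OF mult_carrier_mat[OF A(1) c2[OF j]] lincomb_carrier]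
        mtrace_lincomb[OF mult_carrier_mat[OF A(1) c2]])
qed

lemma T_pow_step:
  assumes "i < N" "j < N"
  shows "(\<Sum>l<N. T $$ (l, j) * (fconst c * (T ^\<^sub>m k) $$ (i, l))) = fconst c * (T ^\<^sub>m Suc k) $$ (i, j)"
proof -
  have Tk: "T ^\<^sub>m k \<in> carrier_mat N N" "mdeg (k * 2) (T ^\<^sub>m k)" using T mdeg_pow[OF T(2,1)] by auto
  have "T $$ (l, j) * (fconst c * (T ^\<^sub>m k) $$ (i, l)) = fconst c * ((T ^\<^sub>m k) $$ (i, l) * T $$ (l, j))"
    if "l < N" for l
    unfolding fconst_mult_mult
    using even_commute[OF mdegD[OF T(2,1) that assms(2)] _ mdegD[OF Tk(2,1) assms(1) that]] by simp
  then show ?thesis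
    using assms by (simp add: index_mult_mat_sum[OF Tk(1) T(1)] sum_distrib_left)
qed

text \<open>Each exchange of \<open>W\<close> with \<open>C j\<close> contributes one even factor
  \<open>T\<close>, so all traces of the family are multiples of entries of powers of
  \<open>T\<close> and only a numerical coefficient has to be followed.\<close>

lemma shifted_trace_eq:
  assumes q: "\<And>b j. b \<le> m \<Longrightarrow> j < N \<Longrightarrow> shifted_trace W W' A C 0 b j = fconst (q b) * (T ^\<^sub>m b) $$ (i, j)"
    and i: "i < N" and "j < N" "a + b \<le> m"
  shows "shifted_trace W W' A C a b j = fconst (binomial_shift q a b) * (T ^\<^sub>m (a + b)) $$ (i, j)"
  using assms(3,4)
proof (induction a arbitrary: b j)
  case (Suc a)
  have "shifted_trace W W' A C (Suc a) b j = fconst (binomial_shift q a (Suc b)) * (T ^\<^sub>m (a + Suc b)) $$ (i, j) +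
     (\<Sum>l<N. T $$ (l, j) * (fconst (binomial_shift q a b) * (T ^\<^sub>m (a + b)) $$ (i, l)))"
    unfolding shifted_trace_Suc[OF Suc.prems(1)] using Suc by (intro arg_cong2[of _ _ _ _ "(+)"] sum.cong) auto
  then show ?case
    using T_pow_step[OF i Suc.prems(1)] by (simp add: fconst.hom_add distrib_right)
qed (use q in simp)

text \<open>The version for an induction in which the value at \<open>b = m\<close> is still
  unknown: it is kept as a separate summand, and \<open>q(m := 0)\<close> removes it from the
  coefficient.\<close>

lemma shifted_trace_eq_top:
  assumes q: "\<And>b j. b < m \<Longrightarrow> j < N \<Longrightarrow> shifted_trace W W' A C 0 b j = fconst (q b) * (T ^\<^sub>m b) $$ (i, j)"
    and i: "i < N" and "j < N" "a + b = m"
  shows "shifted_trace W W' A C a b j = shifted_trace W W' A C 0 m j + fconst (binomial_shift (q(m := 0)) a b) * (T ^\<^sub>m m) $$ (i, j)"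
  using assms(3,4)
proof (induction a arbitrary: b j)
  case 0
  then show ?case by simp
next
  case (Suc a)
  have below: "shifted_trace W W' A C a b l = fconst (binomial_shift (q(m := 0)) a b) * (T ^\<^sub>m (a + b)) $$ (i, l)" if "l < N" for l
    using Suc.prems that q i by (intro shifted_trace_eq[of "m - 1" "q(m := 0)"]) auto
  have "shifted_trace W W' A C (Suc a) b j = shifted_trace W W' A C a (Suc b) j +
     (\<Sum>l<N. T $$ (l, j) * (fconst (binomial_shift (q(m := 0)) a b) * (T ^\<^sub>m (a + b)) $$ (i, l)))"
    unfolding shifted_trace_Suc[OF Suc.prems(1)] using below by simp
  also have "shifted_trace W W' A C a (Suc b) j =
      shifted_trace W W' A C 0 m j + fconst (binomial_shift (q(m := 0)) a (Suc b)) * (T ^\<^sub>m m) $$ (i, j)"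
    using Suc.IH[of j "Suc b"] Suc.prems by (simp del: fun_upd_apply)
  also have "(\<Sum>l<N. T $$ (l, j) * (fconst (binomial_shift (q(m := 0)) a b) * (T ^\<^sub>m (a + b)) $$ (i, l))) =
      fconst (binomial_shift (q(m := 0)) a b) * (T ^\<^sub>m m) $$ (i, j)"
    using T_pow_step[OF i Suc.prems(1)] Suc.prems(2) by (simp flip: Suc.prems(2))
  finally show ?case by (simp add: fconst.hom_add distrib_right add.assoc del: fun_upd_apply)
qed

end

section \<open>Traces of Maurer--Cartan forms over Clifford modules\<close>

text \<open>The solution \<open>q\<close> of the recursion in \<open>clifford_shift_rec\<close>. It expresses that the matrix of traces
  of \<open>g i * g j * W ^ n\<close> is skew for \<open>n > 0\<close>, while moving \<open>W ^ n\<close> past \<open>g j\<close> transposes it.\<close>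

definition clifford_shift :: "complex \<Rightarrow> nat \<Rightarrow> complex" where
  "clifford_shift d n = (if n = 0 then - d else if n = 1 then d / 2 else if n = 3 then - d / 4 else 0)"

text \<open>The recursion characterizes the Taylor coefficients, times n!, of -2d / (exp z + 1) = d
  (tanh (z/2) - 1). Only exponents up to 3 are tabulated, as 2n + 1 is at most 7 in dimension
  7.\<close>

lemma clifford_shift_rec:
  "n \<in> {1, 2, 3} \<Longrightarrow> clifford_shift d n = - binomial_shift ((clifford_shift d)(n := 0)) n 0 / 2"
  by (auto simp: clifford_shift_def numeral_2_eq_2 numeral_3_eq_3)

lemma form_solve:
  assumes "- a = a + fconst c * (b :: 'n::{finite,linorder} form)"
  shows "a = fconst (- c / 2) * b"
proof (rule form_eqI)
  fix I
  have "- coeff a I = coeff a I + c * coeff b I"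
    using arg_cong[OF assms, of "\<lambda>f. coeff f I"] by simp
  then have "coeff a I + (coeff a I + c * coeff b I) = 0" by (simp only: neg_eq_iff_add_eq_0)
  then have "2 * coeff a I = - (c * coeff b I)" by (simp only: mult_2 add.assoc eq_neg_iff_add_eq_0)
  then have "coeff a I = - (c * coeff b I) / 2" by (simp only: eq_divide_eq_numeral1 mult.commute[of _ 2]) simp
  then show "coeff a I = coeff (fconst (- c / 2) * b) I" by simp
qed

lemma cmat_add: "A \<in> carrier_mat n m \<Longrightarrow> B \<in> carrier_mat n m \<Longrightarrow>
    cmat (A + B) = (cmat A + cmat B :: 'n::{finite,linorder} form mat)"
  by (intro eq_matI) (auto simp: fconst.hom_add)

lemma cmat_smult: "cmat (c \<cdot>\<^sub>m A) = (fconst c \<cdot>\<^sub>m cmat A :: 'n::{finite,linorder} form mat)"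
  by (intro eq_matI) (auto simp: fconst.hom_mult)

text \<open>The abstract situation: \<open>U\<close> and \<open>T\<close> stand for the
  Maurer-Cartan forms of the spinor and the vector bundle, \<open>rel\<close> is the derivative of
  the equivariance of Clifford multiplication, and \<open>schur\<close> expresses
  irreducibility.\<close>

context
  fixes U T :: "'n::{finite,linorder} form mat" and g :: "nat \<Rightarrow> complex mat" and D N :: nat
  assumes U: "U \<in> carrier_mat D D" "mdeg 1 U" and T: "T \<in> carrier_mat N N" "mdeg 1 T"
    and skew: "\<And>i j. i < N \<Longrightarrow> j < N \<Longrightarrow> T $$ (j, i) = - T $$ (i, j)"
    and g: "\<And>i. i < N \<Longrightarrow> g i \<in> carrier_mat D D"
    and clifford: "\<And>i j. i < N \<Longrightarrow> j < N \<Longrightarrow> g i * g j + g j * g i = (if i = j then - 2 else 0) \<cdot>\<^sub>m 1\<^sub>m D"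
    and schur: "\<And>V. V \<in> carrier_mat D D \<Longrightarrow> (\<And>i. i < N \<Longrightarrow> V * g i = g i * V) \<Longrightarrow> \<exists>c. V = c \<cdot>\<^sub>m 1\<^sub>m D"
    and rel: "\<And>j. j < N \<Longrightarrow> U * cmat (g j) = cmat (g j) * U + lincomb D D N (\<lambda>i. T $$ (i, j)) (\<lambda>i. cmat (g i))"
begin

private abbreviation (input) "W \<equiv> U * U"
private abbreviation (input) "Om \<equiv> T * T"
private abbreviation (input) G :: "nat \<Rightarrow> 'n form mat" where "G i \<equiv> cmat (g i)"

private lemma G: "i < N \<Longrightarrow> G i \<in> carrier_mat D D"
  using g by simp

private lemma W: "W \<in> carrier_mat D D" "mdeg 2 W" and Om: "Om \<in> carrier_mat N N" "mdeg 2 Om"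
  using U T mdeg_mult[OF U(2) U(2) U(1) U(1)] mdeg_mult[OF T(2) T(2) T(1) T(1)] by (auto simp: numeral_2_eq_2)

private lemma Wpow: "W ^\<^sub>m n \<in> carrier_mat D D" "mdeg (n * 2) (W ^\<^sub>m n)"
  using W mdeg_pow[OF W(2,1)] by auto

lemma mtrace_Wpow: "n > 0 \<Longrightarrow> mtrace (W ^\<^sub>m n) = 0"
  using mtrace_even_power[OF U, of "2 * n"] by (simp add: pow_mat_mult2[OF U(1)])

lemma G_anticommute: "i < N \<Longrightarrow> j < N \<Longrightarrow> G i * G j + G j * G i = fconst (if i = j then - 2 else 0) \<cdot>\<^sub>m 1\<^sub>m D"
proof -
  assume ij: "i < N" "j < N"
  note c = g[OF ij(1)] g[OF ij(2)]
  have "G i * G j + G j * G i = cmat (g i * g j + g j * g i)"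
    using c by (simp add: fconst.mat_hom_mult[OF c] fconst.mat_hom_mult[OF c(2,1)]
        cmat_add[OF mult_carrier_mat[OF c] mult_carrier_mat[OF c(2,1)]])
  also have "\<dots> = fconst (if i = j then - 2 else 0) \<cdot>\<^sub>m 1\<^sub>m D"
    unfolding clifford[OF ij] by (intro eq_matI) auto
  finally show ?thesis .
qed

definition gamma_trace :: "nat \<Rightarrow> nat \<Rightarrow> nat \<Rightarrow> 'n form" where
  "gamma_trace n i j = mtrace (G i * (G j * W ^\<^sub>m n))"

lemma gamma_trace_add:
  assumes "i < N" "j < N"
  shows "gamma_trace n i j + gamma_trace n j i = fconst (if i = j then - 2 else 0) * mtrace (W ^\<^sub>m n)"
proof -
  note Gi = G[OF assms(1)] and Gj = G[OF assms(2)]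
  have "gamma_trace n i j + gamma_trace n j i = mtrace ((G i * G j) * W ^\<^sub>m n) + mtrace ((G j * G i) * W ^\<^sub>m n)"
    unfolding gamma_trace_def by (simp only: assoc_mult_mat[OF Gi Gj Wpow(1)] assoc_mult_mat[OF Gj Gi Wpow(1)])
  also have "\<dots> = mtrace ((G i * G j + G j * G i) * W ^\<^sub>m n)"
    by (simp only: add_mult_distrib_mat[OF mult_carrier_mat[OF Gi Gj] mult_carrier_mat[OF Gj Gi] Wpow(1)]
        mtrace_add[OF mult_carrier_mat[OF mult_carrier_mat[OF Gi Gj] Wpow(1)] mult_carrier_mat[OF mult_carrier_mat[OF Gj Gi] Wpow(1)]])
  also have "\<dots> = mtrace (fconst (if i = j then - 2 else 0) \<cdot>\<^sub>m W ^\<^sub>m n)"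
    unfolding G_anticommute[OF assms] using smult_mult_mat[OF one_carrier_mat Wpow(1)] left_mult_one_mat[OF Wpow(1)] by simp
  finally show ?thesis using Wpow(1) by (simp add: mtrace_smult[of _ D])
qed

text \<open>By cyclicity the trace is symmetric in \<open>i\<close> and \<open>j\<close>, hence half
  the trace of the anticommutator.\<close>

lemma gamma_trace_0: "i < N \<Longrightarrow> j < N \<Longrightarrow> gamma_trace 0 i j = fconst (- of_nat D) * (Om ^\<^sub>m 0) $$ (i, j)"
proof -
  assume ij: "i < N" "j < N"
  have "gamma_trace 0 i j = gamma_trace 0 j i"
    unfolding gamma_trace_def using right_mult_one_mat[OF G[OF ij(1)]] right_mult_one_mat[OF G[OF ij(2)]] W(1) U(1)
      mtrace_comm_even[OF G[OF ij(1)] G[OF ij(2)] mdeg_map_fconst mdeg_map_fconst] by simp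
  then have "fconst 2 * gamma_trace 0 i j = fconst (if i = j then - 2 else 0) * mtrace (1\<^sub>m D)"
    using gamma_trace_add[OF ij, of 0] W(1) carrier_matD[OF U(1)] by (simp add: fconst_numeral mult_2)
  then have "fconst (1/2) * (fconst 2 * gamma_trace 0 i j) = fconst (1/2) * (fconst (if i = j then - 2 else 0) * mtrace (1\<^sub>m D))"
    by simp
  then show ?thesis
    using ij T(1) by (auto intro!: form_eqI dest!: arg_cong[of _ _ coeff] simp: fun_eq_iff mtrace_def coeff_one)
      (simp_all flip: fconst_of_nat add: coeff_fconst)
qed

text \<open>For \<open>n > 0\<close> the trace with \<open>i\<close> and \<open>j\<close> exchanged
  is found in two ways: the Clifford relation gives the negative, as the trace of the power of
  \<open>W\<close> vanishes; moving the power of \<open>W\<close> around the trace and past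
  \<open>G j\<close> gives the trace itself plus terms with smaller exponents. The resulting
  equation is solved for the unknown.\<close>

lemma gamma_trace_eq:
  assumes "n \<le> 3" "i < N" "j < N"
  shows "gamma_trace n i j = fconst (clifford_shift (of_nat D) n) * (Om ^\<^sub>m n) $$ (i, j)"
  using assms
proof (induction n arbitrary: i j rule: less_induct)
  case (less n)
  show ?case
  proof (cases "n = 0")
    case True
    then show ?thesis using gamma_trace_0 less.prems by (simp add: clifford_shift_def)
  next
    case False
    note i = less.prems(2) and j = less.prems(3)
    have relW: "W * G j = G j * W + lincomb D D N (\<lambda>i. Om $$ (i, j)) G" if "j < N" for j
      by (rule square_intertwine[OF U U(1) T G rel that])
    have sh0: "shifted_trace W W (G i) G 0 b j = gamma_trace b i j" if "j < N" for b j
      using left_mult_one_mat[OF mult_carrier_mat[OF G[OF that] Wpow(1)]] U by (simp add: shifted_trace_def gamma_trace_def)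
    have "shifted_trace W W (G i) G n 0 j = shifted_trace W W (G i) G 0 n j +
        fconst (binomial_shift ((clifford_shift (of_nat D))(n := 0)) n 0) * (Om ^\<^sub>m n) $$ (i, j)"
    proof (rule shifted_trace_eq_top[OF W W(1) Om G G[OF i] mdeg_map_fconst relW _ i j])
      fix b j assume "b < n" "j < N"
      then show "shifted_trace W W (G i) G 0 b j = fconst (clifford_shift (of_nat D) b) * (Om ^\<^sub>m b) $$ (i, j)"
        unfolding sh0[OF \<open>j < N\<close>] using less.IH[of b i j] less.prems i by simp
    qed auto
    moreover have "shifted_trace W W (G i) G n 0 j = gamma_trace n j i"
    proof -
      have "shifted_trace W W (G i) G n 0 j = mtrace (G i * (W ^\<^sub>m n * G j))"
        using right_mult_one_mat[OF G[OF j]] U by (simp add: shifted_trace_def)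
      also have "\<dots> = mtrace ((G i * W ^\<^sub>m n) * G j)"
        by (simp only: assoc_mult_mat[OF G[OF i] Wpow(1) G[OF j]])
      also have "\<dots> = mtrace (G j * (G i * W ^\<^sub>m n))"
        using mdeg_mult[OF mdeg_map_fconst Wpow(2) G[OF i] Wpow(1)]
        by (intro mtrace_comm_even[OF mult_carrier_mat[OF G[OF i] Wpow(1)] G[OF j] _ mdeg_map_fconst]) auto
      finally show ?thesis by (simp add: gamma_trace_def)
    qed
    moreover have "gamma_trace n j i = - gamma_trace n i j"
      using gamma_trace_add[OF i j, of n] False mtrace_Wpow[of n] by (simp add: eq_neg_iff_add_eq_0 add.commute)
    ultimately have "- gamma_trace n i j = gamma_trace n i j + fconst (binomial_shift ((clifford_shift (of_nat D))(n := 0)) n 0) * (Om ^\<^sub>m n) $$ (i, j)"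
      using sh0[OF j] by simp
    moreover have "n \<in> {1, 2, 3}" using False less.prems(1) by auto
    ultimately show ?thesis
      unfolding clifford_shift_rec[OF \<open>n \<in> {1, 2, 3}\<close>] by (intro form_solve)
  qed
qed

text \<open>By Schur's lemma \<open>U\<close> differs from \<open>spin_lift\<close> by a scalar one-form, which does not contribute to the
  traces below because the trace of \<open>W ^ n\<close> vanishes.\<close>

definition spin_lift :: "'n form mat" where
  "spin_lift = lincomb D D N (\<lambda>i. fconst (- 1 / 4)) (\<lambda>i. lincomb D D N (\<lambda>j. T $$ (i, j)) (\<lambda>j. G i * G j))"

lemma spin_lift: "spin_lift \<in> carrier_mat D D" "mdeg 1 spin_lift"
proof -
  show "spin_lift \<in> carrier_mat D D" by (simp add: spin_lift_def)
  have "hdeg 1 (T $$ (i, j) * (G i * G j) $$ (r, s))" if "i < N" "j < N" "r < D" "s < D" for i j r s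
    using hdeg_mult[OF mdegD[OF T(2,1) that(1,2)]
        mdegD[OF mdeg_mult[OF mdeg_map_fconst mdeg_map_fconst G[OF that(1)] G[OF that(2)]]
          mult_carrier_mat[OF G[OF that(1)] G[OF that(2)]] that(3,4)]] by simp
  then show "mdeg 1 spin_lift" unfolding spin_lift_def mdeg_def by (auto intro!: hdeg_sum hdeg_fconst_mult)
qed

text \<open>Two anticommutations bring \<open>g k\<close> to the front; this is the commutator of a
  quadratic Clifford element with a generator.\<close>

lemma g_triple:
  assumes "i < N" "j < N" "k < N"
  shows "g i * g j * g k = g k * (g i * g j) +
    ((if i = k then 2 else 0) \<cdot>\<^sub>m g j + (if j = k then - 2 else 0) \<cdot>\<^sub>m g i)"
proof -
  note c = g[OF assms(1)] g[OF assms(2)] g[OF assms(3)]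
  note cc = mult_carrier_mat[OF c(2,3)] mult_carrier_mat[OF c(3,2)] mult_carrier_mat[OF c(1,3)] mult_carrier_mat[OF c(3,1)]
    mult_carrier_mat[OF c(1,2)]
  have "g i * (g j * g k + g k * g j) = (if j = k then - 2 else 0) \<cdot>\<^sub>m g i"
    unfolding clifford[OF assms(2,3)] mult_smult_distrib[OF c(1) one_carrier_mat] right_mult_one_mat[OF c(1)] ..
  moreover have "(g i * g k + g k * g i) * g j = (if i = k then - 2 else 0) \<cdot>\<^sub>m g j"
    unfolding clifford[OF assms(1,3)] mult_smult_assoc_mat[OF one_carrier_mat c(2)] left_mult_one_mat[OF c(2)] ..
  moreover have "g i * (g j * g k + g k * g j) = g i * g j * g k + g i * g k * g j"
    by (simp only: mult_add_distrib_mat[OF c(1) cc(1,2)] assoc_mult_mat[OF c(1,2,3)] assoc_mult_mat[OF c(1,3,2)])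
  moreover have "(g i * g k + g k * g i) * g j = g i * g k * g j + g k * (g i * g j)"
    by (simp only: add_mult_distrib_mat[OF cc(3,4) c(2)] assoc_mult_mat[OF c(3,1,2)])
  ultimately have 1: "g i * g j * g k + g i * g k * g j = (if j = k then - 2 else 0) \<cdot>\<^sub>m g i"
    and 2: "g i * g k * g j + g k * (g i * g j) = (if i = k then - 2 else 0) \<cdot>\<^sub>m g j"
    by simp_all
  show ?thesis
  proof (rule eq_matI)
    let ?R = "g k * (g i * g j) + ((if i = k then 2 else 0) \<cdot>\<^sub>m g j + (if j = k then - 2 else 0) \<cdot>\<^sub>m g i)"
    fix r s assume "r < dim_row ?R" "s < dim_col ?R"
    then have rs: "r < D" "s < D" using c by auto
    have "(g i * g j * g k) $$ (r, s) + (g i * g k * g j) $$ (r, s) = (if j = k then - 2 else 0) * g i $$ (r, s)"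
      using arg_cong[OF 1, of "\<lambda>A. A $$ (r, s)"] rs c by auto
    moreover have "(g i * g k * g j) $$ (r, s) + (g k * (g i * g j)) $$ (r, s) = (if i = k then - 2 else 0) * g j $$ (r, s)"
      using arg_cong[OF 2, of "\<lambda>A. A $$ (r, s)"] rs c by auto
    ultimately have "(g i * g j * g k) $$ (r, s) = (if j = k then - 2 else 0) * g i $$ (r, s) - (g i * g k * g j) $$ (r, s)"
      "(g k * (g i * g j)) $$ (r, s) = (if i = k then - 2 else 0) * g j $$ (r, s) - (g i * g k * g j) $$ (r, s)"
      by (simp_all only: eq_diff_eq add.commute)
    then have "(g i * g j * g k) $$ (r, s) = (g k * (g i * g j)) $$ (r, s) +
        ((if i = k then 2 else 0) * g j $$ (r, s) + (if j = k then - 2 else 0) * g i $$ (r, s))"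
      by auto
    then show "(g i * g j * g k) $$ (r, s) = ?R $$ (r, s)"
      using rs c by simp
  qed (use c in auto)
qed

lemma G_triple:
  assumes "i < N" "j < N" "k < N"
  shows "G i * G j * G k = G k * (G i * G j) +
    (fconst (if i = k then 2 else 0) \<cdot>\<^sub>m G j + fconst (if j = k then - 2 else 0) \<cdot>\<^sub>m G i)"
proof -
  note c = g[OF assms(1)] g[OF assms(2)] g[OF assms(3)]
  have "G i * G j * G k = cmat (g i * g j * g k)"
    by (simp only: fconst.mat_hom_mult[OF c(1,2)] fconst.mat_hom_mult[OF mult_carrier_mat[OF c(1,2)] c(3)])
  also have "\<dots> = G k * (G i * G j) +
    (fconst (if i = k then 2 else 0) \<cdot>\<^sub>m G j + fconst (if j = k then - 2 else 0) \<cdot>\<^sub>m G i)"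
    unfolding g_triple[OF assms] using c
    by (simp only: fconst.mat_hom_mult[OF c(1,2)] fconst.mat_hom_mult[OF c(3) mult_carrier_mat[OF c(1,2)]] cmat_smult
        cmat_add[OF mult_carrier_mat[OF c(3) mult_carrier_mat[OF c(1,2)]] add_carrier_mat[OF smult_carrier_mat[OF c(1)]]]
        cmat_add[OF smult_carrier_mat[OF c(2)] smult_carrier_mat[OF c(1)]])
  finally show ?thesis .
qed

text \<open>Explains the factor -1/4: the two contractions in \<open>G_triple\<close> carry the
  factors 2 and -2, and the skewness of \<open>T\<close> makes the two halves equal.\<close>

lemma spin_lift_rel:
  assumes k: "k < N"
  shows "spin_lift * G k = G k * spin_lift + lincomb D D N (\<lambda>i. T $$ (i, k)) G"
proof (rule eq_matI)
  let ?R = "G k * spin_lift + lincomb D D N (\<lambda>i. T $$ (i, k)) G"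
  fix r s assume "r < dim_row ?R" "s < dim_col ?R"
  then have rs: "r < D" "s < D" using G[OF k] by auto
  have c2: "G i * G j \<in> carrier_mat D D" if "i < N" "j < N" for i j by (rule mult_carrier_mat[OF G[OF that(1)] G[OF that(2)]])
  have GU: "G k * spin_lift = lincomb D D N (\<lambda>i. fconst (- 1 / 4)) (\<lambda>i. lincomb D D N (\<lambda>j. T $$ (i, j)) (\<lambda>j. G k * (G i * G j)))"
  proof -
    have "G k * spin_lift = lincomb D D N (\<lambda>i. fconst (- 1 / 4)) (\<lambda>i. G k * lincomb D D N (\<lambda>j. T $$ (i, j)) (\<lambda>j. G i * G j))"
      unfolding spin_lift_def by (intro lincomb_mult_left[of _ _ D] mult_fconst lincomb_carrier G[OF k])
    also have "\<dots> = lincomb D D N (\<lambda>i. fconst (- 1 / 4)) (\<lambda>i. lincomb D D N (\<lambda>j. T $$ (i, j)) (\<lambda>j. G k * (G i * G j)))"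
    proof (rule lincomb_cong[OF refl])
      fix i assume "i < N"
      then show "G k * lincomb D D N (\<lambda>j. T $$ (i, j)) (\<lambda>j. G i * G j) = lincomb D D N (\<lambda>j. T $$ (i, j)) (\<lambda>j. G k * (G i * G j))"
        using c2 G[OF k] by (intro lincomb_mult_left[of _ _ D]) (auto simp: mult_fconst)
    qed
    finally show ?thesis .
  qed
  have UG: "spin_lift * G k = lincomb D D N (\<lambda>i. fconst (- 1 / 4)) (\<lambda>i. lincomb D D N (\<lambda>j. T $$ (i, j)) (\<lambda>j. G i * G j * G k))"
    unfolding spin_lift_def using lincomb_mult_right[OF lincomb_carrier G[OF k]]
    by (auto intro!: lincomb_cong lincomb_mult_right[OF c2 G[OF k]])
  have "(\<Sum>i<N. fconst (- 1 / 4) * (\<Sum>j<N. T $$ (i, j) * (fconst (if i = k then 2 else 0) * G j $$ (r, s) + fconst (if j = k then - 2 else 0) * G i $$ (r, s)))) =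
    (\<Sum>i<N. T $$ (i, k) * G i $$ (r, s))"
  proof -
    have "(\<Sum>i<N. fconst (- 1 / 4) * (\<Sum>j<N. T $$ (i, j) * (fconst (if i = k then 2 else 0) * G j $$ (r, s) + fconst (if j = k then - 2 else 0) * G i $$ (r, s)))) =
      (\<Sum>i<N. \<Sum>j<N. if i = k then fconst (- 1 / 2) * (T $$ (i, j) * G j $$ (r, s)) else 0) +
      (\<Sum>i<N. \<Sum>j<N. if j = k then fconst (1 / 2) * (T $$ (i, j) * G i $$ (r, s)) else 0)"
      unfolding sum.distrib[symmetric] sum_distrib_left
      by (intro sum.cong refl form_eqI) (auto simp: distrib_left fconst_mult_mult[where a = "T $$ (i, j)" for i j])
    also have "(\<Sum>i<N. \<Sum>j<N. if i = k then fconst (- 1 / 2) * (T $$ (i, j) * G j $$ (r, s)) else 0) =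
      (\<Sum>i<N. if i = k then (\<Sum>j<N. fconst (- 1 / 2) * (T $$ (k, j) * G j $$ (r, s))) else 0)"
      by (intro sum.cong) auto
    also have "\<dots> = (\<Sum>j<N. fconst (1 / 2) * (T $$ (j, k) * G j $$ (r, s)))"
      using k by (auto intro!: sum.cong form_eqI simp: skew[OF _ k])
    also have "(\<Sum>i<N. \<Sum>j<N. if j = k then fconst (1 / 2) * (T $$ (i, j) * G i $$ (r, s)) else 0) =
      (\<Sum>i<N. fconst (1 / 2) * (T $$ (i, k) * G i $$ (r, s)))"
      using k by (intro sum.cong) auto
    also have "(\<Sum>j<N. fconst (1 / 2) * (T $$ (j, k) * G j $$ (r, s))) + (\<Sum>i<N. fconst (1 / 2) * (T $$ (i, k) * G i $$ (r, s))) =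
      (\<Sum>i<N. T $$ (i, k) * G i $$ (r, s))"
      unfolding sum.distrib[symmetric] by (intro sum.cong form_eqI) auto
    finally show ?thesis .
  qed
  moreover have "(G i * G j * G k) $$ (r, s) = (G k * (G i * G j)) $$ (r, s) +
      (fconst (if i = k then 2 else 0) * G j $$ (r, s) + fconst (if j = k then - 2 else 0) * G i $$ (r, s))" if "i < N" "j < N" for i j
    unfolding G_triple[OF that k] using rs G[OF k] G[OF that(1)] G[OF that(2)] by auto
  ultimately show "(spin_lift * G k) $$ (r, s) = ?R $$ (r, s)"
    unfolding UG GU using rs by (simp add: distrib_left sum.distrib)
qed (use G[OF k] spin_lift in auto)

lemma U_minus_U0_scalar:
  obtains l where "hdeg 1 l" "U = spin_lift + l \<cdot>\<^sub>m 1\<^sub>m D"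
proof -
  let ?V = "U - spin_lift"
  have V: "?V \<in> carrier_mat D D" by (rule minus_carrier_mat[OF spin_lift(1)])
  have comm: "?V * G k = G k * ?V" if k: "k < N" for k
    unfolding minus_mult_distrib_mat[OF U(1) spin_lift(1) G[OF k]] mult_minus_distrib_mat[OF G[OF k] U(1) spin_lift(1)]
      rel[OF k] spin_lift_rel[OF k] using G[OF k] U(1) spin_lift(1) by (intro eq_matI) auto
  \<comment> \<open>Schur's lemma concerns complex matrices, so it is applied to each coefficient of
    the form-valued matrix separately.\<close>
  have "\<exists>c. map_mat (\<lambda>a. coeff a I) ?V = c \<cdot>\<^sub>m 1\<^sub>m D" for I
  proof (rule schur)
    fix k assume k: "k < N"
    show "map_mat (\<lambda>a. coeff a I) ?V * g k = g k * map_mat (\<lambda>a. coeff a I) ?V"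
    proof (rule eq_matI)
      fix r s assume "r < dim_row (g k * map_mat (\<lambda>a. coeff a I) ?V)" "s < dim_col (g k * map_mat (\<lambda>a. coeff a I) ?V)"
      then have rs: "r < D" "s < D" using g[OF k] V by auto
      have 1: "(map_mat (\<lambda>a. coeff a I) ?V * g k) $$ (r, s) = coeff ((?V * G k) $$ (r, s)) I"
        using rs g[OF k] V spin_lift(1) by (simp add: index_mult_mat_sum[of _ D D _ D] mult.commute)
      have 2: "(g k * map_mat (\<lambda>a. coeff a I) ?V) $$ (r, s) = coeff ((G k * ?V) $$ (r, s)) I"
        using rs g[OF k] V spin_lift(1) by (simp add: index_mult_mat_sum[of _ D D _ D] mult.commute)
      show "(map_mat (\<lambda>a. coeff a I) ?V * g k) $$ (r, s) = (g k * map_mat (\<lambda>a. coeff a I) ?V) $$ (r, s)"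
        unfolding 1 2 comm[OF k] ..
    qed (use g[OF k] V in auto)
  qed (use V in auto)
  then obtain c where c: "map_mat (\<lambda>a. coeff a I) ?V = c I \<cdot>\<^sub>m 1\<^sub>m D" for I by metis
  have cV: "coeff (U $$ (r, s) - spin_lift $$ (r, s)) I = (if r = s then c I else 0)" if "r < D" "s < D" for r s I
    using arg_cong[OF c[of I], of "\<lambda>A. A $$ (r, s)"] that V U spin_lift by auto
  \<comment> \<open>For \<open>D = 0\<close> the coefficients \<open>c\<close> are arbitrary; 0 is
    chosen to have degree 1.\<close>
  define l where "l = (if D = 0 then 0 else Form c)"
  have "hdeg 1 l"
  proof (cases "D = 0")
    case False
    then have "coeff (U $$ (0, 0) - spin_lift $$ (0, 0)) = c" using cV[of 0 0] by (auto simp: fun_eq_iff)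
    then have "l = U $$ (0, 0) - spin_lift $$ (0, 0)" using False by (auto simp: l_def intro!: form_eqI)
    then show ?thesis using False mdegD[OF U(2,1), of 0 0] mdegD[OF spin_lift(2,1), of 0 0] by (simp add: hdeg_diff)
  qed (simp add: l_def)
  moreover have "U = spin_lift + l \<cdot>\<^sub>m 1\<^sub>m D"
  proof (rule eq_matI)
    fix r s assume "r < dim_row (spin_lift + l \<cdot>\<^sub>m 1\<^sub>m D)" "s < dim_col (spin_lift + l \<cdot>\<^sub>m 1\<^sub>m D)"
    then have rs: "r < D" "s < D" by auto
    have "coeff (U $$ (r, s)) I = coeff (spin_lift $$ (r, s)) I + (if r = s then coeff l I else 0)" for I
      using cV[OF rs, of I] rs by (auto simp: l_def algebra_simps)
    then show "U $$ (r, s) = (spin_lift + l \<cdot>\<^sub>m 1\<^sub>m D) $$ (r, s)"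
      using rs by (intro form_eqI) auto
  qed (use U in auto)
  ultimately show ?thesis using that by blast
qed

text \<open>The factor 1/4 is the -1/4 of \<open>spin_lift\<close>, with its sign reversed by
  exchanging the indices of the skew matrix \<open>T\<close> so that the double sum becomes a
  trace.\<close>

lemma mtrace_clifford:
  assumes "n \<in> {1, 2, 3}"
  shows "mtrace (U ^\<^sub>m (2 * n + 1)) = fconst (clifford_shift (of_nat D) n / 4) * mtrace (T ^\<^sub>m (2 * n + 1))"
proof -
  obtain l where l: "hdeg 1 l" "U = spin_lift + l \<cdot>\<^sub>m 1\<^sub>m D" by (rule U_minus_U0_scalar)
  have n: "n > 0" "n \<le> 3" using assms by auto
  have Up: "U ^\<^sub>m (2 * n + 1) = U * W ^\<^sub>m n"
    using pow_mat_Suc_left[OF U(1), of "2 * n"] by (simp add: pow_mat_mult2[OF U(1)])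
  have Tp: "T ^\<^sub>m (2 * n + 1) = T * Om ^\<^sub>m n"
    using pow_mat_Suc_left[OF T(1), of "2 * n"] by (simp add: pow_mat_mult2[OF T(1)])
  have "U * W ^\<^sub>m n = (spin_lift + l \<cdot>\<^sub>m 1\<^sub>m D) * W ^\<^sub>m n" using arg_cong[OF l(2), of "\<lambda>V. V * W ^\<^sub>m n"] .
  also have "\<dots> = spin_lift * W ^\<^sub>m n + l \<cdot>\<^sub>m W ^\<^sub>m n"
    using spin_lift(1) Wpow(1)[of n] smult_mult_mat[OF one_carrier_mat Wpow(1)[of n], of l] left_mult_one_mat[OF Wpow(1)[of n]]
    by (simp add: add_mult_distrib_mat[of _ D D _ _ D])
  finally have "mtrace (U ^\<^sub>m (2 * n + 1)) = mtrace (spin_lift * W ^\<^sub>m n)"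
    unfolding Up using spin_lift(1) Wpow(1)[of n] n mtrace_Wpow[of n]
    by (simp add: mtrace_add[of _ D] mtrace_smult[of _ D])
  also have "spin_lift * W ^\<^sub>m n = lincomb D D N (\<lambda>i. fconst (- 1 / 4)) (\<lambda>i. lincomb D D N (\<lambda>j. T $$ (i, j)) (\<lambda>j. G i * (G j * W ^\<^sub>m n)))"
    unfolding spin_lift_def lincomb_mult_right[OF lincomb_carrier Wpow(1)]
    using G lincomb_mult_right[OF mult_carrier_mat[OF G G] Wpow(1)] Wpow(1)[of n]
    by (auto intro!: lincomb_cong simp: assoc_mult_mat[OF G G Wpow(1)])
  also have "mtrace \<dots> = (\<Sum>i<N. fconst (- 1 / 4) * (\<Sum>j<N. T $$ (i, j) * gamma_trace n i j))"
    using mtrace_lincomb[OF mult_carrier_mat[OF G mult_carrier_mat[OF G Wpow(1)]]]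
    by (simp add: mtrace_lincomb gamma_trace_def)
  also have "\<dots> = (\<Sum>i<N. \<Sum>j<N. fconst (clifford_shift (of_nat D) n / 4) * (T $$ (j, i) * (Om ^\<^sub>m n) $$ (i, j)))"
    unfolding sum_distrib_left
  proof (intro sum.cong refl form_eqI)
    fix i j I assume "i \<in> {..<N}" "j \<in> {..<N}"
    then have ij: "i < N" "j < N" by auto
    show "coeff (fconst (- 1 / 4) * (T $$ (i, j) * gamma_trace n i j)) I =
      coeff (fconst (clifford_shift (of_nat D) n / 4) * (T $$ (j, i) * (Om ^\<^sub>m n) $$ (i, j))) I"
      unfolding gamma_trace_eq[OF n(2) ij] skew[OF ij] fconst_mult_mult[of "T $$ (i, j)"] by simp
  qed
  also have "\<dots> = fconst (clifford_shift (of_nat D) n / 4) * (\<Sum>j<N. \<Sum>i<N. T $$ (j, i) * (Om ^\<^sub>m n) $$ (i, j))"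
    by (subst sum.swap) (simp add: sum_distrib_left)
  also have "(\<Sum>j<N. \<Sum>i<N. T $$ (j, i) * (Om ^\<^sub>m n) $$ (i, j)) = mtrace (T * Om ^\<^sub>m n)"
    using T Om by (simp add: mtrace_carrier[of _ N N] index_mult_mat_sum[of _ N N _ N])
  finally show ?thesis unfolding Tp .
qed

end

section \<open>The spinor representation\<close>

lemma kron_add_left:
  assumes "A \<in> carrier_mat a b" "A' \<in> carrier_mat a b" "B \<in> carrier_mat c d"
  shows "kron (A + A' :: 'a::semiring_0 mat) B = kron A B + kron A' B"
proof (rule eq_matI)
  fix i j assume "i < dim_row (kron A B + kron A' B)" "j < dim_col (kron A B + kron A' B)"
  then have ij: "i < a * c" "j < b * d" using assms by (auto simp: kron_def)
  then show "kron (A + A') B $$ (i, j) = (kron A B + kron A' B) $$ (i, j)"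
    using assms carrier_matD[OF kron_carrier[OF assms(2,3)]] div_mod_less[OF ij(1)] div_mod_less[OF ij(2)]
    by (simp add: kron_index[OF assms(1,3)] kron_index[OF assms(2,3)]
        kron_index[OF add_carrier_mat[OF assms(2)] assms(3)] distrib_right)
qed (use assms in \<open>auto simp: kron_def\<close>)

lemma kron_zero_left: "B \<in> carrier_mat c d \<Longrightarrow> kron (0\<^sub>m a b) (B :: 'a::semiring_0 mat) = 0\<^sub>m (a * c) (b * d)"
proof (rule eq_matI)
  fix i j assume "B \<in> carrier_mat c d" "i < dim_row (0\<^sub>m (a * c) (b * d) :: 'a mat)" "j < dim_col (0\<^sub>m (a * c) (b * d) :: 'a mat)"
  then have B: "B \<in> carrier_mat c d" and ij: "i < a * c" "j < b * d" by auto
  show "kron (0\<^sub>m a b) B $$ (i, j) = 0\<^sub>m (a * c) (b * d) $$ (i, j)"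
    using ij div_mod_less[OF ij(1)] div_mod_less[OF ij(2)] by (simp add: kron_index[OF zero_carrier_mat B])
qed (auto simp: kron_def)

lemma kron_smult_right:
  assumes "A \<in> carrier_mat a b" "B \<in> carrier_mat c d"
  shows "kron A (s \<cdot>\<^sub>m B) = s \<cdot>\<^sub>m kron A (B :: 'a::comm_semiring_0 mat)"
proof (rule eq_matI)
  fix i j assume "i < dim_row (s \<cdot>\<^sub>m kron A B)" "j < dim_col (s \<cdot>\<^sub>m kron A B)"
  then have ij: "i < a * c" "j < b * d" using assms by (auto simp: kron_def)
  then show "kron A (s \<cdot>\<^sub>m B) $$ (i, j) = (s \<cdot>\<^sub>m kron A B) $$ (i, j)"
    using assms carrier_matD[OF kron_carrier[OF assms]] div_mod_less[OF ij(1)] div_mod_less[OF ij(2)]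
    by (simp add: kron_index[OF assms] kron_index[OF assms(1) smult_carrier_mat[OF assms(2)]] ac_simps)
qed (use assms in \<open>auto simp: kron_def\<close>)

section \<open>Pauli matrices and irreducibility of the Clifford module\<close>

lemma pauli_carrier [simp]: "pauli1 \<in> carrier_mat 2 2" "pauli2 \<in> carrier_mat 2 2" "pauli3 \<in> carrier_mat 2 2"
  by (auto simp: pauli1_def pauli2_def pauli3_def mat_of_rows_list_def)

lemma pauli_index:
  "pauli1 $$ (0, 0) = 0" "pauli1 $$ (0, Suc 0) = 1" "pauli1 $$ (Suc 0, 0) = 1" "pauli1 $$ (Suc 0, Suc 0) = 0"
  "pauli2 $$ (0, 0) = 0" "pauli2 $$ (0, Suc 0) = - \<i>" "pauli2 $$ (Suc 0, 0) = \<i>" "pauli2 $$ (Suc 0, Suc 0) = 0"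
  "pauli3 $$ (0, 0) = 1" "pauli3 $$ (0, Suc 0) = 0" "pauli3 $$ (Suc 0, 0) = 0" "pauli3 $$ (Suc 0, Suc 0) = - 1"
  by (simp_all add: pauli1_def pauli2_def pauli3_def mat_of_rows_list_def)

lemma mat_2_eqI:
  assumes "A \<in> carrier_mat 2 2" "B \<in> carrier_mat 2 2" "A $$ (0, 0) = B $$ (0, 0)" "A $$ (0, Suc 0) = B $$ (0, Suc 0)"
    "A $$ (Suc 0, 0) = B $$ (Suc 0, 0)" "A $$ (Suc 0, Suc 0) = B $$ (Suc 0, Suc 0)"
  shows "A = B"
  using assms by (intro eq_matI) (auto simp: less_2_cases_iff)

lemma index_mult_mat_2:
  "A \<in> carrier_mat 2 2 \<Longrightarrow> B \<in> carrier_mat 2 2 \<Longrightarrow> i < 2 \<Longrightarrow> j < 2 \<Longrightarrow>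
    (A * B) $$ (i, j) = A $$ (i, 0) * B $$ (0, j) + A $$ (i, Suc 0) * B $$ (Suc 0, j)"
  by (subst index_mult_mat_sum[of A 2 2 B 2]) (auto simp: numeral_2_eq_2)

lemma pauli_mult:
  "pauli1 * pauli1 = 1\<^sub>m 2" "pauli2 * pauli2 = 1\<^sub>m 2" "pauli3 * pauli3 = 1\<^sub>m 2"
  "pauli1 * pauli2 + pauli2 * pauli1 = 0\<^sub>m 2 2" "pauli2 * pauli1 + pauli1 * pauli2 = 0\<^sub>m 2 2"
  "pauli1 * pauli3 + pauli3 * pauli1 = 0\<^sub>m 2 2" "pauli3 * pauli1 + pauli1 * pauli3 = 0\<^sub>m 2 2"
  "pauli2 * pauli3 + pauli3 * pauli2 = 0\<^sub>m 2 2" "pauli3 * pauli2 + pauli2 * pauli3 = 0\<^sub>m 2 2"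
  by - (rule mat_2_eqI; (intro carrier_matI)?; simp add: index_mult_mat_2 pauli_index carrier_matD[OF pauli_carrier(1)]
      carrier_matD[OF pauli_carrier(2)] carrier_matD[OF pauli_carrier(3)] add_carrier_mat)+

lemma gamma_carrier [simp]: "gamma m k \<in> carrier_mat (2 ^ m) (2 ^ m)"
proof (induction m arbitrary: k)
  case (Suc m)
  show ?case
    using kron_carrier[OF pauli_carrier(1) one_carrier_mat[of "2 ^ m"]]
      kron_carrier[OF pauli_carrier(2) one_carrier_mat[of "2 ^ m"]] kron_carrier[OF pauli_carrier(3) Suc[of "k - 2"]]
    by simp
qed simp

lemma gamma_dim [simp]: "dim_row (gamma m k) = 2 ^ m" "dim_col (gamma m k) = 2 ^ m"
  using carrier_matD[OF gamma_carrier[of m k]] by blast+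

lemma gamma_anticommute:
  "i < 2 * m \<Longrightarrow> j < 2 * m \<Longrightarrow>
    gamma m i * gamma m j + gamma m j * gamma m i = (if i = j then 2 else 0) \<cdot>\<^sub>m 1\<^sub>m (2 ^ m)"
proof (induction m arbitrary: i j)
  case (Suc m)
  let ?n = "2 ^ m :: nat"
  have mult: "kron P A * kron Q B = kron (P * Q) (A * B)"
    if "P \<in> carrier_mat 2 2" "Q \<in> carrier_mat 2 2" "A \<in> carrier_mat ?n ?n" "B \<in> carrier_mat ?n ?n"
    for P Q A B :: "complex mat"
    using that by (intro kron_mult[of _ 2 2 _ ?n ?n _ 2 _ ?n]) auto
  \<comment> \<open>Anticommuting first factors and commuting second factors: this settles all pairs
    of different kinds.\<close>
  have anti: "kron P A * kron Q A' + kron Q A' * kron P A = 0\<^sub>m (2 * ?n) (2 * ?n)"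
    if "P \<in> carrier_mat 2 2" "Q \<in> carrier_mat 2 2" "A \<in> carrier_mat ?n ?n" "A' \<in> carrier_mat ?n ?n"
      "P * Q + Q * P = 0\<^sub>m 2 2" "A * A' = A' * A" for P Q A A' :: "complex mat"
  proof -
    have "kron P A * kron Q A' + kron Q A' * kron P A = kron (P * Q) (A' * A) + kron (Q * P) (A' * A)"
      using mult[OF that(1-4)] mult[OF that(2,1,4,3)] that(6) by simp
    also have "\<dots> = kron (P * Q + Q * P) (A' * A)"
      by (rule kron_add_left[symmetric, OF mult_carrier_mat[OF that(1,2)] mult_carrier_mat[OF that(2,1)] mult_carrier_mat[OF that(4,3)]])
    finally show ?thesis
      unfolding that(5) using kron_zero_left[OF mult_carrier_mat[OF that(4,3)], of 2 2] by simp
  qed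
  have square: "kron P (1\<^sub>m ?n) * kron P (1\<^sub>m ?n) + kron P (1\<^sub>m ?n) * kron P (1\<^sub>m ?n) = 2 \<cdot>\<^sub>m 1\<^sub>m (2 * ?n)"
    if "P \<in> carrier_mat 2 2" "P * P = 1\<^sub>m 2" for P :: "complex mat"
    using mult[OF that(1,1) one_carrier_mat one_carrier_mat] that(2) by (auto simp: kron_one intro!: eq_matI)
  have zero: "0 \<cdot>\<^sub>m 1\<^sub>m (2 * ?n) = (0\<^sub>m (2 * ?n) (2 * ?n) :: complex mat)" by (intro eq_matI) auto
  have "i = 0 \<or> i = 1 \<or> i \<ge> 2" "j = 0 \<or> j = 1 \<or> j \<ge> 2" by linarith+
  then consider "i = 0" "j = 0" | "i = 1" "j = 1" | "i = 0" "j = 1" | "i = 1" "j = 0" | "i = 0" "j \<ge> 2" | "i = 1" "j \<ge> 2"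
    | "i \<ge> 2" "j = 0" | "i \<ge> 2" "j = 1" | "i \<ge> 2" "j \<ge> 2" by blast
  then show ?case
  proof cases
    case 9
    let ?A = "gamma m (i - 2)" and ?B = "gamma m (j - 2)"
    have "kron pauli3 ?A * kron pauli3 ?B + kron pauli3 ?B * kron pauli3 ?A = kron (1\<^sub>m 2) (?A * ?B) + kron (1\<^sub>m 2) (?B * ?A)"
      by (simp add: mult pauli_mult)
    also have "\<dots> = kron (1\<^sub>m 2) (?A * ?B + ?B * ?A)"
      by (rule kron_add_right[symmetric, OF one_carrier_mat mult_carrier_mat[OF gamma_carrier gamma_carrier] mult_carrier_mat[OF gamma_carrier gamma_carrier]])
    also have "?A * ?B + ?B * ?A = (if i - 2 = j - 2 then 2 else 0) \<cdot>\<^sub>m 1\<^sub>m ?n"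
      using Suc.prems 9 by (intro Suc.IH) auto
    also have "kron (1\<^sub>m 2) ((if i - 2 = j - 2 then 2 else 0) \<cdot>\<^sub>m 1\<^sub>m ?n) = (if i = j then 2 else 0) \<cdot>\<^sub>m (1\<^sub>m (2 * ?n) :: complex mat)"
      using 9 kron_smult_right[OF one_carrier_mat[of 2] one_carrier_mat[of ?n], of "if i - 2 = j - 2 then 2 else (0 :: complex)"]
        eq_diff_iff[of 2 i j] by (simp add: kron_one)
    finally show ?thesis using 9 by simp
  qed (simp_all add: square anti pauli_mult zero)
qed simp

lemma four_block_mat_inject:
  assumes "four_block_mat A B C D = four_block_mat A' B' C' D'"
    "A \<in> carrier_mat n n" "B \<in> carrier_mat n n" "C \<in> carrier_mat n n" "D \<in> carrier_mat n n"
    "A' \<in> carrier_mat n n" "B' \<in> carrier_mat n n" "C' \<in> carrier_mat n n" "D' \<in> carrier_mat n n"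
  shows "A = A'" "B = B'" "C = C'" "D = D'"
proof -
  have *: "four_block_mat A B C D $$ (i, j) = four_block_mat A' B' C' D' $$ (i, j)" for i j
    using assms(1) by simp
  show "A = A'"
  proof (rule eq_matI)
    fix i j assume "i < dim_row A'" "j < dim_col A'"
    then show "A $$ (i, j) = A' $$ (i, j)" using *[of i j] assms(2-) by auto
  qed (use assms(2-) in auto)
  show "B = B'"
  proof (rule eq_matI)
    fix i j assume "i < dim_row B'" "j < dim_col B'"
    then show "B $$ (i, j) = B' $$ (i, j)" using *[of i "j + n"] assms(2-) by auto
  qed (use assms(2-) in auto)
  show "C = C'"
  proof (rule eq_matI)
    fix i j assume "i < dim_row C'" "j < dim_col C'"
    then show "C $$ (i, j) = C' $$ (i, j)" using *[of "i + n" j] assms(2-) by auto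
  qed (use assms(2-) in auto)
  show "D = D'"
  proof (rule eq_matI)
    fix i j assume "i < dim_row D'" "j < dim_col D'"
    then show "D $$ (i, j) = D' $$ (i, j)" using *[of "i + n" "j + n"] assms(2-) by auto
  qed (use assms(2-) in auto)
qed

lemma kron_pauli:
  assumes "A \<in> carrier_mat n n"
  shows "kron pauli1 A = four_block_mat (0\<^sub>m n n) A A (0\<^sub>m n n)"
    "kron pauli2 A = four_block_mat (0\<^sub>m n n) (- \<i> \<cdot>\<^sub>m A) (\<i> \<cdot>\<^sub>m A) (0\<^sub>m n n)"
    "kron pauli3 A = four_block_mat A (0\<^sub>m n n) (0\<^sub>m n n) (- 1 \<cdot>\<^sub>m A)"
proof -
  have lt: "i div n = 0 \<longleftrightarrow> i < n" "i div n = Suc 0 \<longleftrightarrow> \<not> i < n" "\<not> i < n \<Longrightarrow> i mod n = i - n" if "i < 2 * n" for i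
  proof -
    show "i div n = 0 \<longleftrightarrow> i < n" using that by (auto simp: div_eq_0_iff)
    have "i div n < 2" using that by (simp add: less_mult_imp_div_less)
    then show "i div n = Suc 0 \<longleftrightarrow> \<not> i < n" using \<open>i div n = 0 \<longleftrightarrow> i < n\<close> by auto
    show "\<not> i < n \<Longrightarrow> i mod n = i - n" using that by (simp add: mod_if)
  qed
  have d: "i div n = (if i < n then 0 else Suc 0)" "i mod n = (if i < n then i else i - n)" if "i < 2 * n" for i
    using lt[OF that] by auto
  have "kron P A $$ (i, j) = P $$ (if i < n then 0 else Suc 0, if j < n then 0 else Suc 0) *
      A $$ (if i < n then i else i - n, if j < n then j else j - n)"
    if "i < 2 * n" "j < 2 * n" "P \<in> carrier_mat 2 2" for P i j
    unfolding kron_index[OF that(3) assms that(1,2)] d[OF that(1)] d[OF that(2)] ..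
  note k = this[OF _ _ pauli_carrier(1)] this[OF _ _ pauli_carrier(2)] this[OF _ _ pauli_carrier(3)]
  have dims: "dim_row (kron P A) = 2 * n" "dim_col (kron P A) = 2 * n" if "P \<in> carrier_mat 2 2" for P
    using that assms by (auto simp: kron_def)
  note dims = dims[OF pauli_carrier(1)] dims[OF pauli_carrier(2)] dims[OF pauli_carrier(3)]
  show "kron pauli1 A = four_block_mat (0\<^sub>m n n) A A (0\<^sub>m n n)"
    by (rule eq_matI) (use assms in \<open>auto simp: k dims pauli_index mult_2\<close>)
  show "kron pauli2 A = four_block_mat (0\<^sub>m n n) (- \<i> \<cdot>\<^sub>m A) (\<i> \<cdot>\<^sub>m A) (0\<^sub>m n n)"
    by (rule eq_matI) (use assms in \<open>auto simp: k dims pauli_index mult_2\<close>)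
  show "kron pauli3 A = four_block_mat A (0\<^sub>m n n) (0\<^sub>m n n) (- 1 \<cdot>\<^sub>m A)"
    by (rule eq_matI) (use assms in \<open>auto simp: k dims pauli_index mult_2\<close>)
qed

text \<open>In two by two blocks, commuting with the first generator forces \<open>A = D\<close> and
  \<open>B = C\<close>, with the second \<open>B = - C\<close>. The remaining generators contain
  \<open>pauli3\<close> and make \<open>A\<close> commute with those of the smaller module.\<close>

lemma gamma_schur:
  "V \<in> carrier_mat (2 ^ m) (2 ^ m) \<Longrightarrow> (\<And>k. k < 2 * m \<Longrightarrow> V * gamma m k = gamma m k * V) \<Longrightarrow>
    \<exists>c. V = c \<cdot>\<^sub>m 1\<^sub>m (2 ^ m)"
proof (induction m arbitrary: V)
  case 0
  then show ?case by (intro exI[of _ "V $$ (0, 0)"] eq_matI) auto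
next
  case (Suc m)
  let ?n = "2 ^ m :: nat"
  obtain A B C D where split: "split_block V ?n ?n = (A, B, C, D)" by (metis prod_cases4)
  have c: "A \<in> carrier_mat ?n ?n" "B \<in> carrier_mat ?n ?n" "C \<in> carrier_mat ?n ?n" "D \<in> carrier_mat ?n ?n"
    and V: "V = four_block_mat A B C D"
    using split_block[OF split, of ?n ?n] Suc.prems(1) by (auto simp: mult_2)
  note cs = smult_carrier_mat[OF one_carrier_mat[of ?n], of "- \<i>"] smult_carrier_mat[OF one_carrier_mat[of ?n], of "\<i>"]
  have 1: "V * kron pauli1 (1\<^sub>m ?n) = four_block_mat B A D C" "kron pauli1 (1\<^sub>m ?n) * V = four_block_mat C D A B"
    unfolding V kron_pauli(1)[OF one_carrier_mat]
    using c by (simp_all add: mult_four_block_mat[OF c zero_carrier_mat one_carrier_mat one_carrier_mat zero_carrier_mat]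
        mult_four_block_mat[OF zero_carrier_mat one_carrier_mat one_carrier_mat zero_carrier_mat c])
  have "four_block_mat B A D C = four_block_mat C D A B"
    using Suc.prems(2)[of 0] 1 by simp
  then have AD: "A = D" "B = C"
    using four_block_mat_inject[OF _ c(2,1,4,3) c(3,4,1,2)] by blast+
  have 2: "V * kron pauli2 (1\<^sub>m ?n) = four_block_mat (\<i> \<cdot>\<^sub>m B) (- \<i> \<cdot>\<^sub>m A) (\<i> \<cdot>\<^sub>m D) (- \<i> \<cdot>\<^sub>m C)"
    "kron pauli2 (1\<^sub>m ?n) * V = four_block_mat (- \<i> \<cdot>\<^sub>m C) (- \<i> \<cdot>\<^sub>m D) (\<i> \<cdot>\<^sub>m A) (\<i> \<cdot>\<^sub>m B)"
    unfolding V kron_pauli(2)[OF one_carrier_mat]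
    using c by (simp_all add: mult_four_block_mat[OF c zero_carrier_mat cs zero_carrier_mat]
        mult_four_block_mat[OF zero_carrier_mat cs zero_carrier_mat c] mult_smult_distrib[OF _ one_carrier_mat]
        mult_smult_assoc_mat[OF one_carrier_mat])
  have "four_block_mat (\<i> \<cdot>\<^sub>m B) (- \<i> \<cdot>\<^sub>m A) (\<i> \<cdot>\<^sub>m D) (- \<i> \<cdot>\<^sub>m C) =
      four_block_mat (- \<i> \<cdot>\<^sub>m C) (- \<i> \<cdot>\<^sub>m D) (\<i> \<cdot>\<^sub>m A) (\<i> \<cdot>\<^sub>m B)"
    using Suc.prems(2)[of 1] 2 by simp
  from four_block_mat_inject(1)[OF this, of ?n] have BC: "\<i> \<cdot>\<^sub>m B = - \<i> \<cdot>\<^sub>m C" using c by simp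
  have B0: "B = 0\<^sub>m ?n ?n"
  proof (rule eq_matI)
    fix i j assume "i < dim_row (0\<^sub>m ?n ?n :: complex mat)" "j < dim_col (0\<^sub>m ?n ?n :: complex mat)"
    then show "B $$ (i, j) = 0\<^sub>m ?n ?n $$ (i, j)"
      using arg_cong[OF BC, of "\<lambda>X. X $$ (i, j)"] c AD(2) by (auto simp: eq_neg_iff_add_eq_0)
  qed (use c in auto)
  have V': "V = four_block_mat A (0\<^sub>m ?n ?n) (0\<^sub>m ?n ?n) A" using V AD B0 by simp
  have "A * gamma m k = gamma m k * A" if "k < 2 * m" for k
  proof -
    let ?g = "gamma m k"
    have c3: "?g \<in> carrier_mat ?n ?n" "- 1 \<cdot>\<^sub>m ?g \<in> carrier_mat ?n ?n" by auto
    have "V * kron pauli3 ?g = kron pauli3 ?g * V" using Suc.prems(2)[of "k + 2"] that by simp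
    then have "four_block_mat (A * ?g) (0\<^sub>m ?n ?n) (0\<^sub>m ?n ?n) (A * (- 1 \<cdot>\<^sub>m ?g)) =
      four_block_mat (?g * A) (0\<^sub>m ?n ?n) (0\<^sub>m ?n ?n) ((- 1 \<cdot>\<^sub>m ?g) * A)"
      unfolding V' kron_pauli(3)[OF c3(1)] using c c3
      by (simp add: mult_four_block_mat[OF c(1) zero_carrier_mat zero_carrier_mat c(1) c3(1) zero_carrier_mat zero_carrier_mat c3(2)]
          mult_four_block_mat[OF c3(1) zero_carrier_mat zero_carrier_mat c3(2) c(1) zero_carrier_mat zero_carrier_mat c(1)]
          mult_carrier_mat[OF c(1) c3(1)] mult_carrier_mat[OF c3(1) c(1)] mult_carrier_mat[OF c(1) c3(2)] mult_carrier_mat[OF c3(2) c(1)])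
    from four_block_mat_inject(1)[OF this, of ?n] show ?thesis
      using mult_carrier_mat[OF c(1) c3(1)] mult_carrier_mat[OF c3(1) c(1)] mult_carrier_mat[OF c(1) c3(2)] mult_carrier_mat[OF c3(2) c(1)]
      by auto
  qed
  from Suc.IH[OF c(1) this] obtain s where s: "A = s \<cdot>\<^sub>m 1\<^sub>m ?n" by blast
  have "V = s \<cdot>\<^sub>m 1\<^sub>m (2 ^ Suc m)" unfolding V' s by (rule eq_matI) (auto simp: mult_2)
  then show ?case by blast
qed

lemma clifford_gen_carrier [simp]: "clifford_gen n k \<in> carrier_mat (spinor_dim n) (spinor_dim n)"
  by (simp add: clifford_gen_def spinor_dim_def)

lemma clifford_gen_dim [simp]: "dim_row (clifford_gen n k) = spinor_dim n" "dim_col (clifford_gen n k) = spinor_dim n"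
  using carrier_matD[OF clifford_gen_carrier[of n k]] by blast+

lemma clifford_gen_anticommute:
  assumes "even n" "i < n" "j < n"
  shows "clifford_gen n i * clifford_gen n j + clifford_gen n j * clifford_gen n i =
    (if i = j then - 2 else 0) \<cdot>\<^sub>m 1\<^sub>m (spinor_dim n)"
proof -
  let ?m = "n div 2"
  have ij: "i < 2 * ?m" "j < 2 * ?m" using assms by auto
  have sq: "clifford_gen n i * clifford_gen n j = - 1 \<cdot>\<^sub>m (gamma ?m i * gamma ?m j)" for i j
    unfolding clifford_gen_def mult_smult_assoc_mat[OF gamma_carrier smult_carrier_mat[OF gamma_carrier]]
      mult_smult_distrib[OF gamma_carrier gamma_carrier] by (intro eq_matI) (auto simp flip: mult.assoc)
  have "clifford_gen n i * clifford_gen n j + clifford_gen n j * clifford_gen n i =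
      - 1 \<cdot>\<^sub>m (gamma ?m i * gamma ?m j + gamma ?m j * gamma ?m i)"
    unfolding sq using mult_carrier_mat[OF gamma_carrier[of ?m i] gamma_carrier[of ?m j]] mult_carrier_mat[OF gamma_carrier[of ?m j] gamma_carrier[of ?m i]]
    by (intro eq_matI) auto
  then show ?thesis unfolding gamma_anticommute[OF ij] by (auto simp: spinor_dim_def intro!: eq_matI)
qed

lemma clifford_gen_schur:
  assumes "even n" "V \<in> carrier_mat (spinor_dim n) (spinor_dim n)"
    "\<And>k. k < n \<Longrightarrow> V * clifford_gen n k = clifford_gen n k * V"
  shows "\<exists>c. V = c \<cdot>\<^sub>m 1\<^sub>m (spinor_dim n)"
proof -
  let ?m = "n div 2"
  have V: "V \<in> carrier_mat (2 ^ ?m) (2 ^ ?m)" using assms(2) by (simp add: spinor_dim_def)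
  have "V * gamma ?m k = gamma ?m k * V" if "k < 2 * ?m" for k
  proof -
    have "\<i> \<cdot>\<^sub>m (V * gamma ?m k) = \<i> \<cdot>\<^sub>m (gamma ?m k * V)"
      using assms(3)[of k] that
      by (simp add: clifford_gen_def mult_smult_assoc_mat[OF gamma_carrier V] mult_smult_distrib[OF V gamma_carrier])
    then have eq: "(\<i> \<cdot>\<^sub>m (V * gamma ?m k)) $$ (r, s) = (\<i> \<cdot>\<^sub>m (gamma ?m k * V)) $$ (r, s)" for r s by simp
    show ?thesis
    proof (rule eq_matI)
      fix r s assume "r < dim_row (gamma ?m k * V)" "s < dim_col (gamma ?m k * V)"
      then show "(V * gamma ?m k) $$ (r, s) = (gamma ?m k * V) $$ (r, s)"
        using eq[of r s] V mult_carrier_mat[OF gamma_carrier[of ?m k] V] mult_carrier_mat[OF V gamma_carrier[of ?m k]] by auto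
    qed (use V carrier_matD[OF gamma_carrier[of ?m k]] in auto)
  qed
  from gamma_schur[OF V this] show ?thesis by (simp add: spinor_dim_def)
qed

section \<open>Clifford multiplication by vectors and the Spin group\<close>

lemma clifford_carrier [simp]: "clifford n v \<in> carrier_mat (spinor_dim n) (spinor_dim n)"
  by (simp add: clifford_def)

lemma clifford_dim [simp]: "dim_row (clifford n v) = spinor_dim n" "dim_col (clifford n v) = spinor_dim n"
  by (simp_all add: clifford_def)

lemma clifford_eq_lincomb:
  "clifford n v = lincomb (spinor_dim n) (spinor_dim n) n (\<lambda>k. of_real (v $ k)) (clifford_gen n)"
  by (simp add: clifford_def lincomb_def)

lemma clifford_unit_vec: "j < n \<Longrightarrow> clifford n (unit_vec n j) = clifford_gen n j"
proof -
  assume j: "j < n"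
  have "clifford n (unit_vec n j) = lincomb (spinor_dim n) (spinor_dim n) n (\<lambda>k. if k = j then 1 else 0) (clifford_gen n)"
    unfolding clifford_eq_lincomb using j by (intro lincomb_cong) (auto simp: unit_vec_def)
  also have "\<dots> = clifford_gen n j" using j by (intro lincomb_delta) auto
  finally show ?thesis .
qed

lemma clifford_square:
  assumes "even n" "v \<in> carrier_vec n" "(v :: real Matrix.vec) \<bullet> v = 1"
  shows "clifford n v * clifford n v = - 1 \<cdot>\<^sub>m 1\<^sub>m (spinor_dim n)"
proof -
  let ?D = "spinor_dim n" and ?g = "clifford_gen n" and ?v = "\<lambda>k. complex_of_real (v $ k)"
  have "clifford n v * clifford n v = lincomb ?D ?D n ?v (\<lambda>k. ?g k * clifford n v)"
    by (subst (1) clifford_eq_lincomb) (rule lincomb_mult_right; simp)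
  also have "\<dots> = lincomb ?D ?D n ?v (\<lambda>k. lincomb ?D ?D n ?v (\<lambda>l. ?g k * ?g l))"
    unfolding clifford_eq_lincomb by (intro lincomb_cong lincomb_mult_left[of _ _ ?D]) auto
  finally have 1: "clifford n v * clifford n v = \<dots>" .
  show ?thesis
  proof (rule eq_matI)
    fix r s assume "r < dim_row (- 1 \<cdot>\<^sub>m 1\<^sub>m ?D :: complex mat)" "s < dim_col (- 1 \<cdot>\<^sub>m 1\<^sub>m ?D :: complex mat)"
    then have rs: "r < ?D" "s < ?D" by auto
    define X where "X = (\<Sum>k<n. \<Sum>l<n. ?v k * ?v l * (?g k * ?g l) $$ (r, s))"
    have "(clifford n v * clifford n v) $$ (r, s) = X"
      unfolding 1 X_def using rs by (simp add: sum_distrib_left mult.assoc)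
    \<comment> \<open>Doubling symmetrizes the sum, so that only anticommutators of generators
      occur.\<close>
    moreover have "X + X = (\<Sum>k<n. \<Sum>l<n. ?v k * ?v l * ((?g k * ?g l) $$ (r, s) + (?g l * ?g k) $$ (r, s)))"
    proof -
      have "X = (\<Sum>k<n. \<Sum>l<n. ?v k * ?v l * (?g l * ?g k) $$ (r, s))"
        unfolding X_def by (subst sum.swap) (simp add: mult.commute)
      then have "X + X = X + (\<Sum>k<n. \<Sum>l<n. ?v k * ?v l * (?g l * ?g k) $$ (r, s))" by simp
      then show ?thesis unfolding X_def by (simp add: sum.distrib distrib_left)
    qed
    moreover have "\<dots> = (\<Sum>k<n. \<Sum>l<n. if k = l then ?v k * ?v l * (if r = s then - 2 else 0) else 0)"
    proof (intro sum.cong refl)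
      fix k l assume "k \<in> {..<n}" "l \<in> {..<n}"
      then have "(?g k * ?g l + ?g l * ?g k) $$ (r, s) = ((if k = l then - 2 else 0) \<cdot>\<^sub>m 1\<^sub>m ?D) $$ (r, s)"
        using clifford_gen_anticommute[OF assms(1)] by auto
      then have "(?g k * ?g l) $$ (r, s) + (?g l * ?g k) $$ (r, s) = (if k = l then (if r = s then - 2 else 0) else 0)"
        using rs carrier_matD[OF mult_carrier_mat[OF clifford_gen_carrier[of n l] clifford_gen_carrier[of n k]]] by auto
      then show "?v k * ?v l * ((?g k * ?g l) $$ (r, s) + (?g l * ?g k) $$ (r, s)) =
        (if k = l then ?v k * ?v l * (if r = s then - 2 else 0) else 0)" by simp
    qed
    moreover have "\<dots> = (\<Sum>k<n. ?v k * ?v k) * (if r = s then - 2 else 0)"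
      by (simp add: sum_distrib_right)
    moreover have "(\<Sum>k<n. ?v k * ?v k) = complex_of_real ((v :: real Matrix.vec) \<bullet> v)"
      using assms(2) by (simp add: scalar_prod_def atLeast0LessThan)
    ultimately show "(clifford n v * clifford n v) $$ (r, s) = (- 1 \<cdot>\<^sub>m 1\<^sub>m ?D) $$ (r, s)"
      using rs assms(3) by (auto simp flip: mult_2)
  qed auto
qed

lemma Spin_invertible:
  assumes "even n" "a \<in> Spin n"
  shows "a \<in> carrier_mat (spinor_dim n) (spinor_dim n) \<and>
    (\<exists>b\<in>carrier_mat (spinor_dim n) (spinor_dim n). a * b = 1\<^sub>m (spinor_dim n) \<and> b * a = 1\<^sub>m (spinor_dim n))"
  using assms(2)
proof (induction rule: Spin.induct)
  case one
  then show ?case by auto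
next
  case (mult a v w)
  let ?D = "spinor_dim n"
  \<comment> \<open>If \<open>b\<close> inverts \<open>a\<close>, then \<open>- c * b\<close>
    inverts \<open>a * c\<close>, because \<open>c\<close> has square -1.\<close>
  have inv: "\<exists>b'\<in>carrier_mat ?D ?D. (a * c) * b' = 1\<^sub>m ?D \<and> b' * (a * c) = 1\<^sub>m ?D"
    if asm: "a \<in> carrier_mat ?D ?D" "c \<in> carrier_mat ?D ?D" "c * c = - 1 \<cdot>\<^sub>m 1\<^sub>m ?D"
      "\<exists>b\<in>carrier_mat ?D ?D. a * b = 1\<^sub>m ?D \<and> b * a = 1\<^sub>m ?D" for a c :: "complex mat"
  proof -
    obtain b where b: "b \<in> carrier_mat ?D ?D" "a * b = 1\<^sub>m ?D" "b * a = 1\<^sub>m ?D" using asm(4) by blast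
    have cb: "- 1 \<cdot>\<^sub>m (c * b) \<in> carrier_mat ?D ?D" using asm(2) b(1) by simp
    have sm: "- 1 \<cdot>\<^sub>m (- 1 \<cdot>\<^sub>m A) = A" for A :: "complex mat" by (intro eq_matI) auto
    have "(a * c) * (- 1 \<cdot>\<^sub>m (c * b)) = - 1 \<cdot>\<^sub>m ((a * c) * (c * b))"
      by (rule mult_smult_distrib[OF mult_carrier_mat[OF asm(1,2)] mult_carrier_mat[OF asm(2) b(1)]])
    also have "(a * c) * (c * b) = a * (c * (c * b))" by (rule assoc_mult_mat[OF asm(1,2) mult_carrier_mat[OF asm(2) b(1)]])
    also have "c * (c * b) = (c * c) * b" by (rule assoc_mult_mat[symmetric, OF asm(2,2) b(1)])
    also have "\<dots> = - 1 \<cdot>\<^sub>m b" unfolding asm(3) mult_smult_assoc_mat[OF one_carrier_mat b(1)] left_mult_one_mat[OF b(1)] ..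
    also have "a * (- 1 \<cdot>\<^sub>m b) = - 1 \<cdot>\<^sub>m 1\<^sub>m ?D" unfolding mult_smult_distrib[OF asm(1) b(1)] b(2) ..
    finally have 1: "(a * c) * (- 1 \<cdot>\<^sub>m (c * b)) = 1\<^sub>m ?D" unfolding sm .
    have "(- 1 \<cdot>\<^sub>m (c * b)) * (a * c) = - 1 \<cdot>\<^sub>m ((c * b) * (a * c))"
      by (rule mult_smult_assoc_mat[OF mult_carrier_mat[OF asm(2) b(1)] mult_carrier_mat[OF asm(1,2)]])
    also have "(c * b) * (a * c) = c * (b * (a * c))" by (rule assoc_mult_mat[OF asm(2) b(1) mult_carrier_mat[OF asm(1,2)]])
    also have "b * (a * c) = (b * a) * c" by (rule assoc_mult_mat[symmetric, OF b(1) asm(1,2)])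
    also have "c * ((b * a) * c) = - 1 \<cdot>\<^sub>m 1\<^sub>m ?D" unfolding b(3) left_mult_one_mat[OF asm(2)] by (rule asm(3))
    finally have 2: "(- 1 \<cdot>\<^sub>m (c * b)) * (a * c) = 1\<^sub>m ?D" unfolding sm .
    show ?thesis using 1 2 cb by blast
  qed
  have a: "a \<in> carrier_mat ?D ?D" "\<exists>b\<in>carrier_mat ?D ?D. a * b = 1\<^sub>m ?D \<and> b * a = 1\<^sub>m ?D" using mult.IH by auto
  note av = mult_carrier_mat[OF a(1) clifford_carrier[of n v]]
  note v = inv[OF a(1) clifford_carrier clifford_square[OF assms(1) mult.hyps(2,3)] a(2)]
  show ?case
    using inv[OF av clifford_carrier clifford_square[OF assms(1) mult.hyps(4,5)] v]
      mult_carrier_mat[OF av clifford_carrier[of n w]] by blast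
qed

lemma spin_covers_rel:
  assumes "spin_covers n a A" "j < n" "even n"
  shows "a * clifford_gen n j = lincomb (spinor_dim n) (spinor_dim n) n (\<lambda>i. of_real (A $$ (i, j))) (\<lambda>i. clifford_gen n i * a)"
proof -
  have A: "A \<in> carrier_mat n n" and a: "a \<in> carrier_mat (spinor_dim n) (spinor_dim n)"
    using assms Spin_invertible[OF assms(3)] by (auto simp: spin_covers_def SO_def)
  have "a * clifford n (unit_vec n j) = clifford n (A *\<^sub>v unit_vec n j) * a"
    using assms by (simp add: spin_covers_def)
  also have "clifford n (A *\<^sub>v unit_vec n j) = lincomb (spinor_dim n) (spinor_dim n) n (\<lambda>i. of_real (A $$ (i, j))) (clifford_gen n)"
    unfolding clifford_eq_lincomb using A assms(2) by (intro lincomb_cong) auto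
  also have "\<dots> * a = lincomb (spinor_dim n) (spinor_dim n) n (\<lambda>i. of_real (A $$ (i, j))) (\<lambda>i. clifford_gen n i * a)"
    using a by (intro lincomb_mult_right) auto
  finally show ?thesis using clifford_unit_vec[OF assms(2)] by simp
qed

section \<open>Creation and annihilation operators\<close>

text \<open>Levels are shifted by one, so that the level below the zeroth exterior power, with empty basis, is
  included and the anticommutation relations need no special case.\<close>

definition ext_level :: "nat \<Rightarrow> nat \<Rightarrow> nat list list" where
  "ext_level N k = (case k of 0 \<Rightarrow> [] | Suc m \<Rightarrow> ext_basis N m)"

definition level_sets :: "nat \<Rightarrow> nat \<Rightarrow> nat set set" where
  "level_sets N k = (case k of 0 \<Rightarrow> {} | Suc m \<Rightarrow> {K. K \<subseteq> {..<N} \<and> card K = m})"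

lemma level_sets_simps [simp]: "level_sets N 0 = {}"
  "K \<in> level_sets N (Suc m) \<longleftrightarrow> K \<subseteq> {..<N} \<and> card K = m"
  by (simp_all add: level_sets_def)

lemma finite_level_sets [simp]: "finite (level_sets N k)"
  by (cases k) (auto simp: level_sets_def intro: finite_subset[of _ "Pow {..<N}"])

lemma level_sets_finite: "K \<in> level_sets N k \<Longrightarrow> finite K"
  by (cases k) (auto intro: finite_subset)

text \<open>Turns sums over positions in the basis into sums over subsets, on which creation
  operators have a simple description.\<close>

lemma bij_ext_level: "bij_betw (\<lambda>p. set (ext_level N k ! p)) {..<length (ext_level N k)} (level_sets N k)"
proof (cases k)
  case 0
  then show ?thesis by (simp add: ext_level_def bij_betw_def)
next
  case (Suc m)
  let ?B = "ext_basis N m"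
  have d: "distinct (map set (subseqs [0..<N]))" by (intro distinct_set_subseqs) simp
  then have d': "distinct (map set ?B)"
    unfolding ext_basis_def by (metis distinct_map distinct_filter filter_is_subset inj_on_subset)
  have inj: "inj_on (\<lambda>p. set (?B ! p)) {..<length ?B}"
  proof (rule inj_onI)
    fix p q assume pq: "p \<in> {..<length ?B}" "q \<in> {..<length ?B}" "set (?B ! p) = set (?B ! q)"
    then have "map set ?B ! p = map set ?B ! q" by simp
    then show "p = q" using nth_eq_iff_index_eq[OF d', of p q] pq by simp
  qed
  have "(\<lambda>p. set (?B ! p)) ` {..<length ?B} = set ` set ?B"
    by (auto simp: set_conv_nth image_iff)
  also have "\<dots> = level_sets N k"
  proof
    show "set ` set ?B \<subseteq> level_sets N k"
    proof
      fix K assume "K \<in> set ` set ?B"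
      then obtain I where I: "K = set I" "I \<in> set ?B" by auto
      then obtain p where p: "p < length ?B" "I = ?B ! p" by (metis in_set_conv_nth)
      have "distinct I" using ext_basis_nth(3)[OF p(1)] p(2) by (simp add: strict_sorted_iff)
      then show "K \<in> level_sets N k"
        using ext_basis_nth(1,2)[OF p(1)] I p Suc by (auto simp: distinct_card)
    qed
    show "level_sets N k \<subseteq> set ` set ?B"
    proof
      fix K assume "K \<in> level_sets N k"
      then have K: "K \<subseteq> {..<N}" "card K = m" using Suc by auto
      then obtain I where I: "K = set I" "I \<in> set (subseqs [0..<N])"
        using subset_subseqs[of K "[0..<N]"] by (auto simp: atLeast0LessThan)
      then have "sorted_wrt (<) I" by (auto intro: sorted_wrt_subseq[OF _ sorted_wrt_upt])
      then have "length I = m" using K I by (simp add: strict_sorted_iff distinct_card)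
      then show "K \<in> set ` set ?B" using I by (auto simp: ext_basis_def)
    qed
  qed
  finally show ?thesis using inj Suc by (simp add: bij_betw_def ext_level_def)
qed

lemma ext_level_set: "p < length (ext_level N k) \<Longrightarrow> set (ext_level N k ! p) \<in> level_sets N k"
  using bij_betwE[OF bij_ext_level] by auto

lemma ext_level_inj: "p < length (ext_level N k) \<Longrightarrow> q < length (ext_level N k) \<Longrightarrow>
    set (ext_level N k ! p) = set (ext_level N k ! q) \<longleftrightarrow> p = q"
  using bij_ext_level[of N k] by (auto simp: bij_betw_def inj_on_def)

lemma sum_ext_level: "(\<Sum>p<length (ext_level N k). f (set (ext_level N k ! p))) = (\<Sum>K\<in>level_sets N k. f K)"
  by (rule sum.reindex_bij_betw[OF bij_ext_level])

text \<open>The sign picked up when the basis vector \<open>j\<close>, multiplied from the left, is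
  sorted into the monomial of \<open>K\<close>.\<close>

definition wedge_sign :: "nat \<Rightarrow> nat set \<Rightarrow> complex" where
  "wedge_sign j K = (- 1) ^ card {m \<in> K. m < j}"

lemma wedge_sign_insert:
  assumes "finite K" "i \<notin> K" "i \<noteq> j"
  shows "wedge_sign j (insert i K) = (if i < j then - 1 else 1) * wedge_sign j K"
proof -
  have "{m \<in> insert i K. m < j} = (if i < j then insert i {m \<in> K. m < j} else {m \<in> K. m < j})" by auto
  then show ?thesis using assms by (simp add: wedge_sign_def)
qed

lemma wedge_sign_square [simp]: "wedge_sign j K * wedge_sign j K = 1"
  by (simp add: wedge_sign_def flip: power_mult_distrib)

definition creation_coeff :: "nat \<Rightarrow> nat set \<Rightarrow> nat set \<Rightarrow> complex" where
  "creation_coeff j I K = (if j \<notin> K \<and> I = insert j K then wedge_sign j K else 0)"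

definition creation :: "nat \<Rightarrow> nat \<Rightarrow> nat \<Rightarrow> complex mat" where
  "creation N k j = mat (length (ext_level N (Suc k))) (length (ext_level N k))
     (\<lambda>(p, q). creation_coeff j (set (ext_level N (Suc k) ! p)) (set (ext_level N k ! q)))"

text \<open>Indexed by its target level, which makes it the transpose of
  \<open>creation N k j\<close>.\<close>

definition annihilation :: "nat \<Rightarrow> nat \<Rightarrow> nat \<Rightarrow> complex mat" where
  "annihilation N k j = mat (length (ext_level N k)) (length (ext_level N (Suc k)))
     (\<lambda>(p, q). creation_coeff j (set (ext_level N (Suc k) ! q)) (set (ext_level N k ! p)))"

lemma creation_carrier [simp]:
  "creation N k j \<in> carrier_mat (length (ext_level N (Suc k))) (length (ext_level N k))"
  "annihilation N k j \<in> carrier_mat (length (ext_level N k)) (length (ext_level N (Suc k)))"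
  and creation_dim [simp]: "dim_row (creation N k j) = length (ext_level N (Suc k))"
  "dim_col (creation N k j) = length (ext_level N k)"
  "dim_row (annihilation N k j) = length (ext_level N k)"
  "dim_col (annihilation N k j) = length (ext_level N (Suc k))"
  by (simp_all add: creation_def annihilation_def)

lemma sum_creation_left:
  assumes "j < N" "J \<in> level_sets N k"
  shows "(\<Sum>K\<in>level_sets N (Suc k). f K * creation_coeff j K J) =
    (if j \<notin> J then f (insert j J) * wedge_sign j J else 0)"
proof (cases "j \<in> J")
  case True
  then show ?thesis by (simp add: creation_coeff_def)
next
  case False
  have mem: "insert j J \<in> level_sets N (Suc k)"
    using assms False level_sets_finite[OF assms(2)] by (cases k) auto
  have "(\<Sum>K\<in>level_sets N (Suc k). f K * creation_coeff j K J) =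
    (\<Sum>K\<in>level_sets N (Suc k). if K = insert j J then f (insert j J) * wedge_sign j J else 0)"
    using False by (intro sum.cong) (auto simp: creation_coeff_def)
  then show ?thesis using mem False by simp
qed

lemma sum_creation_right:
  assumes "I \<in> level_sets N (Suc (Suc k))"
  shows "(\<Sum>L\<in>level_sets N (Suc k). creation_coeff i I L * f L) =
    (if i \<in> I then wedge_sign i (I - {i}) * f (I - {i}) else 0)"
proof (cases "i \<in> I")
  case False
  then show ?thesis by (auto simp: creation_coeff_def intro!: sum.neutral)
next
  case True
  have mem: "I - {i} \<in> level_sets N (Suc k)"
    using assms True level_sets_finite[OF assms] by auto
  have "(\<Sum>L\<in>level_sets N (Suc k). creation_coeff i I L * f L) =
    (\<Sum>L\<in>level_sets N (Suc k). if L = I - {i} then wedge_sign i (I - {i}) * f (I - {i}) else 0)"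
    using True by (intro sum.cong) (auto simp: creation_coeff_def)
  then show ?thesis using mem True by simp
qed

text \<open>The canonical anticommutation relation. Both products connect \<open>Q\<close> with
  \<open>P\<close> under the same condition; for different \<open>i\<close> and \<open>j\<close> the
  order of the two operations changes exactly one sign.\<close>

lemma annihilation_creation:
  assumes "i < N" "j < N"
  shows "annihilation N (Suc k) i * creation N (Suc k) j + creation N k j * annihilation N k i =
    (if i = j then 1 else 0) \<cdot>\<^sub>m 1\<^sub>m (length (ext_level N (Suc k)))"
proof (rule eq_matI)
  let ?L = "length (ext_level N (Suc k))"
  fix p q assume "p < dim_row ((if i = j then 1 else 0) \<cdot>\<^sub>m 1\<^sub>m ?L :: complex mat)"
    "q < dim_col ((if i = j then 1 else 0) \<cdot>\<^sub>m 1\<^sub>m ?L :: complex mat)"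
  then have pq: "p < ?L" "q < ?L" by auto
  define P Q where "P = set (ext_level N (Suc k) ! p)" and "Q = set (ext_level N (Suc k) ! q)"
  have mem: "P \<in> level_sets N (Suc k)" "Q \<in> level_sets N (Suc k)"
    unfolding P_def Q_def by (simp_all only: ext_level_set[OF pq(1)] ext_level_set[OF pq(2)])
  note fin = level_sets_finite[OF mem(1)] level_sets_finite[OF mem(2)]
  have 1: "(annihilation N (Suc k) i * creation N (Suc k) j) $$ (p, q) =
      (\<Sum>K\<in>level_sets N (Suc (Suc k)). creation_coeff i K P * creation_coeff j K Q)"
    unfolding index_mult_mat_sum[OF creation_carrier(2) creation_carrier(1) pq] P_def Q_def
      sum_ext_level[symmetric] using pq by (simp add: annihilation_def creation_def)
  have 2: "(creation N k j * annihilation N k i) $$ (p, q) =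
      (\<Sum>K\<in>level_sets N k. creation_coeff j P K * creation_coeff i Q K)"
    unfolding index_mult_mat_sum[OF creation_carrier(1) creation_carrier(2) pq] P_def Q_def
      sum_ext_level[symmetric] using pq by (simp add: annihilation_def creation_def)
  have 3: "(\<Sum>K\<in>level_sets N (Suc (Suc k)). creation_coeff i K P * creation_coeff j K Q) =
     (if j \<notin> Q \<and> i \<notin> P \<and> insert j Q = insert i P then wedge_sign i P * wedge_sign j Q else 0)"
    by (subst sum_creation_left[OF assms(2) mem(2)]) (auto simp: creation_coeff_def)
  have 4: "(\<Sum>K\<in>level_sets N k. creation_coeff j P K * creation_coeff i Q K) =
     (if j \<in> P \<and> i \<in> Q \<and> P - {j} = Q - {i} then wedge_sign j (P - {j}) * wedge_sign i (Q - {i}) else 0)"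
  proof (cases k)
    case 0
    then have "P = {}" using mem fin by auto
    then show ?thesis using 0 by simp
  next
    case (Suc k')
    show ?thesis unfolding Suc
      by (subst sum_creation_right) (use mem Suc in \<open>auto simp: creation_coeff_def\<close>)
  qed
  have "(if j \<notin> Q \<and> i \<notin> P \<and> insert j Q = insert i P then wedge_sign i P * wedge_sign j Q else 0) +
     (if j \<in> P \<and> i \<in> Q \<and> P - {j} = Q - {i} then wedge_sign j (P - {j}) * wedge_sign i (Q - {i}) else 0) =
     (if i = j \<and> P = Q then 1 else 0)"
  proof (cases "i = j")
    case True
    show ?thesis
    proof (cases "j \<in> P \<longleftrightarrow> j \<in> Q")
      case same: True
      have "insert j Q = insert j P \<longleftrightarrow> P = Q" if "j \<notin> P" "j \<notin> Q" using that by auto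
      moreover have "P - {j} = Q - {j} \<longleftrightarrow> P = Q" if "j \<in> P" "j \<in> Q" using that by auto
      ultimately show ?thesis using True same by auto
    qed (use True in auto)
  next
    case False
    show ?thesis
    proof (cases "j \<in> P \<and> i \<in> Q \<and> P - {j} = Q - {i}")
      case c: True
      \<comment> \<open>The common part of \<open>P\<close> and \<open>Q\<close>; adding
        \<open>i\<close> and \<open>j\<close> to it in the two possible orders gives opposite
        signs.\<close>
      define L where "L = P - {j}"
      have L: "P = insert j L" "Q = insert i L" "i \<notin> L" "j \<notin> L" "finite L"
        using c False fin by (auto simp: L_def)
      have "wedge_sign i P * wedge_sign j Q + wedge_sign j L * wedge_sign i L = 0"
        unfolding L(1,2) wedge_sign_insert[OF L(5,4) False[symmetric]] wedge_sign_insert[OF L(5,3) False]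
        using False by auto
      then show ?thesis using L False c by (auto simp: insert_commute)
    next
      case c: False
      have n: "\<not> (j \<notin> Q \<and> i \<notin> P \<and> insert j Q = insert i P)"
        using c False by (auto simp: set_eq_iff)
      show ?thesis unfolding if_not_P[OF n] if_not_P[OF c] using False by simp
    qed
  qed
  then show "(annihilation N (Suc k) i * creation N (Suc k) j + creation N k j * annihilation N k i) $$ (p, q) =
    ((if i = j then 1 else 0) \<cdot>\<^sub>m 1\<^sub>m ?L) $$ (p, q)"
    using pq 1 2 3 4 ext_level_inj[OF pq] by (auto simp: P_def Q_def)
qed auto

lemma creation_anticommute:
  assumes "i < N" "j < N"
  shows "creation N (Suc k) i * creation N k j = - (creation N (Suc k) j * creation N k i)"
proof (rule eq_matI)
  fix p q assume "p < dim_row (- (creation N (Suc k) j * creation N k i))" "q < dim_col (- (creation N (Suc k) j * creation N k i))"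
  then have pq: "p < length (ext_level N (Suc (Suc k)))" "q < length (ext_level N k)" by auto
  define P Q where "P = set (ext_level N (Suc (Suc k)) ! p)" and "Q = set (ext_level N k ! q)"
  have mem: "Q \<in> level_sets N k" unfolding Q_def using pq ext_level_set by auto
  note fin = level_sets_finite[OF mem]
  have eq: "(creation N (Suc k) i * creation N k j) $$ (p, q) =
      (if j \<notin> Q \<and> i \<notin> Q \<and> i \<noteq> j \<and> P = insert i (insert j Q) then wedge_sign i (insert j Q) * wedge_sign j Q else 0)"
    if "i < N" "j < N" for i j
  proof -
    have "(creation N (Suc k) i * creation N k j) $$ (p, q) =
      (\<Sum>K\<in>level_sets N (Suc k). creation_coeff i P K * creation_coeff j K Q)"
      unfolding index_mult_mat_sum[OF creation_carrier(1) creation_carrier(1) pq] P_def Q_def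
        sum_ext_level[symmetric] using pq by (simp add: creation_def)
    then show ?thesis
      unfolding sum_creation_left[OF that(2) mem] by (auto simp: creation_coeff_def)
  qed
  show "(creation N (Suc k) i * creation N k j) $$ (p, q) = (- (creation N (Suc k) j * creation N k i)) $$ (p, q)"
  proof (cases "j \<notin> Q \<and> i \<notin> Q \<and> i \<noteq> j")
    case True
    then show ?thesis
      using pq fin wedge_sign_insert[OF fin, of i j] wedge_sign_insert[OF fin, of j i]
      by (auto simp: eq[OF assms] eq[OF assms(2,1)] insert_commute)
  next
    case False
    then show ?thesis using pq by (auto simp: eq[OF assms] eq[OF assms(2,1)])
  qed
qed auto

text \<open>Each element of the basis set is counted once. For \<open>k > 0\<close> the sum is
  invertible, so the creation operators are jointly surjective; this drives all cancellations
  below.\<close>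

lemma number_operator:
  "lincomb (length (ext_level N (Suc k))) (length (ext_level N (Suc k))) N (\<lambda>i. 1) (\<lambda>i. creation N k i * annihilation N k i) =
    of_nat k \<cdot>\<^sub>m 1\<^sub>m (length (ext_level N (Suc k)))" (is "?l = ?r")
proof (rule eq_matI)
  fix p q assume "p < dim_row ?r" "q < dim_col ?r"
  then have pq: "p < length (ext_level N (Suc k))" "q < length (ext_level N (Suc k))" by auto
  define P Q where "P = set (ext_level N (Suc k) ! p)" and "Q = set (ext_level N (Suc k) ! q)"
  have mem: "P \<in> level_sets N (Suc k)" "Q \<in> level_sets N (Suc k)"
    unfolding P_def Q_def by (simp_all only: ext_level_set[OF pq(1)] ext_level_set[OF pq(2)])
  have "(creation N k i * annihilation N k i) $$ (p, q) = (if i \<in> P \<and> P = Q then 1 else 0)" for i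
  proof -
    have "(creation N k i * annihilation N k i) $$ (p, q) =
      (\<Sum>K\<in>level_sets N k. creation_coeff i P K * creation_coeff i Q K)"
      unfolding index_mult_mat_sum[OF creation_carrier(1) creation_carrier(2) pq] P_def Q_def
        sum_ext_level[symmetric] using pq by (simp add: annihilation_def creation_def)
    also have "\<dots> = (if i \<in> P \<and> P = Q then 1 else 0)"
    proof (cases k)
      case 0
      then show ?thesis using mem level_sets_finite[OF mem(1)] by auto
    next
      case (Suc k')
      have "i \<in> P \<Longrightarrow> i \<in> Q \<Longrightarrow> P - {i} = Q - {i} \<longleftrightarrow> P = Q" by auto
      then show ?thesis unfolding Suc
        by (subst sum_creation_right) (use mem Suc in \<open>auto simp: creation_coeff_def\<close>)
    qed
    finally show ?thesis .
  qed
  then have "?l $$ (p, q) = (\<Sum>i<N. if i \<in> P \<and> P = Q then 1 else 0)" using pq by simp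
  also have "\<dots> = (if P = Q then of_nat (card P) else 0)"
  proof -
    have "{..<N} \<inter> P = P" using mem by auto
    then show ?thesis by (cases "P = Q") (simp_all add: sum.If_cases Collect_mem_eq)
  qed
  finally show "?l $$ (p, q) = ?r $$ (p, q)"
    using pq mem ext_level_inj[OF pq] by (auto simp: P_def Q_def)
qed auto

section \<open>Exterior powers of matrices\<close>

definition minor :: "complex mat \<Rightarrow> nat list \<Rightarrow> nat list \<Rightarrow> complex" where
  "minor G I K = det (mat (length I) (length I) (\<lambda>(r, s). G $$ (I ! r, K ! s)))"

lemma ext_level_nth:
  assumes "p < length (ext_level N (Suc k))"
  shows "ext_level N (Suc k) ! p = sorted_list_of_set (set (ext_level N (Suc k) ! p))"
    "length (ext_level N (Suc k) ! p) = k"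
  using assms ext_basis_nth(1,3)[of p N k]
  by (auto simp: ext_level_def strict_sorted_iff sorted_list_of_set.idem_if_sorted_distinct)

lemma ext_mat_index:
  assumes "G \<in> carrier_mat N N" "p < length (ext_level N (Suc k))" "q < length (ext_level N (Suc k))"
  shows "ext_mat k G $$ (p, q) =
    minor G (sorted_list_of_set (set (ext_level N (Suc k) ! p))) (sorted_list_of_set (set (ext_level N (Suc k) ! q)))"
  unfolding ext_level_nth(1)[OF assms(2), symmetric] ext_level_nth(1)[OF assms(3), symmetric]
  using assms ext_level_nth(2)[OF assms(2)] by (simp add: ext_mat_def Let_def minor_def ext_level_def)

lemma ext_mat_carrier:
  "G \<in> carrier_mat N N \<Longrightarrow> ext_mat k G \<in> carrier_mat (length (ext_level N (Suc k))) (length (ext_level N (Suc k)))"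
  by (simp add: ext_mat_def Let_def ext_level_def)

text \<open>The same index shift as in \<open>mat_delete\<close>, so that minors of sets with one
  element removed appear as cofactors.\<close>

lemma sorted_list_of_set_delete_nth:
  assumes "finite A" "r < card A" "r' < card A - 1"
  shows "sorted_list_of_set (A - {sorted_list_of_set A ! r}) ! r' = sorted_list_of_set A ! (if r' < r then r' else Suc r')"
proof -
  let ?xs = "sorted_list_of_set A"
  have d: "distinct ?xs" and l: "length ?xs = card A" by auto
  have split: "?xs = take r ?xs @ ?xs ! r # drop (Suc r) ?xs" using assms(2) l by (simp add: id_take_nth_drop)
  have "?xs ! r \<notin> set (take r ?xs)"
    using d split by (metis distinct_append disjoint_iff list.set_intros(1))
  then have "remove1 (?xs ! r) ?xs = take r ?xs @ drop (Suc r) ?xs"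
    by (subst (2) split) (simp add: remove1_append)
  then show ?thesis
    using assms l by (simp add: sorted_list_of_set_remove nth_append)
qed

text \<open>Exactly \<open>r\<close> elements precede the one at position \<open>r\<close>, so the
  sign is the one of the Laplace expansion.\<close>

lemma wedge_sign_nth:
  assumes "finite A" "r < card A"
  shows "wedge_sign (sorted_list_of_set A ! r) (A - {sorted_list_of_set A ! r}) = (- 1) ^ r"
proof -
  let ?xs = "sorted_list_of_set A"
  have l: "length ?xs = card A" and s: "sorted_wrt (<) ?xs" and st: "set ?xs = A" and d: "distinct ?xs"
    using assms by auto
  have "{m \<in> A - {?xs ! r}. m < ?xs ! r} = (\<lambda>i. ?xs ! i) ` {..<r}"
  proof (intro equalityI subsetI)
    fix m assume m: "m \<in> {m \<in> A - {?xs ! r}. m < ?xs ! r}"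
    then obtain i where i: "i < card A" "m = ?xs ! i" using st l by (metis (no_types, lifting) DiffD1 in_set_conv_nth mem_Collect_eq)
    have "i < r"
    proof (rule ccontr)
      assume "\<not> i < r"
      then have "?xs ! r \<le> ?xs ! i" using sorted_wrt_nth_less[OF s, of r i] l i assms(2) by (cases "i = r") auto
      then show False using m i by auto
    qed
    then show "m \<in> (\<lambda>i. ?xs ! i) ` {..<r}" using i by auto
  next
    fix m assume "m \<in> (\<lambda>i. ?xs ! i) ` {..<r}"
    then obtain i where i: "i < r" "m = ?xs ! i" by auto
    then have "m < ?xs ! r" using sorted_wrt_nth_less[OF s, of i r] l assms(2) by simp
    moreover have "m \<in> A" using i assms(2) st l nth_mem[of i ?xs] by simp
    ultimately show "m \<in> {m \<in> A - {?xs ! r}. m < ?xs ! r}" by auto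
  qed
  moreover have "card ((\<lambda>i. ?xs ! i) ` {..<r}) = r"
    using d l assms(2) by (subst card_image) (auto simp: inj_on_def nth_eq_iff_index_eq)
  ultimately show ?thesis by (simp add: wedge_sign_def)
qed

lemma sum_sorted_list_of_set:
  assumes "finite A"
  shows "(\<Sum>r<card A. f (sorted_list_of_set A ! r)) = (\<Sum>i\<in>A. f i)"
proof -
  have "bij_betw (\<lambda>r. sorted_list_of_set A ! r) {..<card A} A"
    using bij_betw_nth[of "sorted_list_of_set A" "{..<card A}" A] assms by simp
  then show ?thesis by (rule sum.reindex_bij_betw)
qed

text \<open>Expansion along the column of \<open>j\<close> in the minor with columns \<open>j\<close> and \<open>J\<close>; if \<open>j \<in> J\<close> then two
  columns agree.\<close>

lemma minor_expansion:
  assumes I: "finite I" "card I = Suc m" and J: "finite J" "card J = m"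
  shows "(\<Sum>i\<in>I. G $$ (i, j) * (wedge_sign i (I - {i}) * minor G (sorted_list_of_set (I - {i})) (sorted_list_of_set J))) =
    (if j \<notin> J then wedge_sign j J * minor G (sorted_list_of_set I) (sorted_list_of_set (insert j J)) else 0)"
proof -
  let ?s = "sorted_list_of_set"
  define S where "S = (\<Sum>i\<in>I. G $$ (i, j) * (wedge_sign i (I - {i}) * minor G (?s (I - {i})) (?s J)))"
  have S: "S = (\<Sum>r<Suc m. G $$ (?s I ! r, j) * ((- 1) ^ r * minor G (?s (I - {?s I ! r})) (?s J)))"
    unfolding S_def sum_sorted_list_of_set[OF I(1), symmetric] I(2)
    by (intro sum.cong refl) (use I wedge_sign_nth[OF I(1)] in auto)
  have cardI: "card (I - {?s I ! r}) = m" if "r < Suc m" for r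
    using I that nth_mem[of r "?s I"] by simp
  have del: "minor G (?s (I - {?s I ! r})) (?s J) =
      det (mat m m (\<lambda>(r', s'). G $$ (?s I ! (if r' < r then r' else Suc r'), ?s J ! s')))" if "r < Suc m" for r
    unfolding minor_def using that I cardI[OF that]
    by (intro arg_cong[of _ _ det] eq_matI) (auto simp: sorted_list_of_set_delete_nth[of I r])
  show ?thesis
  proof (cases "j \<in> J")
    case True
    then obtain t where t: "t < m" "?s J ! t = j"
      using J by (metis in_set_conv_nth set_sorted_list_of_set length_sorted_list_of_set)
    define A where "A = mat (Suc m) (Suc m) (\<lambda>(r, s). G $$ (?s I ! r, (j # ?s J) ! s))"
    have A: "A \<in> carrier_mat (Suc m) (Suc m)" by (simp add: A_def)
    have "det A = 0"
      by (rule det_identical_columns[OF A, of 0 "Suc t"]) (use t in \<open>auto simp: A_def col_def intro!: eq_vecI\<close>)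
    moreover have "det A = S"
      unfolding laplace_expansion_column[OF A zero_less_Suc] S
    proof (intro sum.cong refl)
      fix r assume r: "r \<in> {..<Suc m}"
      have "mat_delete A r 0 = mat m m (\<lambda>(r', s'). G $$ (?s I ! (if r' < r then r' else Suc r'), ?s J ! s'))"
        using r by (intro eq_matI) (auto simp: mat_delete_def A_def)
      then show "A $$ (r, 0) * cofactor A r 0 = G $$ (?s I ! r, j) * ((- 1) ^ r * minor G (?s (I - {?s I ! r})) (?s J))"
        using r del[of r] by (simp add: cofactor_def) (simp add: A_def)
    qed
    ultimately show ?thesis using True by (simp add: S_def)
  next
    case False
    let ?K = "insert j J"
    have K: "finite ?K" "card ?K = Suc m" using J False by auto
    then obtain t where t: "t < Suc m" "?s ?K ! t = j"
      by (metis in_set_conv_nth set_sorted_list_of_set length_sorted_list_of_set insertI1)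
    have JK: "J = ?K - {?s ?K ! t}" using t False by auto
    define A where "A = mat (Suc m) (Suc m) (\<lambda>(r, s). G $$ (?s I ! r, ?s ?K ! s))"
    have A: "A \<in> carrier_mat (Suc m) (Suc m)" by (simp add: A_def)
    have "det A = (- 1) ^ t * S"
      unfolding laplace_expansion_column[OF A t(1)] S sum_distrib_left
    proof (intro sum.cong refl)
      fix r assume r: "r \<in> {..<Suc m}"
      have "mat_delete A r t = mat m m (\<lambda>(r', s'). G $$ (?s I ! (if r' < r then r' else Suc r'), ?s J ! s'))"
      proof (rule eq_matI)
        fix r' s' assume "r' < dim_row (mat m m (\<lambda>(r', s'). G $$ (?s I ! (if r' < r then r' else Suc r'), ?s J ! s')))"
          "s' < dim_col (mat m m (\<lambda>(r', s'). G $$ (?s I ! (if r' < r then r' else Suc r'), ?s J ! s')))"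
        then have rs: "r' < m" "s' < m" by auto
        have "?s J ! s' = ?s ?K ! (if s' < t then s' else Suc s')"
          by (subst JK, rule sorted_list_of_set_delete_nth) (use K t rs in auto)
        then show "mat_delete A r t $$ (r', s') = mat m m (\<lambda>(r', s'). G $$ (?s I ! (if r' < r then r' else Suc r'), ?s J ! s')) $$ (r', s')"
          using rs r t by (auto simp: mat_delete_def A_def)
      qed (auto simp: mat_delete_def A_def)
      then show "A $$ (r, t) * cofactor A r t = (- 1) ^ t * (G $$ (?s I ! r, j) * ((- 1) ^ r * minor G (?s (I - {?s I ! r})) (?s J)))"
        using r t del[of r] by (simp add: cofactor_def power_add) (simp add: A_def)
    qed
    moreover have "wedge_sign j J = (- 1) ^ t" using wedge_sign_nth[OF K(1), of t] K t JK by simp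
    moreover have "det A = minor G (?s I) (?s ?K)" using I by (simp add: minor_def A_def)
    moreover have "(- 1) ^ t * ((- 1) ^ t * S) = S" by (simp flip: mult.assoc power_mult_distrib)
    ultimately show ?thesis using False by (simp add: S_def)
  qed
qed

definition ext_mat_level :: "nat \<Rightarrow> complex mat \<Rightarrow> complex mat" where
  "ext_mat_level k G = (case k of 0 \<Rightarrow> 1\<^sub>m 0 | Suc m \<Rightarrow> ext_mat m G)"

lemma ext_mat_level_simps [simp]: "ext_mat_level 0 G = 1\<^sub>m 0" "ext_mat_level (Suc m) G = ext_mat m G"
  by (simp_all add: ext_mat_level_def)

lemma ext_mat_level_carrier:
  "G \<in> carrier_mat N N \<Longrightarrow> ext_mat_level k G \<in> carrier_mat (length (ext_level N k)) (length (ext_level N k))"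
  by (cases k) (use ext_mat_carrier in \<open>auto simp: ext_level_def\<close>)

text \<open>Exterior multiplication is equivariant. This is \<open>minor_expansion\<close> in matrix
  form and the relation fed into \<open>maurer_cartan_intertwine\<close>.\<close>

lemma ext_mat_creation:
  assumes G: "G \<in> carrier_mat N N" and j: "j < N"
  shows "ext_mat_level (Suc k) G * creation N k j =
    lincomb (length (ext_level N (Suc k))) (length (ext_level N k)) N (\<lambda>i. G $$ (i, j)) (\<lambda>i. creation N k i * ext_mat_level k G)"
proof (cases k)
  case 0
  then show ?thesis using ext_mat_carrier[OF G] by (intro eq_matI) (auto simp: ext_level_def)
next
  case (Suc m)
  let ?s = "sorted_list_of_set"
  note c = ext_mat_level_carrier[OF G]
  show ?thesis unfolding Suc
  proof (rule eq_matI)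
    let ?R = "lincomb (length (ext_level N (Suc (Suc m)))) (length (ext_level N (Suc m))) N (\<lambda>i. G $$ (i, j))
      (\<lambda>i. creation N (Suc m) i * ext_mat_level (Suc m) G)"
    fix p q assume "p < dim_row ?R" "q < dim_col ?R"
    then have pq: "p < length (ext_level N (Suc (Suc m)))" "q < length (ext_level N (Suc m))" by auto
    define I J where "I = set (ext_level N (Suc (Suc m)) ! p)" and "J = set (ext_level N (Suc m) ! q)"
    have I: "I \<in> level_sets N (Suc (Suc m))" and J: "J \<in> level_sets N (Suc m)"
      unfolding I_def J_def by (simp_all only: ext_level_set[OF pq(1)] ext_level_set[OF pq(2)])
    note fin = level_sets_finite[OF I] level_sets_finite[OF J]
    have "(ext_mat_level (Suc (Suc m)) G * creation N (Suc m) j) $$ (p, q) =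
      (\<Sum>K\<in>level_sets N (Suc (Suc m)). minor G (?s I) (?s K) * creation_coeff j K J)"
      unfolding index_mult_mat_sum[OF c creation_carrier(1) pq] I_def J_def sum_ext_level[symmetric]
      using pq by (auto simp: creation_def ext_mat_index[OF G] intro!: sum.cong)
    also have "\<dots> = (if j \<notin> J then minor G (?s I) (?s (insert j J)) * wedge_sign j J else 0)"
      by (rule sum_creation_left[OF j J])
    also have "\<dots> = (\<Sum>i\<in>I. G $$ (i, j) * (wedge_sign i (I - {i}) * minor G (?s (I - {i})) (?s J)))"
      using minor_expansion[OF fin(1) _ fin(2), of m G j] I J by (simp add: mult.commute)
    also have "\<dots> = (\<Sum>i<N. G $$ (i, j) * (if i \<in> I then wedge_sign i (I - {i}) * minor G (?s (I - {i})) (?s J) else 0))"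
      using I by (intro sum.mono_neutral_cong_left) auto
    also have "\<dots> = ?R $$ (p, q)"
    proof -
      have "(creation N (Suc m) i * ext_mat_level (Suc m) G) $$ (p, q) =
        (if i \<in> I then wedge_sign i (I - {i}) * minor G (?s (I - {i})) (?s J) else 0)" for i
      proof -
        have "(creation N (Suc m) i * ext_mat_level (Suc m) G) $$ (p, q) =
          (\<Sum>L\<in>level_sets N (Suc m). creation_coeff i I L * minor G (?s L) (?s J))"
          unfolding index_mult_mat_sum[OF creation_carrier(1) c pq] I_def J_def sum_ext_level[symmetric]
          using pq by (auto simp: creation_def ext_mat_index[OF G] intro!: sum.cong)
        then show ?thesis unfolding sum_creation_right[OF I] .
      qed
      then show ?thesis using pq by simp
    qed
    finally show "(ext_mat_level (Suc (Suc m)) G * creation N (Suc m) j) $$ (p, q) = ?R $$ (p, q)" .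
  qed (use carrier_matD[OF c[of "Suc (Suc m)"]] in auto)
qed

lemma ext_mat_0: "ext_mat 0 G = 1\<^sub>m 1"
proof -
  have "length (ext_basis (dim_row G) 0) = 1" by (simp add: length_ext_basis)
  then show ?thesis by (intro eq_matI) (auto simp: ext_mat_def Let_def)
qed

text \<open>As the sum of \<open>C i * A i\<close> is an invertible scalar, a matrix is determined
  by its products with the \<open>C i\<close>.\<close>

lemma lincomb_cancel:
  fixes X Y :: "'a::ring_1 mat"
  assumes X: "X \<in> carrier_mat m n" and Y: "Y \<in> carrier_mat m n"
    and C: "\<And>i. i < N \<Longrightarrow> C i \<in> carrier_mat n r" and A: "\<And>i. i < N \<Longrightarrow> A i \<in> carrier_mat r n"
    and num: "lincomb n n N (\<lambda>i. 1) (\<lambda>i. C i * A i) = s \<cdot>\<^sub>m 1\<^sub>m n"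
    and inj: "\<And>x y :: 'a. x * s = y * s \<Longrightarrow> x = y"
    and eq: "\<And>j. j < N \<Longrightarrow> X * C j = Y * C j"
  shows "X = Y"
proof -
  have "Z * (s \<cdot>\<^sub>m 1\<^sub>m n) = lincomb m n N (\<lambda>i. 1) (\<lambda>i. (Z * C i) * A i)" if Z: "Z \<in> carrier_mat m n" for Z
  proof -
    have "Z * (s \<cdot>\<^sub>m 1\<^sub>m n) = lincomb m n N (\<lambda>i. 1) (\<lambda>i. Z * (C i * A i))"
      unfolding num[symmetric] by (intro lincomb_mult_left[of _ _ n]) (use Z mult_carrier_mat[OF C A] in auto)
    also have "\<dots> = lincomb m n N (\<lambda>i. 1) (\<lambda>i. (Z * C i) * A i)"
      by (intro lincomb_cong refl) (use assoc_mult_mat[OF Z C A] in simp)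
    finally show ?thesis .
  qed
  from this[OF X] this[OF Y] have "X * (s \<cdot>\<^sub>m 1\<^sub>m n) = Y * (s \<cdot>\<^sub>m 1\<^sub>m n)"
    using lincomb_cong[OF refl, of N "\<lambda>i. (X * C i) * A i" "\<lambda>i. (Y * C i) * A i" m n "\<lambda>i. 1"] eq by simp
  then have e: "(X * (s \<cdot>\<^sub>m 1\<^sub>m n)) $$ (p, q) = (Y * (s \<cdot>\<^sub>m 1\<^sub>m n)) $$ (p, q)" for p q by simp
  have entry: "(Z * (s \<cdot>\<^sub>m 1\<^sub>m n)) $$ (p, q) = Z $$ (p, q) * s" if "Z \<in> carrier_mat m n" "p < m" "q < n" for Z p q
  proof -
    have "(Z * (s \<cdot>\<^sub>m 1\<^sub>m n)) $$ (p, q) = (\<Sum>l<n. if l = q then Z $$ (p, q) * s else 0)"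
      unfolding index_mult_mat_sum[OF that(1) smult_carrier_mat[OF one_carrier_mat] that(2,3)]
      using that by (intro sum.cong) auto
    then show ?thesis using that by simp
  qed
  show ?thesis
  proof (rule eq_matI)
    fix p q assume "p < dim_row Y" "q < dim_col Y"
    then have pq: "p < m" "q < n" using Y by auto
    have "X $$ (p, q) * s = Y $$ (p, q) * s"
      using e[of p q] unfolding entry[OF X pq] entry[OF Y pq] .
    then show "X $$ (p, q) = Y $$ (p, q)" by (rule inj)
  qed (use X Y in auto)
qed

lemma ext_mat_cancel:
  assumes "X \<in> carrier_mat (length (ext_level N (Suc k))) (length (ext_level N (Suc k)))"
    "Y \<in> carrier_mat (length (ext_level N (Suc k))) (length (ext_level N (Suc k)))" "k > 0"
    "\<And>j. j < N \<Longrightarrow> X * creation N k j = Y * creation N k j"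
  shows "X = Y"
  by (rule lincomb_cancel[OF assms(1,2) creation_carrier number_operator _ assms(4)]) (use assms(3) in auto)

text \<open>The Cauchy-Binet formula, obtained by induction on the level: both sides have the same
  products with the creation operators.\<close>

lemma ext_mat_level_mult:
  assumes G: "G \<in> carrier_mat N N" and H: "H \<in> carrier_mat N N"
  shows "ext_mat_level k (G * H) = ext_mat_level k G * ext_mat_level k H"
proof (induction k)
  case (Suc k)
  note GH = mult_carrier_mat[OF G H]
  let ?L = "length (ext_level N k)" and ?L' = "length (ext_level N (Suc k))"
  note cG = ext_mat_level_carrier[OF G] and cH = ext_mat_level_carrier[OF H]
  show ?case
  proof (cases "k = 0")
    case False
    show ?thesis
    proof (rule ext_mat_cancel[of _ N k])
      fix j assume j: "j < N"
      have "(ext_mat_level (Suc k) G * ext_mat_level (Suc k) H) * creation N k j =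
        ext_mat_level (Suc k) G * (ext_mat_level (Suc k) H * creation N k j)"
        by (rule assoc_mult_mat[OF cG cH creation_carrier(1)])
      also have "\<dots> = lincomb ?L' ?L N (\<lambda>l. H $$ (l, j)) (\<lambda>l. ext_mat_level (Suc k) G * (creation N k l * ext_mat_level k H))"
        unfolding ext_mat_creation[OF H j]
        by (intro lincomb_mult_left[of _ _ ?L'] mult_carrier_mat[OF creation_carrier(1) cH] cG mult.commute)
      also have "\<dots> = lincomb ?L' ?L N (\<lambda>l. H $$ (l, j)) (\<lambda>l. lincomb ?L' ?L N (\<lambda>i. G $$ (i, l)) (\<lambda>i. creation N k i * ext_mat_level k (G * H)))"
      proof (rule lincomb_cong[OF refl])
        fix l assume l: "l < N"
        have "ext_mat_level (Suc k) G * (creation N k l * ext_mat_level k H) = (ext_mat_level (Suc k) G * creation N k l) * ext_mat_level k H"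
          by (rule assoc_mult_mat[symmetric, OF cG creation_carrier(1) cH])
        also have "\<dots> = lincomb ?L' ?L N (\<lambda>i. G $$ (i, l)) (\<lambda>i. (creation N k i * ext_mat_level k G) * ext_mat_level k H)"
          unfolding ext_mat_creation[OF G l] by (rule lincomb_mult_right[OF mult_carrier_mat[OF creation_carrier(1) cG] cH])
        finally show "ext_mat_level (Suc k) G * (creation N k l * ext_mat_level k H) =
          lincomb ?L' ?L N (\<lambda>i. G $$ (i, l)) (\<lambda>i. creation N k i * ext_mat_level k (G * H))"
          unfolding Suc.IH by (simp only: assoc_mult_mat[OF creation_carrier(1) cG cH])
      qed
      also have "\<dots> = lincomb ?L' ?L N (\<lambda>i. (G * H) $$ (i, j)) (\<lambda>i. creation N k i * ext_mat_level k (G * H))"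
        unfolding lincomb_lincomb
        by (intro lincomb_cong refl) (auto simp: index_mult_mat_sum[OF G H _ j] mult.commute)
      also have "\<dots> = ext_mat_level (Suc k) (G * H) * creation N k j"
        by (rule ext_mat_creation[symmetric, OF GH j])
      finally show "ext_mat_level (Suc k) (G * H) * creation N k j =
        (ext_mat_level (Suc k) G * ext_mat_level (Suc k) H) * creation N k j" ..
    qed (use False mult_carrier_mat[OF cG[of "Suc k"] cH] ext_mat_level_carrier[OF GH, of "Suc k"] in auto)
  qed (simp add: ext_mat_0)
qed simp

lemma ext_mat_level_one: "ext_mat_level k (1\<^sub>m N) = 1\<^sub>m (length (ext_level N k))"
proof (induction k)
  case (Suc k)
  show ?case
  proof (cases "k = 0")
    case False
    let ?L = "length (ext_level N k)" and ?L' = "length (ext_level N (Suc k))"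
    show ?thesis
    proof (rule ext_mat_cancel[of _ N k])
      fix j assume j: "j < N"
      have "ext_mat_level (Suc k) (1\<^sub>m N) * creation N k j = lincomb ?L' ?L N (\<lambda>i. if i = j then 1 else 0) (\<lambda>i. creation N k i)"
        unfolding ext_mat_creation[OF one_carrier_mat j] Suc.IH
        using right_mult_one_mat[OF creation_carrier(1)] j by (intro lincomb_cong) auto
      also have "\<dots> = creation N k j" by (rule lincomb_delta[OF creation_carrier(1) j])
      finally show "ext_mat_level (Suc k) (1\<^sub>m N) * creation N k j = 1\<^sub>m ?L' * creation N k j"
        using left_mult_one_mat[OF creation_carrier(1)] by simp
    qed (use False ext_mat_level_carrier[OF one_carrier_mat, of "Suc k" N] in auto)
  qed (simp add: ext_mat_0 ext_level_def length_ext_basis)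
qed (simp add: ext_level_def)

lemma length_ext_level: "length (ext_level N (Suc k)) = N choose k"
  by (simp add: ext_level_def length_ext_basis)

section \<open>Exterior powers of a bundle with automorphism\<close>

lemma differentiable_prod:
  fixes f :: "'i \<Rightarrow> 'a::real_normed_vector \<Rightarrow> complex"
  shows "finite S \<Longrightarrow> (\<And>i. i \<in> S \<Longrightarrow> f i differentiable at x) \<Longrightarrow> (\<lambda>y. \<Prod>i\<in>S. f i y) differentiable at x"
  by (induction S rule: finite_induct) (auto intro: differentiable_mult)

definition ext_bundle :: "'n::finite abundle \<Rightarrow> nat \<Rightarrow> 'n abundle" where
  "ext_bundle b k = (case k of 0 \<Rightarrow> trivial 0 | Suc m \<Rightarrow> ext_power m b)"

text \<open>In closed form the sum over 0 < j \<le> k of (-1)^(j-1) * j^n * (N choose (k - j)), that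
  is, the coefficient of t^k in (1 + t)^N times the sum of (-1)^(j-1) j^n t^j. The recursion is the
  form in which it comes out of the anticommutation relations.\<close>

primrec ext_index :: "nat \<Rightarrow> nat \<Rightarrow> nat \<Rightarrow> complex" where
  "ext_index N 0 = (\<lambda>n. 0)"
| "ext_index N (Suc k) = (\<lambda>n. binomial_shift (\<lambda>b. (if b = 0 then of_nat (N choose k) else 0) - ext_index N k b) n 0)"

context open_nbhd
begin

lemma mfun_ext_mat:
  assumes "mfun X x N N f"
  shows "mfun X x (length (ext_level N (Suc k))) (length (ext_level N (Suc k))) (\<lambda>y. ext_mat k (f y))"
  unfolding mfun_def
proof (intro conjI ballI allI impI)
  fix p q assume pq: "p < length (ext_level N (Suc k))" "q < length (ext_level N (Suc k))"
  let ?B = "ext_basis N k"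
  have lt: "?B ! p ! r < N" if "p < length (ext_level N (Suc k))" "r < k" for p r
  proof -
    have p: "p < length ?B" using that(1) by (simp add: ext_level_def)
    have "?B ! p ! r \<in> set (?B ! p)" by (rule nth_mem) (simp add: ext_basis_nth(1)[OF p] that(2))
    then show ?thesis using ext_basis_nth(2)[OF p] by auto
  qed
  have "(\<lambda>y. \<Sum>s | s permutes {0..<k}. of_int (sign s) * (\<Prod>i = 0..<k. f y $$ (?B ! p ! i, ?B ! q ! s i))) differentiable at x"
  proof (intro differentiable_sum differentiable_mult differentiable_prod ballI)
    fix s i assume "s \<in> {s. s permutes {0..<k}}" "i \<in> {0..<k}"
    then have "i < k" "s i < k" using permutes_in_image[of s "{0..<k}" i] by auto
    then show "(\<lambda>y. f y $$ (?B ! p ! i, ?B ! q ! s i)) differentiable at x"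
      using assms lt pq by (auto simp: mfun_def)
  qed (auto simp: finite_permutations)
  then show "(\<lambda>y. ext_mat k (f y) $$ (p, q)) differentiable at x"
  proof (rule differentiable_transform_within_open[OF _ X])
    fix y assume "y \<in> X"
    then have "f y \<in> carrier_mat N N" using assms by (auto simp: mfun_def)
    then have "ext_mat k (f y) $$ (p, q) = det (mat k k (\<lambda>(r, s). f y $$ (?B ! p ! r, ?B ! q ! s)))"
      using pq by (simp add: ext_mat_def Let_def ext_level_def)
    also have "\<dots> = (\<Sum>s | s permutes {0..<k}. of_int (sign s) * (\<Prod>i = 0..<k. f y $$ (?B ! p ! i, ?B ! q ! s i)))"
      unfolding det_def by (auto intro!: sum.cong prod.cong dest: permutes_in_image)
    finally show "(\<Sum>s | s permutes {0..<k}. of_int (sign s) * (\<Prod>i = 0..<k. f y $$ (?B ! p ! i, ?B ! q ! s i))) =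
      ext_mat k (f y) $$ (p, q)" ..
  qed
qed (use assms ext_mat_carrier in \<open>auto simp: mfun_def\<close>)

context
  fixes b :: "'n abundle"
  assumes b: "regular b"
begin

private abbreviation (input) "N \<equiv> arank b"
private abbreviation (input) "rk k \<equiv> length (ext_level N k)"
private abbreviation (input) "T \<equiv> maurer_cartan b x"
private abbreviation (input) "U k \<equiv> maurer_cartan (ext_bundle b k) x"
private abbreviation (input) C :: "nat \<Rightarrow> nat \<Rightarrow> 'n form mat" where "C k j \<equiv> cmat (creation N k j)"
private abbreviation (input) A :: "nat \<Rightarrow> nat \<Rightarrow> 'n form mat" where "A k j \<equiv> cmat (annihilation N k j)"

lemma arank_ext_bundle: "arank (ext_bundle b k) = rk k"
  by (cases k) (auto simp: ext_bundle_def trivial_abundle_def ext_power_abundle_def ext_level_def)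

lemma aut_ext_bundle: "aut (ext_bundle b k) y = ext_mat_level k (aut b y)"
  by (cases k) (auto simp: ext_bundle_def trivial_abundle_def ext_power_abundle_def)

lemma regular_ext_bundle: "regular (ext_bundle b k)"
proof (cases k)
  case 0
  then show ?thesis by (simp add: ext_bundle_def regular_trivial)
next
  case (Suc m)
  note p = minv_props[OF b]
  have mb: "mfun X x N N (aut b)" using b by (simp add: regular_def)
  have "mfun X x (rk k) (rk k) (aut (ext_bundle b k))"
    using mfun_ext_mat[OF mb, of m] Suc by (simp add: ext_bundle_def ext_power_abundle_def)
  moreover have "ext_mat_level k (aut b x) * ext_mat_level k (minv (aut b x)) = 1\<^sub>m (rk k)"
    "ext_mat_level k (minv (aut b x)) * ext_mat_level k (aut b x) = 1\<^sub>m (rk k)"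
    by (simp_all add: ext_mat_level_mult[OF p(4,1), symmetric] ext_mat_level_mult[OF p(1,4), symmetric] p(2,3) ext_mat_level_one)
  ultimately show ?thesis
    unfolding regular_def arank_ext_bundle aut_ext_bundle using ext_mat_level_carrier[OF p(1)] by blast
qed

lemma regular_ext_power: "regular (ext_power k b)"
  using regular_ext_bundle[of "Suc k"] by (simp add: ext_bundle_def)

private lemma T: "T \<in> carrier_mat N N" "mdeg 1 T"
  using maurer_cartan_carrier[OF b] mdeg_maurer_cartan[OF b] by auto

private lemma U: "U k \<in> carrier_mat (rk k) (rk k)" "mdeg 1 (U k)"
  using maurer_cartan_carrier[OF regular_ext_bundle[of k]] mdeg_maurer_cartan[OF regular_ext_bundle[of k]]
  by (auto simp: arank_ext_bundle)

private lemma C: "C k j \<in> carrier_mat (rk (Suc k)) (rk k)" and A: "A k j \<in> carrier_mat (rk k) (rk (Suc k))"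
  by simp_all

lemma maurer_cartan_creation:
  assumes "j < N"
  shows "U (Suc k) * C k j = C k j * U k + lincomb (rk (Suc k)) (rk k) N (\<lambda>i. T $$ (i, j)) (\<lambda>i. C k i)"
proof -
  have "aut (ext_bundle b (Suc k)) y * creation N k j = lincomb (arank (ext_bundle b (Suc k))) (arank (ext_bundle b k)) N
      (\<lambda>i. aut b y $$ (i, j)) (\<lambda>i. creation N k i * aut (ext_bundle b k) y)" if "y \<in> X" "j < N" for y j
    unfolding aut_ext_bundle arank_ext_bundle
    using b that by (intro ext_mat_creation) (auto simp: regular_def mfun_def)
  from maurer_cartan_intertwine[OF regular_ext_bundle regular_ext_bundle b _ this assms]
  show ?thesis by (simp add: arank_ext_bundle)
qed

text \<open>\<open>C (Suc k) j\<close> is moved to the front past an annihilation and a creation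
  operator, and the two signs cancel.\<close>

lemma CAR_triple:
  assumes "p < N" "q < N" "j < N"
  shows "C (Suc k) p * A (Suc k) q * C (Suc k) j =
    fconst (if q = j then 1 else 0) \<cdot>\<^sub>m C (Suc k) p + C (Suc k) j * (C k p * A k q)"
proof -
  let ?c = "creation N" and ?a = "annihilation N"
  note cc = creation_carrier[of N]
  note m = mult_carrier_mat[OF cc(2,1)] mult_carrier_mat[OF cc(1,2)] mult_carrier_mat[OF cc(1,1)]
  have "?c (Suc k) p * ?a (Suc k) q * ?c (Suc k) j + ?c (Suc k) p * (?c k j * ?a k q) =
      ?c (Suc k) p * (?a (Suc k) q * ?c (Suc k) j + ?c k j * ?a k q)"
    unfolding assoc_mult_mat[OF cc(1,2,1)] by (rule mult_add_distrib_mat[symmetric, OF cc(1) m(1,2)])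
  also have "\<dots> = (if q = j then 1 else 0) \<cdot>\<^sub>m ?c (Suc k) p"
    unfolding annihilation_creation[OF assms(2,3)] mult_smult_distrib[OF cc(1) one_carrier_mat] right_mult_one_mat[OF cc(1)] ..
  also have "?c (Suc k) p * (?c k j * ?a k q) = (?c (Suc k) p * ?c k j) * ?a k q"
    by (rule assoc_mult_mat[symmetric, OF cc(1,1,2)])
  also have "\<dots> = - (?c (Suc k) j * ?c k p) * ?a k q"
    unfolding creation_anticommute[OF assms(1,3)] ..
  also have "\<dots> = - (?c (Suc k) j * (?c k p * ?a k q))"
    unfolding assoc_mult_mat[OF cc(1,1,2), symmetric]
    by (intro eq_matI) (auto simp: index_mult_mat_sum[OF uminus_carrier_mat[OF m(3)] cc(2)] index_mult_mat_sum[OF m(3) cc(2)] sum_negf)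
  finally have eq: "?c (Suc k) p * ?a (Suc k) q * ?c (Suc k) j + - (?c (Suc k) j * (?c k p * ?a k q)) =
    (if q = j then 1 else 0) \<cdot>\<^sub>m ?c (Suc k) p" .
  have "?c (Suc k) p * ?a (Suc k) q * ?c (Suc k) j =
      (if q = j then 1 else 0) \<cdot>\<^sub>m ?c (Suc k) p + ?c (Suc k) j * (?c k p * ?a k q)"
  proof (rule eq_matI)
    fix r s assume "r < dim_row ((if q = j then 1 else 0) \<cdot>\<^sub>m ?c (Suc k) p + ?c (Suc k) j * (?c k p * ?a k q))"
      "s < dim_col ((if q = j then 1 else 0) \<cdot>\<^sub>m ?c (Suc k) p + ?c (Suc k) j * (?c k p * ?a k q))"
    then show "(?c (Suc k) p * ?a (Suc k) q * ?c (Suc k) j) $$ (r, s) =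
      ((if q = j then 1 else 0) \<cdot>\<^sub>m ?c (Suc k) p + ?c (Suc k) j * (?c k p * ?a k q)) $$ (r, s)"
      using arg_cong[OF eq, of "\<lambda>M. M $$ (r, s)"] by (auto simp: algebra_simps)
  qed auto
  then have "cmat (?c (Suc k) p * ?a (Suc k) q * ?c (Suc k) j) =
      (cmat ((if q = j then 1 else 0) \<cdot>\<^sub>m ?c (Suc k) p + ?c (Suc k) j * (?c k p * ?a k q)) :: 'n form mat)" by simp
  then show ?thesis
    by (simp only: fconst.mat_hom_mult[OF m(2) cc(1)] fconst.mat_hom_mult[OF cc(1) m(2)] fconst.mat_hom_mult[OF cc(1,2)]
        cmat_add[OF smult_carrier_mat[OF cc(1)] mult_carrier_mat[OF cc(1) m(2)]] cmat_smult)
qed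

text \<open>The second quantization of \<open>T\<close>, that is, its extension to the exterior
  power as a derivation.\<close>

private definition V :: "nat \<Rightarrow> 'n form mat" where
  "V k = lincomb (rk (Suc k)) (rk (Suc k)) N (\<lambda>p. 1)
     (\<lambda>p. lincomb (rk (Suc k)) (rk (Suc k)) N (\<lambda>q. T $$ (p, q)) (\<lambda>q. C k p * A k q))"

private lemma V_carrier: "V k \<in> carrier_mat (rk (Suc k)) (rk (Suc k))"
  by (simp add: V_def)

private lemma V_creation:
  assumes j: "j < N"
  shows "V (Suc k) * C (Suc k) j = C (Suc k) j * V k + lincomb (rk (Suc (Suc k))) (rk (Suc k)) N (\<lambda>i. T $$ (i, j)) (\<lambda>i. C (Suc k) i)"
    (is "_ = ?R")
proof (rule eq_matI)
  let ?d = "rk (Suc (Suc k))" and ?d' = "rk (Suc k)"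
  fix r s assume "r < dim_row ?R" "s < dim_col ?R"
  then have rs: "r < ?d" "s < ?d'" by auto
  note m = mult_carrier_mat[OF C A]
  have 1: "V (Suc k) * C (Suc k) j = lincomb ?d ?d' N (\<lambda>p. 1)
     (\<lambda>p. lincomb ?d ?d' N (\<lambda>q. T $$ (p, q)) (\<lambda>q. C (Suc k) p * A (Suc k) q * C (Suc k) j))"
    unfolding V_def lincomb_mult_right[OF lincomb_carrier C]
    by (intro lincomb_cong refl lincomb_mult_right[OF m C])
  have 2: "C (Suc k) j * V k = lincomb ?d ?d' N (\<lambda>p. 1)
     (\<lambda>p. lincomb ?d ?d' N (\<lambda>q. T $$ (p, q)) (\<lambda>q. C (Suc k) j * (C k p * A k q)))"
  proof -
    have "C (Suc k) j * V k = lincomb ?d ?d' N (\<lambda>p. 1)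
      (\<lambda>p. C (Suc k) j * lincomb ?d' ?d' N (\<lambda>q. T $$ (p, q)) (\<lambda>q. C k p * A k q))"
      unfolding V_def by (rule lincomb_mult_left[of _ _ ?d']) (use C in auto)
    also have "\<dots> = lincomb ?d ?d' N (\<lambda>p. 1)
      (\<lambda>p. lincomb ?d ?d' N (\<lambda>q. T $$ (p, q)) (\<lambda>q. C (Suc k) j * (C k p * A k q)))"
    proof (rule lincomb_cong[OF refl])
      fix p assume p: "p < N"
      show "C (Suc k) j * lincomb ?d' ?d' N (\<lambda>q. T $$ (p, q)) (\<lambda>q. C k p * A k q) =
        lincomb ?d ?d' N (\<lambda>q. T $$ (p, q)) (\<lambda>q. C (Suc k) j * (C k p * A k q))"
        by (rule lincomb_mult_left[of _ _ ?d']) (use C m in \<open>auto simp: mult_fconst\<close>)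
    qed
    finally show ?thesis .
  qed
  have "(C (Suc k) p * A (Suc k) q * C (Suc k) j) $$ (r, s) =
      fconst (if q = j then 1 else 0) * C (Suc k) p $$ (r, s) + (C (Suc k) j * (C k p * A k q)) $$ (r, s)"
    if "p < N" "q < N" for p q
    unfolding CAR_triple[OF that j] using rs by simp
  then have "(V (Suc k) * C (Suc k) j) $$ (r, s) =
    (\<Sum>p<N. \<Sum>q<N. T $$ (p, q) * (fconst (if q = j then 1 else 0) * C (Suc k) p $$ (r, s))) + (C (Suc k) j * V k) $$ (r, s)"
    unfolding 1 2 using rs by (simp add: distrib_left sum.distrib)
  also have "(\<Sum>p<N. \<Sum>q<N. T $$ (p, q) * (fconst (if q = j then 1 else 0) * C (Suc k) p $$ (r, s))) =
    (\<Sum>p<N. \<Sum>q<N. if q = j then T $$ (p, j) * C (Suc k) p $$ (r, s) else 0)"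
    by (intro sum.cong refl) auto
  also have "\<dots> = (\<Sum>p<N. T $$ (p, j) * C (Suc k) p $$ (r, s))" using j by simp
  finally show "(V (Suc k) * C (Suc k) j) $$ (r, s) = ?R $$ (r, s)"
    using rs by (simp add: add.commute)
qed (simp_all add: V_def)

text \<open>Both sides vanish on the zeroth power and satisfy the same commutation relation with the
  creation operators, so the number operator carries equality from one power to the next.\<close>

private lemma U_eq_V: "U (Suc k) = V k"
proof (induction k)
  case 0
  have "rk 0 = 0" "rk (Suc 0) = 1" by (simp_all add: ext_level_def length_ext_basis)
  moreover have "aut (ext_bundle b (Suc 0)) = (\<lambda>y. 1\<^sub>m 1)"
    by (rule ext) (simp add: aut_ext_bundle ext_mat_0)
  then have "U (Suc 0) = 0\<^sub>m 1 1"
    using minv_props(1)[OF regular_ext_bundle[of "Suc 0"]] \<open>rk (Suc 0) = 1\<close>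
    by (simp add: maurer_cartan_eq arank_ext_bundle dmx_const)
  moreover have "(C 0 p * A 0 q) $$ (0, 0) = 0" for p q
    using \<open>rk 0 = 0\<close> \<open>rk (Suc 0) = 1\<close> by (subst index_mult_mat_sum[OF C A]) auto
  ultimately show ?case by (intro eq_matI) (auto simp: V_def)
next
  case (Suc k)
  have num: "lincomb (rk (Suc (Suc k))) (rk (Suc (Suc k))) N (\<lambda>i. 1) (\<lambda>i. C (Suc k) i * A (Suc k) i) =
    fconst (of_nat (Suc k)) \<cdot>\<^sub>m 1\<^sub>m (rk (Suc (Suc k)))"
  proof -
    have "cmat (lincomb (rk (Suc (Suc k))) (rk (Suc (Suc k))) N (\<lambda>i. 1) (\<lambda>i. creation N (Suc k) i * annihilation N (Suc k) i)) =
      (fconst (of_nat (Suc k)) \<cdot>\<^sub>m 1\<^sub>m (rk (Suc (Suc k))) :: 'n form mat)"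
      unfolding number_operator by (simp add: cmat_smult fconst.mat_hom_one)
    then show ?thesis
      unfolding cmat_lincomb[OF mult_carrier_mat[OF creation_carrier(1,2)]]
      by (simp add: fconst.mat_hom_mult[OF creation_carrier(1,2)])
  qed
  show ?case
  proof (rule lincomb_cancel[OF U(1) V_carrier C A num])
    show "U (Suc (Suc k)) * C (Suc k) j = V (Suc k) * C (Suc k) j" if "j < N" for j
      unfolding V_creation[OF that] maurer_cartan_creation[OF that] Suc.IH ..
    fix f h :: "'n form" assume eq: "f * fconst (of_nat (Suc k)) = h * fconst (of_nat (Suc k))"
    show "f = h"
    proof (rule form_eqI)
      fix I show "coeff f I = coeff h I"
        using arg_cong[OF eq, of "\<lambda>f. coeff f I"] by (simp del: of_nat_Suc)
    qed
  qed
qed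

private abbreviation (input) "W k \<equiv> U k * U k"
private abbreviation (input) "Om \<equiv> T * T"

private lemma W: "W k \<in> carrier_mat (rk k) (rk k)" "mdeg 2 (W k)" and Om: "Om \<in> carrier_mat N N" "mdeg 2 Om"
  using U[of k] T mdeg_mult[OF U(2)[of k] U(2)[of k] U(1)[of k] U(1)[of k]] mdeg_mult[OF T(2) T(2) T(1) T(1)]
  by (auto simp: numeral_2_eq_2)

private lemma Wpow: "W k ^\<^sub>m n \<in> carrier_mat (rk k) (rk k)" "mdeg (n * 2) (W k ^\<^sub>m n)"
  using W[of k] mdeg_pow[OF W(2,1)[of k]] by auto

private lemma mtrace_Wpow: "mtrace (W (Suc k) ^\<^sub>m n) = fconst (if n = 0 then of_nat (N choose k) else 0)"
proof (cases "n = 0")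
  case True
  then show ?thesis using carrier_matD[OF U(1)[of "Suc k"]]
    by (simp add: mtrace_def length_ext_level fconst_of_nat)
next
  case False
  then show ?thesis using mtrace_even_power[OF U, of "2 * n" "Suc k"] by (simp add: pow_mat_mult2[OF U(1)])
qed

text \<open>Cyclicity and the exchange of \<open>W\<close> with the creation operator lead from
  creation times annihilation on power \<open>k + 1\<close> to annihilation times creation on power
  \<open>k\<close>. There the anticommutation relation, together with the vanishing traces of
  positive powers of \<open>W\<close>, leads back to creation times annihilation.\<close>

private lemma creation_trace:
  assumes "i < N" "j < N"
  shows "mtrace (C k i * (A k j * W (Suc k) ^\<^sub>m n)) = fconst (ext_index N k n) * (Om ^\<^sub>m n) $$ (j, i)"
  using assms
proof (induction k arbitrary: i j n)
  case 0
  have "rk 0 = 0" by (simp add: ext_level_def)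
  have "C 0 i * (A 0 j * W (Suc 0) ^\<^sub>m n) \<in> carrier_mat (rk (Suc 0)) (rk (Suc 0))"
    by (rule mult_carrier_mat[OF C mult_carrier_mat[OF A Wpow(1)]])
  from mtrace_carrier[OF this] have "mtrace (C 0 i * (A 0 j * W (Suc 0) ^\<^sub>m n)) = 0"
    using \<open>rk 0 = 0\<close> by (simp add: index_mult_mat_sum[OF C mult_carrier_mat[OF A Wpow(1)]])
  then show ?case by simp
next
  case (Suc k)
  note i = Suc.prems(1) and j = Suc.prems(2)
  let ?st = "shifted_trace (W (Suc (Suc k))) (W (Suc k)) (A (Suc k) j) (C (Suc k))"
  have "?st n 0 i = fconst (binomial_shift (\<lambda>b. (if b = 0 then of_nat (N choose k) else 0) - ext_index N k b) n 0) * (Om ^\<^sub>m (n + 0)) $$ (j, i)"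
  proof (rule shifted_trace_eq[OF W W(1) Om C A mdeg_map_fconst _ _ j i, where m = n])
    show "W (Suc (Suc k)) * C (Suc k) l = C (Suc k) l * W (Suc k) +
        lincomb (rk (Suc (Suc k))) (rk (Suc k)) N (\<lambda>i. Om $$ (i, l)) (C (Suc k))" if "l < N" for l
      by (rule square_intertwine[OF U U(1) T C maurer_cartan_creation that])
    fix m l assume l: "l < N"
    have c: "A (Suc k) j * C (Suc k) l \<in> carrier_mat (rk (Suc k)) (rk (Suc k))" "C k l * A k j \<in> carrier_mat (rk (Suc k)) (rk (Suc k))"
      by (rule mult_carrier_mat[OF A C], rule mult_carrier_mat[OF C A])
    have car: "A (Suc k) j * C (Suc k) l + C k l * A k j = fconst (if j = l then 1 else 0) \<cdot>\<^sub>m 1\<^sub>m (rk (Suc k))"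
    proof -
      note cc = creation_carrier[of N]
      have "A (Suc k) j * C (Suc k) l + C k l * A k j =
        cmat (annihilation N (Suc k) j * creation N (Suc k) l + creation N k l * annihilation N k j)"
        by (simp only: cmat_add[OF mult_carrier_mat[OF cc(2,1)] mult_carrier_mat[OF cc(1,2)]]
            fconst.mat_hom_mult[OF cc(2,1)] fconst.mat_hom_mult[OF cc(1,2)])
      then show ?thesis unfolding annihilation_creation[OF j l] by (simp add: cmat_smult fconst.mat_hom_one)
    qed
    have "?st 0 m l = mtrace (A (Suc k) j * (C (Suc k) l * W (Suc k) ^\<^sub>m m))"
      using left_mult_one_mat[OF mult_carrier_mat[OF C Wpow(1)]] carrier_matD[OF U(1)[of "Suc (Suc k)"]]
      by (simp add: shifted_trace_def)
    also have "\<dots> = mtrace ((A (Suc k) j * C (Suc k) l) * W (Suc k) ^\<^sub>m m)"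
      by (simp only: assoc_mult_mat[OF A C Wpow(1)])
    finally have s: "?st 0 m l = \<dots>" .
    have "mtrace ((A (Suc k) j * C (Suc k) l) * W (Suc k) ^\<^sub>m m) + mtrace (C k l * (A k j * W (Suc k) ^\<^sub>m m)) =
      mtrace ((A (Suc k) j * C (Suc k) l + C k l * A k j) * W (Suc k) ^\<^sub>m m)"
      by (simp only: add_mult_distrib_mat[OF c Wpow(1)] assoc_mult_mat[OF C A Wpow(1), symmetric]
          mtrace_add[OF mult_carrier_mat[OF c(1) Wpow(1)] mult_carrier_mat[OF c(2) Wpow(1)]])
    also have "\<dots> = fconst (if j = l then 1 else 0) * mtrace (W (Suc k) ^\<^sub>m m)"
      unfolding car smult_mult_mat[OF one_carrier_mat Wpow(1)] left_mult_one_mat[OF Wpow(1)]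
      by (rule mtrace_smult[OF Wpow(1)])
    finally have "?st 0 m l = fconst (if j = l then 1 else 0) * mtrace (W (Suc k) ^\<^sub>m m) - mtrace (C k l * (A k j * W (Suc k) ^\<^sub>m m))"
      unfolding s by (simp only: eq_diff_eq)
    also have "\<dots> = fconst (if j = l then 1 else 0) * fconst (if m = 0 then of_nat (N choose k) else 0) -
        fconst (ext_index N k m) * (Om ^\<^sub>m m) $$ (j, l)"
      unfolding mtrace_Wpow Suc.IH[OF l j] ..
    also have "\<dots> = fconst ((if m = 0 then of_nat (N choose k) else 0) - ext_index N k m) * (Om ^\<^sub>m m) $$ (j, l)"
      \<comment> \<open>For \<open>m = 0\<close> the power of \<open>Om\<close> is the identity and
        supplies the delta of the anticommutation relation; for \<open>m > 0\<close> that term is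
        zero.\<close>
      using j l T(1) by (cases "m = 0") (auto simp: fconst.hom_minus fconst.hom_uminus left_diff_distrib)
    finally show "?st 0 m l = fconst ((if m = 0 then of_nat (N choose k) else 0) - ext_index N k m) * (Om ^\<^sub>m m) $$ (j, l)" .
  qed auto
  moreover have "?st n 0 i = mtrace (C (Suc k) i * (A (Suc k) j * W (Suc (Suc k)) ^\<^sub>m n))"
  proof -
    have "?st n 0 i = mtrace (A (Suc k) j * (W (Suc (Suc k)) ^\<^sub>m n * C (Suc k) i))"
      using right_mult_one_mat[OF C] carrier_matD[OF U(1)[of "Suc k"]] by (simp add: shifted_trace_def)
    also have "\<dots> = mtrace ((A (Suc k) j * W (Suc (Suc k)) ^\<^sub>m n) * C (Suc k) i)"
      by (simp only: assoc_mult_mat[OF A Wpow(1) C])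
    also have "\<dots> = mtrace (C (Suc k) i * (A (Suc k) j * W (Suc (Suc k)) ^\<^sub>m n))"
      using mdeg_mult[OF mdeg_map_fconst Wpow(2) A Wpow(1)]
      by (intro mtrace_comm_even[OF mult_carrier_mat[OF A Wpow(1)] C _ mdeg_map_fconst]) auto
    finally show ?thesis .
  qed
  ultimately show ?case by simp
qed

lemma mtrace_ext_power:
  "mtrace (maurer_cartan (ext_power k b) x ^\<^sub>m (2 * n + 1)) = fconst (ext_index N k n) * mtrace (T ^\<^sub>m (2 * n + 1))"
proof -
  have "mtrace (U (Suc k) ^\<^sub>m (2 * n + 1)) = mtrace (U (Suc k) * W (Suc k) ^\<^sub>m n)"
    using pow_mat_Suc_left[OF U(1), of "Suc k" "2 * n"] by (simp add: pow_mat_mult2[OF U(1)])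
  also have "U (Suc k) * W (Suc k) ^\<^sub>m n = V k * W (Suc k) ^\<^sub>m n"
    using arg_cong[OF U_eq_V, of "\<lambda>A. A * W (Suc k) ^\<^sub>m n"] .
  also have "\<dots> = lincomb (rk (Suc k)) (rk (Suc k)) N (\<lambda>p. 1)
     (\<lambda>p. lincomb (rk (Suc k)) (rk (Suc k)) N (\<lambda>q. T $$ (p, q)) (\<lambda>q. C k p * (A k q * W (Suc k) ^\<^sub>m n)))"
    unfolding V_def lincomb_mult_right[OF lincomb_carrier Wpow(1)] lincomb_mult_right[OF mult_carrier_mat[OF C A] Wpow(1)]
    by (simp only: assoc_mult_mat[OF C A Wpow(1)])
  also have "mtrace \<dots> = (\<Sum>p<N. \<Sum>q<N. T $$ (p, q) * mtrace (C k p * (A k q * W (Suc k) ^\<^sub>m n)))"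
    by (subst mtrace_lincomb[OF lincomb_carrier]) (simp add: mtrace_lincomb[OF mult_carrier_mat[OF C mult_carrier_mat[OF A Wpow(1)]]])
  also have "\<dots> = (\<Sum>p<N. \<Sum>q<N. fconst (ext_index N k n) * (T $$ (p, q) * (Om ^\<^sub>m n) $$ (q, p)))"
    by (intro sum.cong refl) (use creation_trace in \<open>simp add: fconst_mult_mult[where a = "T $$ (p, q)" for p q]\<close>)
  also have "\<dots> = fconst (ext_index N k n) * mtrace (T * Om ^\<^sub>m n)"
    using T Om by (simp add: mtrace_carrier[of _ N N] index_mult_mat_sum[of _ N N _ N] sum_distrib_left)
  also have "T * Om ^\<^sub>m n = T ^\<^sub>m (2 * n + 1)"
    using pow_mat_Suc_left[OF T(1), of "2 * n"] by (simp add: pow_mat_mult2[OF T(1)])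
  finally show ?thesis by (simp add: ext_bundle_def)
qed

end

end

section \<open>Dual numbers\<close>

text \<open>The body of a value is the rank, the soul the odd Chern character. Multiplicativity under tensor
  products says that the odd Chern character is a derivation over the rank.\<close>

datatype 'n dual = Dual (body: complex) (soul: "'n form")

instantiation dual :: ("{finite, linorder}") comm_ring_1
begin
definition "0 = Dual 0 0"
definition "1 = Dual 1 0"
definition "a + b = Dual (body a + body b) (soul a + soul b)"
definition "- a = Dual (- body a) (- soul a)"
definition "a - b = Dual (body a - body b) (soul a - soul b)"
definition "a * b = Dual (body a * body b) (fconst (body a) * soul b + fconst (body b) * soul a)"

instance
  by standard (auto simp: zero_dual_def one_dual_def plus_dual_def uminus_dual_def minus_dual_def times_dual_def
      algebra_simps fconst.hom_add fconst.hom_mult intro!: form_eqI)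
end

lemma of_nat_dual: "of_nat n = Dual (of_nat n) 0"
  by (induction n) (simp_all add: zero_dual_def one_dual_def plus_dual_def)

lemma of_int_dual: "of_int n = Dual (of_int n) 0"
  by (cases n rule: int_cases2) (simp_all add: of_nat_dual uminus_dual_def)

lemma soul_sum_list: "soul (sum_list ds) = sum_list (map soul ds)"
  by (induction ds) (simp_all add: zero_dual_def plus_dual_def)

context open_nbhd
begin

definition dual_char :: "'n abundle \<Rightarrow> 'n dual" where
  "dual_char b = Dual (of_nat (arank b)) (odd_chern_char b x)"

lemma odd_chern_char_trivial: "odd_chern_char (trivial n) x = 0"
proof -
  have "mtrace (maurer_cartan (trivial n) x ^\<^sub>m (2 * k + 1)) = 0" for k
    by (simp add: maurer_cartan_trivial pow_0_mat mtrace_def del: pow_mat.simps)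
  then show ?thesis by (simp add: odd_chern_char_def)
qed

lemma dual_valuation: "bundle_valuation regular dual_char"
proof unfold_locales
  fix a b :: "'n abundle" and n k
  show "regular (trivial n)" by (rule regular_trivial)
  show "dual_char (trivial n) = of_nat n"
    by (simp add: dual_char_def of_nat_dual odd_chern_char_trivial) (simp add: trivial_abundle_def)
  assume a: "regular a"
  show "regular (ext_power k a)" by (rule regular_ext_power[OF a])
  assume b: "regular b"
  show "regular (tensor a b)" by (rule regular_tensor(1)[OF a b])
  show "dual_char (tensor a b) = dual_char a * dual_char b"
    by (simp add: dual_char_def times_dual_def odd_chern_char_tensor[OF a b] fconst_of_nat)
      (simp add: tensor_abundle_def)
qed

sublocale dual: bundle_valuation regular dual_char
  by (rule dual_valuation)

lemma odd_ch_eq_soul: "odd_ch V x = soul (dual.hv V)"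
  by (auto simp: odd_ch_def dual.hv_def soul_sum_list o_def of_int_dual times_dual_def dual_char_def
      fconst_of_int intro!: arg_cong[of _ _ sum_list])

lemma dual_char_ext_power_trivial: "dual_char (ext_power k (trivial n)) = of_nat (n choose k)"
proof -
  have "mtrace (maurer_cartan (ext_power k (trivial n)) x ^\<^sub>m (2 * j + 1)) = 0" for j
    unfolding mtrace_ext_power[OF regular_trivial] maurer_cartan_trivial
    by (simp add: pow_0_mat mtrace_def del: pow_mat.simps)
  then show ?thesis
    by (simp add: dual_char_def odd_chern_char_def of_nat_dual)
      (simp add: ext_power_abundle_def trivial_abundle_def length_ext_basis)
qed

lemma inv_ext_dual:
  "dual.inv_ext n k = (if k = 0 then 1 else 0) - (\<Sum>j\<leftarrow>[1..<Suc k]. of_nat (n choose j) * dual.inv_ext n (k - j))"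
  by (subst dual.inv_ext_rec) (simp only: dual_char_ext_power_trivial)

end

section \<open>Index of the virtual bundles\<close>

text \<open>Makes the binomial coefficients polynomials in \<open>N\<close>, so that the identities
  below are checked by field arithmetic.\<close>

lemma of_nat_choose_small:
  "of_nat (N choose 2) = (of_nat N * (of_nat N - 1) / 2 :: complex)"
  "of_nat (N choose 3) = (of_nat N * (of_nat N - 1) * (of_nat N - 2) / 6 :: complex)"
  "of_nat (N choose 4) = (of_nat N * (of_nat N - 1) * (of_nat N - 2) * (of_nat N - 3) / 24 :: complex)"
proof -
  show 2: "of_nat (N choose 2) = (of_nat N * (of_nat N - 1) / 2 :: complex)" for N
    by (induction N) (simp_all add: numeral_2_eq_2 field_simps)
  show 3: "of_nat (N choose 3) = (of_nat N * (of_nat N - 1) * (of_nat N - 2) / 6 :: complex)" for N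
  proof (induction N)
    case (Suc N)
    have S: "of_nat (Suc N choose 3) = (of_nat (N choose 2) + of_nat (N choose 3) :: complex)"
      by (simp add: numeral_3_eq_3 numeral_2_eq_2)
    show ?case unfolding S 2 Suc by (simp add: field_simps)
  qed simp
  show "of_nat (N choose 4) = (of_nat N * (of_nat N - 1) * (of_nat N - 2) * (of_nat N - 3) / 24 :: complex)"
  proof (induction N)
    case (Suc N)
    have S: "of_nat (Suc N choose 4) = (of_nat (N choose 3) + of_nat (N choose 4) :: complex)"
      by (simp add: eval_nat_numeral)
    show ?case unfolding S 3 Suc by (simp add: field_simps)
  qed simp
qed

text \<open>The numbers 1, -8, 27, -64 are signed cubes; the exponent 3 belongs to the trace of
  degree 7 = 2 * 3 + 1.\<close>

lemma ext_index_3: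
  "ext_index N 0 3 = 0" "ext_index N (Suc 0) 3 = 1" "ext_index N 2 3 = of_nat N - 8"
  "ext_index N 3 3 = of_nat (N choose 2) - 8 * of_nat N + 27"
  "ext_index N 4 3 = of_nat (N choose 3) - 8 * of_nat (N choose 2) + 27 * of_nat N - 64"
  by (simp_all add: eval_nat_numeral)

context open_nbhd
begin

text \<open>Division by the exterior power series of the trivial bundle removes all dependence on
  the rank and leaves the signed cubes.\<close>

lemma hv_vext_small:
  fixes b :: "'n abundle" and \<tau> :: "'n form"
  assumes b: "regular b" and ext: "\<And>k. odd_chern_char (ext_power k b) x = fconst (ext_index (arank b) k 3) * \<tau>"
  shows "dual.hv (vext 2 (reduced b)) = Dual 0 (fconst (- 8) * \<tau>)"
    "dual.hv (vext 3 (reduced b)) = Dual 0 (fconst 27 * \<tau>)"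
    "dual.hv (vext 4 (reduced b)) = Dual 0 (fconst (- 64) * \<tau>)"
proof -
  let ?N = "arank b"
  let ?n = "of_nat ?N :: complex"
  have four: "4 = Suc (Suc (Suc (Suc 0)))" by simp
  note choose_Suc = of_nat_choose_small(1)[unfolded numeral_2_eq_2, of ?N]
    of_nat_choose_small(2)[unfolded numeral_3_eq_3, of ?N] of_nat_choose_small(3)[of ?N, unfolded four]
  have e: "dual_char (ext_power k b) = Dual (of_nat (?N choose k)) (fconst (ext_index ?N k 3) * \<tau>)" for k
    by (simp add: dual_char_def ext) (simp add: ext_power_abundle_def length_ext_basis)
  have rank: "bundle_rank b = ?N" by (simp add: bundle_rank_abundle_def)
  \<comment> \<open>These are the coefficients of (1 + t)^(-N), with no odd part.\<close>
  have i0: "dual.inv_ext ?N 0 = Dual 1 0" by (subst inv_ext_dual) (simp add: one_dual_def)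
  have i1: "dual.inv_ext ?N (Suc 0) = Dual (- ?n) 0"
    by (subst inv_ext_dual) (simp add: i0 of_nat_dual times_dual_def zero_dual_def plus_dual_def minus_dual_def uminus_dual_def)
  have i2: "dual.inv_ext ?N 2 = Dual (?n * (?n + 1) / 2) 0"
    by (subst inv_ext_dual)
      (simp add: upt_rec numeral_2_eq_2 i0 i1 of_nat_dual times_dual_def zero_dual_def minus_dual_def plus_dual_def uminus_dual_def,
       simp add: of_nat_choose_small(1)[unfolded numeral_2_eq_2] field_simps)
  have i3: "dual.inv_ext ?N 3 = Dual (- ?n * (?n + 1) * (?n + 2) / 6) 0"
    by (subst inv_ext_dual)
      (simp add: upt_rec i0 i1 i2 of_nat_dual times_dual_def zero_dual_def minus_dual_def plus_dual_def uminus_dual_def,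
       simp add: choose_Suc of_nat_choose_small field_simps)
  have i4: "dual.inv_ext ?N 4 = Dual (?n * (?n + 1) * (?n + 2) * (?n + 3) / 24) 0"
    by (subst inv_ext_dual)
      (simp add: upt_rec i0 i1 i2 i3 of_nat_dual times_dual_def zero_dual_def minus_dual_def plus_dual_def uminus_dual_def,
       simp add: choose_Suc of_nat_choose_small field_simps)
  have comb: "fconst c * \<tau> + fconst d * \<tau> = fconst (c + d) * \<tau>" "fconst c * (fconst d * \<tau>) = fconst (c * d) * \<tau>" for c d
    by (simp_all add: fconst.hom_add fconst.hom_mult distrib_right mult.assoc)
  have e0: "dual_char (ext_power 0 b) = Dual 1 (fconst 0 * \<tau>)"
    using e[of 0] by (simp only: ext_index_3) simp
  have e1: "dual_char (ext_power (Suc 0) b) = Dual ?n (fconst 1 * \<tau>)"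
    using e[of "Suc 0"] by (simp only: ext_index_3) simp
  have e2: "dual_char (ext_power (Suc (Suc 0)) b) = Dual (?n * (?n - 1) / 2) (fconst (?n - 8) * \<tau>)"
    using e[of 2] by (simp only: ext_index_3 of_nat_choose_small numeral_2_eq_2[symmetric])
  have e3: "dual_char (ext_power (Suc (Suc (Suc 0))) b) =
      Dual (?n * (?n - 1) * (?n - 2) / 6) (fconst (?n * (?n - 1) / 2 - 8 * ?n + 27) * \<tau>)"
    using e[of 3] by (simp only: ext_index_3 of_nat_choose_small numeral_3_eq_3[symmetric])
  have e4: "dual_char (ext_power (Suc (Suc (Suc (Suc 0)))) b) =
      Dual (?n * (?n - 1) * (?n - 2) * (?n - 3) / 24)
        (fconst (?n * (?n - 1) * (?n - 2) / 6 - 8 * (?n * (?n - 1) / 2) + 27 * ?n - 64) * \<tau>)"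
    using e[of 4] by (simp only: ext_index_3 of_nat_choose_small four[symmetric])
  note i = i0 i1 i2 i3 i4 and e = e0 e1 e2 e3 e4
  show "dual.hv (vext 2 (reduced b)) = Dual 0 (fconst (- 8) * \<tau>)"
    unfolding dual.hv_vext_reduced[OF b] rank
    by (simp add: upt_rec e i comb times_dual_def plus_dual_def zero_dual_def del: fconst.hom_zero fconst.hom_one)
      (simp add: field_simps)
  show "dual.hv (vext 3 (reduced b)) = Dual 0 (fconst 27 * \<tau>)"
    unfolding dual.hv_vext_reduced[OF b] rank
    by (simp add: upt_rec e i comb times_dual_def plus_dual_def zero_dual_def del: fconst.hom_zero fconst.hom_one)
      (simp add: field_simps)
  show "dual.hv (vext 4 (reduced b)) = Dual 0 (fconst (- 64) * \<tau>)"
    unfolding dual.hv_vext_reduced[OF b] rank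
    by (simp add: upt_rec e i comb times_dual_def plus_dual_def zero_dual_def del: fconst.hom_zero fconst.hom_one)
      (simp add: field_simps)
qed

text \<open>Reduced factors have rank zero, so products of two of them vanish. What is left is the
  rank of \<open>S\<close> times 2 * (-8) + 1 = -15 for \<open>eta1\<close>, and times 2 * (-64) + 1
  - 8 = -135 for \<open>eta2\<close>. Relative to -1/16 these are 240 and 2160.\<close>

lemma eta_ratio:
  fixes S E :: "'n abundle" and \<tau> :: "'n form"
  assumes S: "regular S" and E: "regular E"
    and \<tau>: "odd_chern_char E x = \<tau>"
    and ext: "\<And>k. odd_chern_char (ext_power k E) x = fconst (ext_index (arank E) k 3) * \<tau>"
    and spin: "odd_chern_char S x = fconst (- of_nat (arank S) / 16) * \<tau>"
  shows "eta0 S x = fconst (- of_nat (arank S) / 16) * \<tau>"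
    "eta1 S E x = fconst (240 * (- of_nat (arank S) / 16)) * \<tau>"
    "eta2 S E x = fconst (2160 * (- of_nat (arank S) / 16)) * \<tau>"
proof -
  note v = hv_vext_small[OF E ext]
  have S': "dual_char S = Dual (of_nat (arank S)) (fconst (- of_nat (arank S) / 16) * \<tau>)"
    by (simp add: dual_char_def spin)
  have E': "dual.hv (reduced E) = Dual 0 \<tau>"
    by (simp add: dual.hv_reduced dual_char_def \<tau> bundle_rank_abundle_def of_nat_dual minus_dual_def)
  show "eta0 S x = fconst (- of_nat (arank S) / 16) * \<tau>"
    by (simp add: eta0_def odd_ch_eq_soul S')
  have good: "dual.vgood (reduced E)" "dual.vgood (vext k (reduced E))" for k using E by simp_all
  show "eta1 S E x = fconst (240 * (- of_nat (arank S) / 16)) * \<tau>"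
    unfolding eta1_def Let_def odd_ch_eq_soul
    using S good by (intro form_eqI) (simp add: S' E' v of_int_dual times_dual_def plus_dual_def minus_dual_def)
  show "eta2 S E x = fconst (2160 * (- of_nat (arank S) / 16)) * \<tau>"
    unfolding eta2_def Let_def odd_ch_eq_soul
    using S good by (intro form_eqI) (simp add: S' E' v of_int_dual times_dual_def plus_dual_def minus_dual_def)
qed

end

section \<open>Maurer--Cartan forms of orthogonal matrices\<close>

text \<open>For anticommuting entries the square of a skew matrix is again skew, with commuting
  entries, so the fourth power is symmetric; a skew matrix times a symmetric one has trace
  zero.\<close>

lemma mtrace_skew_pow_5:
  fixes T :: "'n::{finite,linorder} form mat"
  assumes T: "T \<in> carrier_mat N N" "mdeg 1 T"
    and skew: "\<And>i j. i < N \<Longrightarrow> j < N \<Longrightarrow> T $$ (j, i) = - T $$ (i, j)"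
  shows "mtrace (T ^\<^sub>m 5) = 0"
proof -
  let ?O = "T * T"
  have Om: "?O \<in> carrier_mat N N" "mdeg 2 ?O"
    using T mdeg_mult[OF T(2,2,1,1)] by (auto simp: numeral_2_eq_2)
  have skew_Om: "?O $$ (j, i) = - ?O $$ (i, j)" if ij: "i < N" "j < N" for i j
  proof -
    have "?O $$ (j, i) = (\<Sum>k<N. - (T $$ (i, k) * T $$ (k, j)))"
      unfolding index_mult_mat_sum[OF T(1,1) ij(2,1)]
    proof (intro sum.cong refl)
      fix k assume "k \<in> {..<N}"
      then have k: "k < N" by simp
      show "T $$ (j, k) * T $$ (k, i) = - (T $$ (i, k) * T $$ (k, j))"
        using skew[OF k ij(2)] skew[OF ij(1) k] odd_anticommute[OF mdegD[OF T(2,1) k ij(2)] _ mdegD[OF T(2,1) ij(1) k]] by simp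
    qed
    then show ?thesis unfolding index_mult_mat_sum[OF T(1,1) ij] by (simp add: sum_negf)
  qed
  have sym: "(?O * ?O) $$ (j, i) = (?O * ?O) $$ (i, j)" if ij: "i < N" "j < N" for i j
    unfolding index_mult_mat_sum[OF Om(1,1) ij(2,1)] index_mult_mat_sum[OF Om(1,1) ij]
  proof (intro sum.cong refl)
    fix k assume "k \<in> {..<N}"
    then have k: "k < N" by simp
    show "?O $$ (j, k) * ?O $$ (k, i) = ?O $$ (i, k) * ?O $$ (k, j)"
      using skew_Om[OF k ij(2)] skew_Om[OF ij(1) k] even_commute[OF mdegD[OF Om(2,1) k ij(2)] _ mdegD[OF Om(2,1) ij(1) k]] by simp
  qed
  have OO: "?O * ?O \<in> carrier_mat N N" using Om by simp
  have tr: "mtrace (T * (?O * ?O)) = (\<Sum>i<N. \<Sum>j<N. T $$ (i, j) * (?O * ?O) $$ (j, i))"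
    by (simp add: mtrace_carrier[OF mult_carrier_mat[OF T(1) OO]] index_mult_mat_sum[OF T(1) OO])
  also have "\<dots> = (\<Sum>i<N. \<Sum>j<N. - (T $$ (j, i) * (?O * ?O) $$ (i, j)))"
  proof (intro sum.cong refl)
    fix i j assume "i \<in> {..<N}" "j \<in> {..<N}"
    then have ij: "i < N" "j < N" by auto
    show "T $$ (i, j) * (?O * ?O) $$ (j, i) = - (T $$ (j, i) * (?O * ?O) $$ (i, j))"
      unfolding skew[OF ij] sym[OF ij] by simp
  qed
  also have "\<dots> = - (\<Sum>j<N. \<Sum>i<N. T $$ (j, i) * (?O * ?O) $$ (i, j))"
    by (subst sum.swap) (simp add: sum_negf)
  finally have "mtrace (T * (?O * ?O)) = - mtrace (T * (?O * ?O))" unfolding tr .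
  then have "mtrace (T * (?O * ?O)) = 0" by (rule form_double_eq_0)
  moreover have "T ^\<^sub>m 5 = T * (?O * ?O)"
    using pow_mat_Suc_left[OF T(1), of 4] pow_mat_mult2[OF T(1), of 2] Om
    by (simp add: numeral_2_eq_2 eval_nat_numeral del: pow_mat.simps) (simp add: numeral_2_eq_2 eval_nat_numeral)
  ultimately show ?thesis by simp
qed

context open_nbhd
begin

lemma orthogonal_abundle:
  fixes b :: "'n abundle"
  assumes m: "mfun X x N N (aut b)" and rank: "arank b = N"
    and orth: "\<And>y. y \<in> X \<Longrightarrow> transpose_mat (aut b y) * aut b y = 1\<^sub>m N"
  shows "regular b"
    and "\<And>i j. i < N \<Longrightarrow> j < N \<Longrightarrow> maurer_cartan b x $$ (j, i) = - maurer_cartan b x $$ (i, j)"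
proof -
  have c: "aut b y \<in> carrier_mat N N" if "y \<in> X" for y using m that by (auto simp: mfun_def)
  note cx = c[OF X(2)] and ox = orth[OF X(2)]
  have inv: "aut b x * transpose_mat (aut b x) = 1\<^sub>m N"
    using cx by (intro mat_mult_left_right_inverse[OF _ _ ox]) auto
  show "regular b"
    unfolding regular_def rank using m cx ox inv by (auto intro!: bexI[of _ "transpose_mat (aut b x)"])
  have minv: "minv (aut b x) = transpose_mat (aut b x)"
    using cx by (intro minv_eq[OF cx _ inv ox]) auto
  fix i j assume ij: "i < N" "j < N"
  have mc: "maurer_cartan b x $$ (i, j) = (\<Sum>k<N. fconst (aut b x $$ (k, i)) * dfun (\<lambda>y. aut b y $$ (k, j)) x)"
    if "i < N" "j < N" for i j
  proof -
    have "cmat (transpose_mat (aut b x)) \<in> carrier_mat N N" using cx by simp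
    from index_mult_mat_sum[OF this dmx_carrier that] show ?thesis
      unfolding maurer_cartan_eq rank minv using cx that by simp
  qed
  have d: "(\<lambda>y. aut b y $$ (k, l)) differentiable at x" if "k < N" "l < N" for k l
    using m that by (auto simp: mfun_def)
  \<comment> \<open>The constant entries of the orthogonality relation are differentiated.\<close>
  have "0 = dfun (\<lambda>y. if i = j then 1 else 0) x" by simp
  also have "\<dots> = dfun (\<lambda>y. \<Sum>k<N. aut b y $$ (k, i) * aut b y $$ (k, j)) x"
  proof (rule dfun_transform[OF _ X])
    fix y assume y: "y \<in> X"
    have "(transpose_mat (aut b y) * aut b y) $$ (i, j) = (\<Sum>k<N. aut b y $$ (k, i) * aut b y $$ (k, j))"
      using c[OF y] ij by (subst index_mult_mat_sum[of _ N N _ N]) auto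
    then show "(if i = j then 1 else 0) = (\<Sum>k<N. aut b y $$ (k, i) * aut b y $$ (k, j))"
      using orth[OF y] ij by simp
  qed simp
  also have "\<dots> = (\<Sum>k<N. fconst (aut b x $$ (k, i)) * dfun (\<lambda>y. aut b y $$ (k, j)) x +
      fconst (aut b x $$ (k, j)) * dfun (\<lambda>y. aut b y $$ (k, i)) x)"
    using d ij by (subst dfun_sum) (auto intro!: differentiable_mult dfun_mult sum.cong)
  also have "\<dots> = maurer_cartan b x $$ (i, j) + maurer_cartan b x $$ (j, i)"
    by (simp add: mc ij sum.distrib)
  finally show "maurer_cartan b x $$ (j, i) = - maurer_cartan b x $$ (i, j)"
    by (simp add: eq_neg_iff_add_eq_0 add.commute)
qed

end

text \<open>The terms \<open>n = 1\<close> and \<open>n = 2\<close> vanish by assumption and those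
  with \<open>n > 3\<close> exceed the dimension.\<close>

lemma odd_chern_char_top:
  fixes b :: "7 abundle"
  assumes "maurer_cartan b x \<in> carrier_mat n n" "mdeg 1 (maurer_cartan b x)"
    and "mtrace (maurer_cartan b x ^\<^sub>m 3) = 0" "mtrace (maurer_cartan b x ^\<^sub>m 5) = 0"
  shows "odd_chern_char b x = fconst (fact 3 / fact 7 * (1 / (2 * pi * \<i>)) ^ 4) * mtrace (maurer_cartan b x ^\<^sub>m 7)"
proof -
  have zero: "mtrace (maurer_cartan b x ^\<^sub>m (2 * k + 1)) = 0" if "k \<noteq> 3" "k > 0" for k
  proof -
    consider "k = 1" | "k = 2" | "k > 3" using \<open>k \<noteq> 3\<close> \<open>k > 0\<close> by linarith
    then show ?thesis
    proof cases
      case 3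
      have "hdeg ((2 * k + 1) * 1) (mtrace (maurer_cartan b x ^\<^sub>m (2 * k + 1)))"
        by (rule hdeg_mtrace[OF mdeg_pow[OF assms(2,1)] pow_carrier_mat[OF assms(1)]])
      then show ?thesis by (rule hdeg_large_eq_0) (use 3 in simp)
    qed (use assms in \<open>simp_all add: numeral_eq_Suc\<close>)
  qed
  have "odd_chern_char b x = (\<Sum>k\<in>{3}. fconst (fact k / fact (2 * k + 1) * (1 / (2 * pi * \<i>)) ^ (k + 1)) *
     mtrace (maurer_cartan b x ^\<^sub>m (2 * k + 1)))"
    unfolding odd_chern_char_def by (rule sum.mono_neutral_right) (use zero in auto)
  then show ?thesis by simp
qed

section \<open>Charts\<close>

lemma smooth_on_differentiable: "smooth_on S f \<Longrightarrow> x \<in> S \<Longrightarrow> f differentiable at x"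
  unfolding smooth_on_def by (metis cont_diff.simps(2))

lemma smooth_map_mfun:
  fixes f :: "'a \<Rightarrow> complex mat"
  assumes "smooth_map M (topspace (space_of M)) n f" "c \<in> atlas M" "fst c \<subseteq> topspace (space_of M)"
    "open (snd c ` fst c)" "x \<in> snd c ` fst c" "\<And>y. y \<in> snd c ` fst c \<Longrightarrow> f (chart_inv c y) \<in> carrier_mat n n"
  shows "mfun (snd c ` fst c) x n n (\<lambda>y. f (chart_inv c y))"
proof -
  have "fst c \<inter> topspace (space_of M) = fst c" using assms(3) by auto
  then have "smooth_mat_on (snd c ` fst c) n (f \<circ> chart_inv c)"
    using assms(1,2) unfolding smooth_map_def by metis
  then show ?thesis using assms(5,6) unfolding mfun_def smooth_mat_on_def o_def
    by (auto intro: smooth_on_differentiable)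
qed

lemma smooth_map_mfun_of_real:
  fixes f :: "'a \<Rightarrow> real mat"
  assumes "smooth_map M (topspace (space_of M)) n f" "c \<in> atlas M" "fst c \<subseteq> topspace (space_of M)"
    "open (snd c ` fst c)" "x \<in> snd c ` fst c" "\<And>y. y \<in> snd c ` fst c \<Longrightarrow> f (chart_inv c y) \<in> carrier_mat n n"
  shows "mfun (snd c ` fst c) x n n (\<lambda>y. map_mat complex_of_real (f (chart_inv c y)))"
  unfolding mfun_def
proof (intro conjI ballI allI impI)
  fix i j assume ij: "i < n" "j < n"
  have "fst c \<inter> topspace (space_of M) = fst c" using assms(3) by auto
  then have "smooth_mat_on (snd c ` fst c) n (f \<circ> chart_inv c)"
    using assms(1,2) unfolding smooth_map_def by metis
  then have "(\<lambda>y. f (chart_inv c y) $$ (i, j)) differentiable at x"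
    using assms(5) ij unfolding smooth_mat_on_def o_def by (auto intro: smooth_on_differentiable)
  then have "(\<lambda>y. complex_of_real (f (chart_inv c y) $$ (i, j))) differentiable at x"
    unfolding differentiable_def by (auto intro: has_derivative_of_real)
  then show "(\<lambda>y. map_mat complex_of_real (f (chart_inv c y)) $$ (i, j)) differentiable at x"
  proof (rule differentiable_transform_within_open[OF _ assms(4,5)])
    fix y assume "y \<in> snd c ` fst c"
    then show "complex_of_real (f (chart_inv c y) $$ (i, j)) = map_mat complex_of_real (f (chart_inv c y)) $$ (i, j)"
      using assms(6)[of y] ij by auto
  qed
qed (use assms(6) in auto)

section \<open>The odd characteristic forms at a point of a chart\<close>

lemma odd_characters:
  fixes M :: "'a manifold" and g :: "'a \<Rightarrow> real mat" and g\<Delta> :: "'a \<Rightarrow> complex mat"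
  assumes N: "even N" and M: "oriented_manifold M"
    and SO: "\<forall>p\<in>topspace (space_of M). g p \<in> SO N" and g: "smooth_map M (topspace (space_of M)) N g"
    and spin: "\<forall>p\<in>topspace (space_of M). spin_covers N (g\<Delta> p) (g p)"
    and g\<Delta>: "smooth_map M (topspace (space_of M)) (spinor_dim N) g\<Delta>"
    and c3: "\<forall>c\<in>atlas M. \<forall>y\<in>snd c ` fst c. chern_form3 (vector_abundle N g c) y = 0"
    and c: "c \<in> atlas M" and x: "x \<in> snd c ` fst c"
  obtains \<tau> e where "hdeg 7 \<tau>" "eta0 (spinor_abundle N g\<Delta> c) x = fconst e * \<tau>"
    "eta1 (spinor_abundle N g\<Delta> c) (vector_abundle N g c) x = fconst (240 * e) * \<tau>"
    "eta2 (spinor_abundle N g\<Delta> c) (vector_abundle N g c) x = fconst (2160 * e) * \<tau>"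
proof -
  let ?X = "snd c ` fst c" and ?EC = "vector_abundle N g c" and ?SE = "spinor_abundle N g\<Delta> c"
  let ?D = "spinor_dim N"
  have op: "open ?X" using M c unfolding oriented_manifold_def by (auto simp: case_prod_unfold)
  have sub: "fst c \<subseteq> topspace (space_of M)" using M c unfolding oriented_manifold_def by blast
  interpret open_nbhd ?X x by unfold_locales (rule op, rule x)
  have inv: "chart_inv c y \<in> topspace (space_of M)" if "y \<in> ?X" for y
    using that sub inv_into_into[of y "snd c" "fst c"] unfolding chart_inv_def by auto
  have gN: "g (chart_inv c y) \<in> carrier_mat N N" "transpose_mat (g (chart_inv c y)) * g (chart_inv c y) = 1\<^sub>m N"
    "spin_covers N (g\<Delta> (chart_inv c y)) (g (chart_inv c y))" if "y \<in> ?X" for y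
    using SO spin inv[OF that] by (auto simp: SO_def)
  have spinN: "g\<Delta> (chart_inv c y) \<in> carrier_mat ?D ?D"
    "\<exists>b\<in>carrier_mat ?D ?D. g\<Delta> (chart_inv c y) * b = 1\<^sub>m ?D \<and> b * g\<Delta> (chart_inv c y) = 1\<^sub>m ?D" if "y \<in> ?X" for y
    using Spin_invertible[OF N, of "g\<Delta> (chart_inv c y)"] gN(3)[OF that] by (auto simp: spin_covers_def)
  have rE: "arank ?EC = N" "aut ?EC = (\<lambda>y. map_mat complex_of_real (g (chart_inv c y)))"
    and rS: "arank ?SE = ?D" "aut ?SE = (\<lambda>y. g\<Delta> (chart_inv c y))"
    by (simp_all add: vector_abundle_def spinor_abundle_def)
  have mE: "mfun ?X x N N (aut ?EC)"
    unfolding rE by (rule smooth_map_mfun_of_real[OF g c sub op x gN(1)])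
  have orth: "transpose_mat (aut ?EC y) * aut ?EC y = 1\<^sub>m N" if "y \<in> ?X" for y
  proof -
    have "transpose_mat (aut ?EC y) * aut ?EC y = map_mat complex_of_real (transpose_mat (g (chart_inv c y)) * g (chart_inv c y))"
      unfolding rE using gN(1)[OF that] by (subst of_real_hom.mat_hom_mult[of _ N N _ N]) (auto simp: map_mat_transpose)
    then show ?thesis unfolding gN(2)[OF that] by (simp add: of_real_hom.mat_hom_one)
  qed
  note E = orthogonal_abundle[OF mE rE(1) orth]
  have S: "regular ?SE"
    unfolding regular_def rS using smooth_map_mfun[OF g\<Delta> c sub op x spinN(1)] spinN(2)[OF x] by auto
  let ?T = "maurer_cartan ?EC x" and ?U = "maurer_cartan ?SE x"
  have T: "?T \<in> carrier_mat N N" "mdeg 1 ?T" and U: "?U \<in> carrier_mat ?D ?D" "mdeg 1 ?U"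
    using maurer_cartan_carrier[OF E(1)] mdeg_maurer_cartan[OF E(1)] maurer_cartan_carrier[OF S] mdeg_maurer_cartan[OF S] rE rS by auto
  \<comment> \<open>The covering property of the lift says that Clifford multiplication is
    equivariant; this is its derivative.\<close>
  have rel: "?U * cmat (clifford_gen N j) = cmat (clifford_gen N j) * ?U +
      lincomb ?D ?D N (\<lambda>i. ?T $$ (i, j)) (\<lambda>i. cmat (clifford_gen N i))" if "j < N" for j
  proof -
    have "aut ?SE y * clifford_gen N j = lincomb (arank ?SE) (arank ?SE) (arank ?EC)
      (\<lambda>i. aut ?EC y $$ (i, j)) (\<lambda>i. clifford_gen N i * aut ?SE y)" if "y \<in> ?X" "j < arank ?EC" for y j
      unfolding rE rS using spin_covers_rel[OF gN(3)[OF that(1)] _ N, of j] that(2) gN(1)[OF that(1)]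
      by (auto simp: rE intro!: trans[OF spin_covers_rel[OF gN(3)[OF that(1)] _ N] lincomb_cong])
    from maurer_cartan_intertwine[OF S S E(1) _ this, of j] show ?thesis using that by (simp add: rE rS)
  qed
  have cliff: "mtrace (?U ^\<^sub>m (2 * n + 1)) = fconst (clifford_shift (of_nat ?D) n / 4) * mtrace (?T ^\<^sub>m (2 * n + 1))"
    if "n \<in> {1, 2, 3}" for n
    by (rule mtrace_clifford[OF U T E(2) clifford_gen_carrier clifford_gen_anticommute[OF N] clifford_gen_schur[OF N] rel that])
  have T3: "mtrace (?T ^\<^sub>m 3) = 0"
  proof (rule form_eqI)
    fix I
    have "fconst ((1 / (2 * pi * \<i>)) ^ 2) * mtrace (?T ^\<^sub>m 3) = 0"
      using c3 c x unfolding chern_form3_def by blast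
    from arg_cong[OF this, of "\<lambda>f. coeff f I"] show "coeff (mtrace (?T ^\<^sub>m 3)) I = coeff 0 I" by simp
  qed
  have T5: "mtrace (?T ^\<^sub>m 5) = 0" by (rule mtrace_skew_pow_5[OF T E(2)])
  define \<tau> where "\<tau> = odd_chern_char ?EC x"
  let ?k = "fact 3 / fact 7 * (1 / (2 * pi * \<i>)) ^ 4"
  have \<tau>: "\<tau> = fconst ?k * mtrace (?T ^\<^sub>m 7)"
    unfolding \<tau>_def by (rule odd_chern_char_top[OF T T3 T5])
  \<comment> \<open>Only the degree 7 component is left in each character, with the same prefactor,
    so a ratio of traces is a ratio of characters.\<close>
  have proportional: "odd_chern_char b x = fconst s * \<tau>"
    if "regular b" "mtrace (maurer_cartan b x ^\<^sub>m 3) = 0" "mtrace (maurer_cartan b x ^\<^sub>m 5) = 0"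
      "mtrace (maurer_cartan b x ^\<^sub>m 7) = fconst s * mtrace (?T ^\<^sub>m 7)" for b s
    unfolding odd_chern_char_top[OF maurer_cartan_carrier[OF that(1)] mdeg_maurer_cartan[OF that(1)] that(2,3)] \<tau> that(4)
    by (rule fconst_mult_mult)
  have ext: "odd_chern_char (ext_power k ?EC) x = fconst (ext_index (arank ?EC) k 3) * \<tau>" for k
    using mtrace_ext_power[OF E(1), of k 1] mtrace_ext_power[OF E(1), of k 2] mtrace_ext_power[OF E(1), of k 3] T3 T5
    by (intro proportional regular_ext_power[OF E(1)]) simp_all
  \<comment> \<open>The factor is \<open>clifford_shift d 3 / 4 = - d / 16\<close> for the spinor
    rank \<open>d\<close>.\<close>
  have spinor: "odd_chern_char ?SE x = fconst (- of_nat (arank ?SE) / 16) * \<tau>"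
    using cliff[of 1] cliff[of 2] cliff[of 3] T3 T5
    by (intro proportional S) (simp_all add: clifford_shift_def rS)
  note eta = eta_ratio[OF S E(1) \<tau>_def[symmetric] ext spinor]
  have "hdeg (7 * 1) (mtrace (?T ^\<^sub>m 7))"
    by (rule hdeg_mtrace[OF mdeg_pow[OF T(2,1)] pow_carrier_mat[OF T(1)]])
  then have "hdeg 7 \<tau>" unfolding \<tau> by (intro hdeg_fconst_mult) simp
  then show ?thesis using eta by (rule that)
qed

theorem theorem4p2:
  "\<exists>N0. \<forall>N\<ge>N0. even N \<longrightarrow>
    (\<forall>(M :: 'a manifold) (met :: 'a metric_tensor)
      (P :: ('a, 'p) pbundle) (fr :: ('a, 'p) frame_map)
      (Pi :: ('a, 'q) pbundle) (Ai :: ('a, 'q) gauge_potential)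
      (Pj :: ('a, 'r) pbundle) (Aj :: ('a, 'r) gauge_potential)
      (\<rho> :: complex mat \<Rightarrow> complex mat)
      (g :: 'a \<Rightarrow> real mat) (g\<Delta> :: 'a \<Rightarrow> complex mat).
      oriented_manifold M \<and> riemannian_metric M met \<and> spin_structure M met P fr \<and>
      principal_bundle M 248 E8 Pi \<and> principal_connection M 248 E8 e8_compact Pi Ai \<and>
      principal_bundle M 248 E8 Pj \<and> principal_connection M 248 E8 e8_compact Pj Aj \<and>
      E8_irreducible 3875 \<rho> \<and>
      (\<forall>x\<in>topspace (space_of M). g x \<in> SO N) \<and>
      smooth_map M (topspace (space_of M)) N g \<and>
      (\<forall>x\<in>topspace (space_of M). spin_covers N (g\<Delta> x) (g x)) \<and>
      smooth_map M (topspace (space_of M)) (spinor_dim N) g\<Delta> \<and>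
      (\<forall>c\<in>atlas M. \<forall>y\<in>snd c ` fst c. chern_form3 (vector_abundle N g c) y = 0)
      \<longrightarrow>
      (\<forall>c\<in>atlas M. \<forall>\<sigma>\<in>sections P. \<forall>\<sigma>i\<in>sections Pi. \<forall>\<sigma>j\<in>sections Pj.
        \<forall>y\<in>snd c ` (fst c \<inter> fst \<sigma> \<inter> fst \<sigma>i \<inter> fst \<sigma>j).
        let e = local_frame fr \<sigma> c;
            TM = tangent_bundle (met c) e;
            S = spinor_bundle (met c) e;
            Wi = W_bundle (Ai \<sigma>i c); Wbi = Wbar_bundle \<rho> (Ai \<sigma>i c);
            Wj = W_bundle (Aj \<sigma>j c); Wbj = Wbar_bundle \<rho> (Aj \<sigma>j c);
            EC = vector_abundle N g c; SE = spinor_abundle N g\<Delta> c;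
            cc = chern2 Wi y + chern2 Wj y;
            \<mu>0 = m0 8 S y; \<mu>1 = m1 8 S TM y; \<mu>2 = m2 8 S TM y;
            \<beta>1 = b1 cc Wi Wj y; \<beta>2 = b2 cc Wi Wj Wbi Wbj y;
            \<eta>0 = eta0 SE y; \<eta>1 = eta1 SE EC y; \<eta>2 = eta2 SE EC y;
            q = fexp (fconst (1 / 720) * cc) * A_hat TM y
        in degree_part 7 (q * (\<mu>2 * \<eta>0 + \<mu>1 * \<eta>1 + \<mu>0 * \<eta>2
               + \<beta>1 * (\<mu>1 * \<eta>0 + \<mu>0 * \<eta>1) + \<beta>2 * \<mu>0 * \<eta>0))
           = 196560 * degree_part 7 (q * \<mu>0 * \<eta>0)
             - 24 * degree_part 7 (q * (\<mu>1 * \<eta>0 + \<mu>0 * \<eta>1 + \<beta>1 * \<mu>0 * \<eta>0))))"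
\<comment> \<open>The rank computations are polynomial identities in \<open>N\<close>, so the bound
  0 serves as witness.\<close>
proof (rule exI[of _ 0], intro allI impI ballI, elim conjE, goal_cases)
  case (1 N M met P fr Pi Ai Pj Aj \<rho> g g\<Delta> c \<sigma> \<sigma>i \<sigma>j y)
  let ?e = "local_frame fr \<sigma> c"
  let ?TM = "tangent_bundle (met c) ?e" and ?S = "spinor_bundle (met c) ?e"
  let ?Wi = "W_bundle (Ai \<sigma>i c)" and ?Wbi = "Wbar_bundle \<rho> (Ai \<sigma>i c)"
  let ?Wj = "W_bundle (Aj \<sigma>j c)" and ?Wbj = "Wbar_bundle \<rho> (Aj \<sigma>j c)"
  let ?cc = "chern2 ?Wi y + chern2 ?Wj y"
  have y: "y \<in> snd c ` fst c" using 1 by auto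
  obtain \<tau> e where \<tau>: "hdeg 7 \<tau>" "eta0 (spinor_abundle N g\<Delta> c) y = fconst e * \<tau>"
    "eta1 (spinor_abundle N g\<Delta> c) (vector_abundle N g c) y = fconst (240 * e) * \<tau>"
    "eta2 (spinor_abundle N g\<Delta> c) (vector_abundle N g c) y = fconst (2160 * e) * \<tau>"
    by (rule odd_characters[of N M g g\<Delta> c y]) (use 1 y in blast)+
  note n = nilpotent_conn_characteristic[of y]
  \<comment> \<open>Second Chern forms are of degree 4, so the exponential prefactor has constant
    term 1.\<close>
  have cc: "coeff ?cc {} = 0" by (simp add: chern2_def coeff_degree_part)
  have q: "coeff (fexp (fconst (1 / 720) * ?cc) * A_hat ?TM y) {} = 1"
    using cc by (simp only: aug.hom_mult aug_A_hat[OF n(1)] aug_fexp coeff_fconst_mult mult_zero_right mult_1)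
  show ?case
    unfolding Let_def
    by (rule top_degree_reduction[OF \<tau> q])
      (simp_all only: aug_m0[OF n(2)] aug_m1[OF n(2,1)] aug_m2[OF n(2,1)] aug_b1[OF n(3,3) cc]
        aug_b2[OF n(3,3,4,4) cc] crank_characteristic, simp_all)
qed

end
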